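(* Let $K\subset\mathbb{R}$ be an algebraic number field and let $m$ be a positive integer. Then the $K$-density $\delta_K(\mathbf{m\text{-}Sect},[-1,1])$ exists. It equals $1$ when $m$ is a power of two, and it equals $0$ otherwise.
   Context: An "angle" is a complex number $\alpha$ with $|\alpha|=1$. A complex number $\beta$ is constructible over a set $S\ni 0,1$ if it can be obtained by an unmarked straightedge-and-compass construction starting from the points of $S$. An angle $\alpha$ is $m$-sectable if there is an angle $\beta$ with $\beta^m=\alpha$ constructible over $\{0,1,\alpha\}$. $\mathbf{m\text{-}Sect}$ denotes the set $\{\mathrm{Re}(\alpha):\alpha \text{ an } m\text{-sectable angle}\}\subseteq[-1,1]$. Height: for a number field $K$, let $M_K$ be the canonical set of absolute values $|\cdot|_v$ on $K$, namely all extensions to $K$ of the usual absolute value and of the $p$-adic absolute values $|p^e c/d|_p=p^{-e}$ ($p\nmid c,d$) on $\mathbb{Q}$, each equipped with its weight $n_v$ (the local degree) so that the product formula $\prod_{v\in M_K}|x|_v^{n_v}=1$ holds for $x\in K^*$. The height of $x\in K$ is $H_K(x)=\prod_{v\in M_K}\max\{1,|x|_v^{n_v}\}$; for each real $B\ge1$ the set $H_K^{-1}[1,B]=\{x\in K: H_K(x)\le B\}$ is finite and nonempty. Density: for sets $S\subseteq T\subseteq\mathbb{C}$ with $1\in T$ and real $B\ge1$, put $\delta_K(S,T;B)=|S\cap H_K^{-1}[1,B]|/|T\cap H_K^{-1}[1,B]|$; the $K$-density $\delta_K(S,T)$ is $\lim_{B\to\infty}\delta_K(S,T;B)$ when this limit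 exists. *)

theory Defs
  imports "HOL-Analysis.Analysis" "HOL-Algebra.Algebraic_Closure_Type"
begin

section \<open>Straightedge and compass\<close>

text \<open>
  Points and figures (lines and circles) are generated simultaneously. The compass is the
  non-collapsing one: it transfers the distance between two constructed points to a third.
\<close>

inductive_set constructible :: "complex set \<Rightarrow> complex set"
  and drawable :: "complex set \<Rightarrow> complex set set"
  for S :: "complex set" where
  given: "z \<in> S \<Longrightarrow> z \<in> constructible S"
| straightedge: "\<lbrakk>a \<in> constructible S; b \<in> constructible S; a \<noteq> b\<rbrakk>
    \<Longrightarrow> affine hull {a, b} \<in> drawable S"
| compass: "\<lbrakk>c \<in> constructible S; a \<in> constructible S; b \<in> constructible S; a \<noteq> b\<rbrakk>
    \<Longrightarrow> sphere c (dist a b) \<in> drawable S"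
| intersection: "\<lbrakk>F \<in> drawable S; G \<in> drawable S; F \<noteq> G; z \<in> F \<inter> G\<rbrakk>
    \<Longrightarrow> z \<in> constructible S"

definition angle :: "complex \<Rightarrow> bool" where
  "angle \<alpha> \<longleftrightarrow> norm \<alpha> = 1"

definition sectable :: "nat \<Rightarrow> complex \<Rightarrow> bool" where
  "sectable m \<alpha> \<longleftrightarrow> angle \<alpha> \<and> (\<exists>\<beta>. angle \<beta> \<and> \<beta> ^ m = \<alpha> \<and> \<beta> \<in> constructible {0, 1, \<alpha>})"

definition Sect :: "nat \<Rightarrow> real set" where
  "Sect m = {Re \<alpha> | \<alpha>. sectable m \<alpha>}"


section \<open>Number fields and their absolute values\<close>

definition number_field :: "'a::field_char_0 set \<Rightarrow> bool" where
  "number_field K \<longleftrightarrow>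
     subfield K ring_of_type_algebra \<and> ring.finite_dimension ring_of_type_algebra \<rat> K"

text \<open>Absolute values are extensional, so that two of them are equal iff they agree on \<open>K\<close>.\<close>

definition absolute_value_on :: "'a::field_char_0 set \<Rightarrow> ('a \<Rightarrow> real) \<Rightarrow> bool" where
  "absolute_value_on K v \<longleftrightarrow>
     v \<in> extensional K \<and>
     (\<forall>x\<in>K. 0 \<le> v x \<and> (v x = 0 \<longleftrightarrow> x = 0)) \<and>
     (\<forall>x\<in>K. \<forall>y\<in>K. v (x * y) = v x * v y) \<and>
     (\<forall>x\<in>K. \<forall>y\<in>K. v (x + y) \<le> v x + v y)"

definition padic_abs :: "nat \<Rightarrow> rat \<Rightarrow> real" where
  "padic_abs p q =
     (if q = 0 then 0
      else real p powi (int (multiplicity (int p) (snd (quotient_of q)))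
                        - int (multiplicity (int p) (fst (quotient_of q)))))"

definition canonical_abs :: "'a::field_char_0 set \<Rightarrow> ('a \<Rightarrow> real) set" where
  "canonical_abs K =
     {v. absolute_value_on K v \<and>
         ((\<forall>q. v (of_rat q) = \<bar>of_rat q\<bar>) \<or>
          (\<exists>p. Factorial_Ring.prime p \<and> (\<forall>q. v (of_rat q) = padic_abs p q)))}"


section \<open>Completions and local degrees\<close>

definition cauchy_seqs :: "'a::field_char_0 set \<Rightarrow> ('a \<Rightarrow> real) \<Rightarrow> (nat \<Rightarrow> 'a) ring" where
  "cauchy_seqs K v =
     \<lparr>carrier = {s. range s \<subseteq> K \<and> (\<forall>e>0. \<exists>N. \<forall>i\<ge>N. \<forall>j\<ge>N. v (s i - s j) < e)},
      mult = (\<lambda>s t n. s n * t n), one = (\<lambda>_. 1),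
      zero = (\<lambda>_. 0), add = (\<lambda>s t n. s n + t n)\<rparr>"

definition null_seqs :: "'a::field_char_0 set \<Rightarrow> ('a \<Rightarrow> real) \<Rightarrow> (nat \<Rightarrow> 'a) set" where
  "null_seqs K v = {s \<in> carrier (cauchy_seqs K v). (\<lambda>n. v (s n)) \<longlonglongrightarrow> 0}"

definition completion :: "'a::field_char_0 set \<Rightarrow> ('a \<Rightarrow> real) \<Rightarrow> (nat \<Rightarrow> 'a) set ring" where
  "completion K v = cauchy_seqs K v Quot null_seqs K v"

text \<open>The completion of the rationals, as a subfield of the completion of \<open>K\<close>.\<close>

definition rat_completion :: "'a::field_char_0 set \<Rightarrow> ('a \<Rightarrow> real) \<Rightarrow> (nat \<Rightarrow> 'a) set set" where
  "rat_completion K v =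
     {null_seqs K v +>\<^bsub>cauchy_seqs K v\<^esub> s | s. s \<in> carrier (cauchy_seqs K v) \<and> range s \<subseteq> \<rat>}"

definition local_degree :: "'a::field_char_0 set \<Rightarrow> ('a \<Rightarrow> real) \<Rightarrow> nat" where
  "local_degree K v =
     ring.dim (completion K v) (rat_completion K v) (carrier (completion K v))"


section \<open>Height and density\<close>

text \<open>
  A \<^const>\<open>prod\<close> over an infinite set is 1 by convention, so the product is taken over the
  absolute values whose factor differs from 1.
\<close>

definition height :: "'a::field_char_0 set \<Rightarrow> 'a \<Rightarrow> real" where
  "height K x =
     (\<Prod>v \<in> {v \<in> canonical_abs K. max 1 (v x ^ local_degree K v) \<noteq> 1}.
        max 1 (v x ^ local_degree K v))"

definition bounded_height :: "'a::field_char_0 set \<Rightarrow> real \<Rightarrow> 'a set" where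
  "bounded_height K B = {x \<in> K. height K x \<le> B}"

definition density_upto ::
    "'a::field_char_0 set \<Rightarrow> 'a set \<Rightarrow> 'a set \<Rightarrow> real \<Rightarrow> real" where
  "density_upto K S T B =
     real (card (S \<inter> bounded_height K B)) / real (card (T \<inter> bounded_height K B))"

definition has_density :: "'a::field_char_0 set \<Rightarrow> 'a set \<Rightarrow> 'a set \<Rightarrow> real \<Rightarrow> bool" where
  "has_density K S T d \<longleftrightarrow> (density_upto K S T \<longlongrightarrow> d) at_top"

end

theory Submission
  imports Defs
begin

text \<open>
  Write \<open>m = 2 ^ k * n\<close> with \<open>n\<close> odd. Bisection is always possible, which settles \<open>n = 1\<close>. In general,
  a constructible \<open>m\<close>-th root of an angle \<open>\<alpha>\<close> with real part \<open>x \<in> K\<close> lies in a tower of quadratic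
  extensions of \<open>K(\<alpha>)\<close>, and taking relative norms down the tower produces an \<open>n\<close>-th root of \<open>\<alpha>\<close> in
  \<open>K(\<alpha>)\<close> itself. Its real part \<open>y\<close> lies in \<open>K\<close> and \<open>x = T\<^sub>n(y)\<close> for the Chebyshev polynomial \<open>T\<^sub>n\<close>.
  The height of \<open>T\<^sub>n(y)\<close> is at least a constant times \<open>H(y) ^ n\<close>, so for \<open>n > 1\<close> and any constant \<open>c\<close> the
  sectable \<open>x\<close> with \<open>H(x) \<le> B\<close> come from points \<open>y \<in> [-1, 1]\<close> with \<open>H(y) \<le> B / c\<close> once \<open>B\<close> is large.
  No asymptotic count of points of bounded height is needed: the interval \<open>[-1, 1]\<close> contains \<open>M\<close>
  disjoint rational affine copies of itself, so for a suitable \<open>c\<close> it has at least \<open>M\<close> times as many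
  points of height at most \<open>B\<close> as of height at most \<open>B / c\<close>.
\<close>

text \<open>The densities make sense only after several finiteness facts: \<open>card\<close> of an
  infinite set is 0, \<open>prod\<close> over an infinite set is 1, and \<open>dim\<close> has a
  definite value only in finite dimension. Hence the bulk of the work: each absolute value of \<rat>
  has finitely many extensions to K, local degrees are finite and positive, and Northcott's theorem
  holds. Northcott in turn needs K to carry enough absolute values, as otherwise elements with large
  denominators or conjugates could have small height. They are built by Zorn's lemma: the p-adic
  ones by Chevalley's extension theorem, the archimedean ones by extending a partial embedding into
  \<complex>. Height inequalities are proved place by place. A constant is tolerable at finitely
  many places but must be exactly 1 at all others. As T_n has leading coefficient 2 ^ (n - 1), only
  archimedean and dyadic places cost a constant in the bound for H(T_n(y)). Coordinates of
  constructible points force i into the ground field of the tower; one last norm step removes it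
  again.\<close>

hide_const (open) Polynomials.degree Polynomials.lead_coeff up_ring.coeff up_ring.monom
  module.smult Divisibility.prime

section \<open>Subfields and quadratic towers\<close>

locale field_set =
  fixes F :: "'a::field_char_0 set"
  assumes one: "1 \<in> F"
    and diff: "x \<in> F \<Longrightarrow> y \<in> F \<Longrightarrow> x - y \<in> F"
    and mult: "x \<in> F \<Longrightarrow> y \<in> F \<Longrightarrow> x * y \<in> F"
    and inverse: "x \<in> F \<Longrightarrow> inverse x \<in> F"
begin

lemma zero: "0 \<in> F"
  using diff[OF one one] by simp

lemma uminus: "x \<in> F \<Longrightarrow> - x \<in> F"
  using diff[OF zero] by fastforce

lemma add: "x \<in> F \<Longrightarrow> y \<in> F \<Longrightarrow> x + y \<in> F"
  using diff[of x "- y"] uminus by fastforce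

lemma divide: "x \<in> F \<Longrightarrow> y \<in> F \<Longrightarrow> x / y \<in> F"
  using mult inverse by (simp add: divide_inverse)

lemma power: "x \<in> F \<Longrightarrow> x ^ n \<in> F"
  by (induction n) (auto intro: one mult)

lemma of_nat: "of_nat n \<in> F"
  by (induction n) (auto intro: zero one add)

lemma of_int: "of_int n \<in> F"
  by (cases n) (auto intro: of_nat uminus simp del: of_nat_Suc)

lemma of_rat: "of_rat q \<in> F"
  by (cases q) (auto simp: of_rat_rat intro: divide of_int)

lemma numeral: "numeral n \<in> F"
  using of_nat[of "numeral n"] by simp

lemma sum: "(\<And>i. i \<in> I \<Longrightarrow> f i \<in> F) \<Longrightarrow> sum f I \<in> F"
  by (induction I rule: infinite_finite_induct) (auto intro: zero add)

lemmas closed = zero one add diff uminus mult inverse divide power of_nat of_int of_rat numeral sum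

end

text \<open>This is the field F(r) as soon as r * r \<in> F. The element r may already lie in F, so
  tower steps may be trivial and irreducibility need not be tracked.\<close>

definition adjoin :: "'a::field_char_0 set \<Rightarrow> 'a \<Rightarrow> 'a set" where
  "adjoin F r = {a + b * r | a b. a \<in> F \<and> b \<in> F}"

lemma adjoinI: "a \<in> F \<Longrightarrow> b \<in> F \<Longrightarrow> a + b * r \<in> adjoin F r"
  unfolding adjoin_def by blast

context field_set
begin

lemma subset_adjoin: "F \<subseteq> adjoin F r"
  unfolding adjoin_def using zero by force

lemma in_adjoin: "r \<in> adjoin F r"
  unfolding adjoin_def using zero one by force

lemma adjoin_trivial: "r \<in> F \<Longrightarrow> adjoin F r = F"
  using subset_adjoin by (auto simp: adjoin_def intro: closed)

lemma norm_adjoin_nonzero: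
  assumes "r \<notin> F" "a \<in> F" "b \<in> F" "a + b * r \<noteq> 0"
  shows "a\<^sup>2 - b\<^sup>2 * (r * r) \<noteq> 0"
proof
  assume "a\<^sup>2 - b\<^sup>2 * (r * r) = 0"
  then have "(a + b * r) * (a - b * r) = 0"
    by (simp add: algebra_simps power2_eq_square)
  with assms(4) have eq: "a = b * r" by simp
  show False
  proof (cases "b = 0")
    case True
    then show False using eq assms(4) by simp
  next
    case False
    then have "r = a / b" using eq by simp
    then show False using divide[OF assms(2,3)] assms(1) by simp
  qed
qed

lemma field_set_adjoin:
  assumes "r * r \<in> F"
  shows "field_set (adjoin F r)"
proof (cases "r \<in> F")
  case True
  then show ?thesis using adjoin_trivial field_set_axioms by simp
next
  case False
  show ?thesis
  proof
    show "1 \<in> adjoin F r" using subset_adjoin one by blast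
  next
    fix x y assume "x \<in> adjoin F r" "y \<in> adjoin F r"
    then obtain a b c d where xy: "x = a + b * r" "y = c + d * r" and F: "a \<in> F" "b \<in> F" "c \<in> F" "d \<in> F"
      unfolding adjoin_def by blast
    have "x - y = (a - c) + (b - d) * r" by (simp add: xy algebra_simps)
    then show "x - y \<in> adjoin F r" using adjoinI[OF diff[OF F(1,3)] diff[OF F(2,4)]] by simp
    have "x * y = (a * c + b * d * (r * r)) + (a * d + b * c) * r" by (simp add: xy algebra_simps)
    moreover have "a * c + b * d * (r * r) \<in> F" "a * d + b * c \<in> F"
      using F assms by (auto intro!: add mult[OF _ assms] mult[OF F(1,3)] mult[OF F(2,4)] mult[OF F(1,4)] mult[OF F(2,3)])
    ultimately show "x * y \<in> adjoin F r" using adjoinI by simp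
  next
    fix x assume "x \<in> adjoin F r"
    then obtain a b where x: "x = a + b * r" and F: "a \<in> F" "b \<in> F"
      unfolding adjoin_def by blast
    show "inverse x \<in> adjoin F r"
    proof (cases "x = 0")
      case True
      then show ?thesis using subset_adjoin zero by auto
    next
      case nz: False
      define N where "N = a\<^sup>2 - b\<^sup>2 * (r * r)"
      have "N \<noteq> 0" using norm_adjoin_nonzero[OF False F] nz x N_def by simp
      moreover have "x * (a - b * r) = N" by (simp add: x N_def algebra_simps power2_eq_square)
      ultimately have "x * ((a - b * r) / N) = 1" by simp
      then have "inverse x = (a - b * r) / N" by (rule inverse_unique)
      then have "inverse x = a / N + (- b / N) * r"
        by (simp add: diff_divide_distrib)
      moreover have "N \<in> F" unfolding N_def using F assms by (intro diff mult[OF _ assms] power)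
      ultimately show ?thesis using adjoinI[OF divide[OF F(1)] divide[OF uminus[OF F(2)]]] by simp
    qed
  qed
qed

text \<open>
  The relative norm of an \<open>n\<close>-th root of \<open>\<alpha>\<close> is an \<open>n\<close>-th root \<open>\<nu>\<close> of \<open>\<alpha>\<^sup>2\<close>; for
  \<open>n = 2 * k + 1\<close>, the quotient \<open>\<alpha> / \<nu> ^ k\<close> is then an \<open>n\<close>-th root of \<open>\<alpha>\<close>.
\<close>

lemma odd_root_descent:
  assumes r: "r * r \<in> F" and \<alpha>: "\<alpha> \<in> F" and \<gamma>: "\<gamma> \<in> adjoin F r" "\<gamma> ^ n = \<alpha>" and n: "odd n"
  shows "\<exists>\<delta>\<in>F. \<delta> ^ n = \<alpha>"
proof (cases "r \<in> F \<or> \<alpha> = 0")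
  case True
  then show ?thesis using \<gamma> adjoin_trivial zero n by (metis odd_pos zero_power)
next
  case False
  then have rF: "r \<notin> F" and nz: "\<alpha> \<noteq> 0" by auto
  obtain a b where ab: "\<gamma> = a + b * r" "a \<in> F" "b \<in> F"
    using \<gamma>(1) unfolding adjoin_def by blast
  \<comment> \<open>Conjugation r \<mapsto> - r is simulated: the powers of both conjugates are
    computed together, with the same A and B.\<close>
  have "\<exists>A B. A \<in> F \<and> B \<in> F \<and> (a + b * r) ^ k = A + B * r \<and> (a - b * r) ^ k = A - B * r" for k
  proof (induction k)
    case 0
    then show ?case using zero one by (intro exI[of _ 1] exI[of _ 0]) auto
  next
    case (Suc k)
    then obtain A B where AB: "A \<in> F" "B \<in> F"
      "(a + b * r) ^ k = A + B * r" "(a - b * r) ^ k = A - B * r" by blast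
    have "a * A + b * B * (r * r) \<in> F" "a * B + b * A \<in> F"
      using AB ab r by (auto intro!: add mult)
    then show ?case
      using AB by (intro exI[of _ "a * A + b * B * (r * r)"] exI[of _ "a * B + b * A"])
        (auto simp: algebra_simps)
  qed
  then obtain A B where AB: "A \<in> F" "B \<in> F"
    "(a + b * r) ^ n = A + B * r" "(a - b * r) ^ n = A - B * r" by blast
  \<comment> \<open>As \<alpha> \<in> F, the r-component of \<gamma> ^ n vanishes, so the conjugate
    of \<gamma> is an n-th root of \<alpha> as well.\<close>
  have "B = 0"
  proof (rule ccontr)
    assume "B \<noteq> 0"
    then have "r = (\<alpha> - A) / B" using AB(3) \<gamma>(2) ab(1) by (simp add: field_simps)
    then show False using rF AB \<alpha> closed by metis
  qed
  then have conj: "(a - b * r) ^ n = \<alpha>" using AB \<gamma>(2) ab(1) by simp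
  define \<nu> where "\<nu> = a * a - b * b * (r * r)"
  have \<nu>F: "\<nu> \<in> F" unfolding \<nu>_def by (rule diff[OF mult[OF ab(2,2)] mult[OF mult[OF ab(3,3)] r]])
  have "\<nu> = (a + b * r) * (a - b * r)" by (simp add: \<nu>_def algebra_simps)
  then have \<nu>n: "\<nu> ^ n = \<alpha> * \<alpha>" using conj \<gamma>(2) ab(1) by (simp add: power_mult_distrib)
  obtain k where k: "n = 2 * k + 1" using n oddE by blast
  have "(\<alpha> / \<nu> ^ k) ^ n = \<alpha> ^ n / (\<nu> ^ n) ^ k"
    by (simp add: power_divide mult.commute flip: power_mult)
  also have "\<dots> = \<alpha> ^ n / (\<alpha> * \<alpha>) ^ k"
    by (simp only: \<nu>n)
  also have "\<alpha> ^ n = \<alpha> * (\<alpha> * \<alpha>) ^ k"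
    by (simp add: k power_mult power2_eq_square)
  finally have "(\<alpha> / \<nu> ^ k) ^ n = \<alpha>" using nz by simp
  then show ?thesis using \<alpha> \<nu>F divide power by blast
qed

end

inductive_set quadratic_tower :: "'a::field_char_0 set \<Rightarrow> 'a set set" for L where
  base: "L \<in> quadratic_tower L"
| step: "F \<in> quadratic_tower L \<Longrightarrow> r * r \<in> F \<Longrightarrow> adjoin F r \<in> quadratic_tower L"

lemma field_set_quadratic_tower:
  "F \<in> quadratic_tower L \<Longrightarrow> field_set L \<Longrightarrow> field_set F"
  by (induction rule: quadratic_tower.induct) (auto intro: field_set.field_set_adjoin)

text \<open>The quadratic steps are peeled off one at a time by \<open>odd_root_descent\<close>,
  which needs \<alpha> in every intermediate field; hence the inclusion L \<subseteq> F.\<close>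

lemma quadratic_tower_odd_root:
  assumes "F \<in> quadratic_tower L" "field_set L" "\<alpha> \<in> L" "odd n" "\<exists>\<gamma>\<in>F. \<gamma> ^ n = \<alpha>"
  shows "L \<subseteq> F \<and> (\<exists>\<gamma>\<in>L. \<gamma> ^ n = \<alpha>)"
  using assms
proof (induction rule: quadratic_tower.induct)
  case (step F r)
  have F: "field_set F" using field_set_quadratic_tower step.hyps(1) step.prems(1) .
  have sub: "L \<subseteq> F"
    using step.hyps(1)
  proof (induction rule: quadratic_tower.induct)
    case (step F r)
    then show ?case
      using field_set.subset_adjoin[OF field_set_quadratic_tower[OF step.hyps(1) \<open>field_set L\<close>]] by blast
  qed auto
  then have "\<exists>\<gamma>\<in>F. \<gamma> ^ n = \<alpha>"
    using field_set.odd_root_descent[OF F step.hyps(2)] step.prems by blast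
  then show ?case
    using step field_set.subset_adjoin[OF F] by blast
qed auto


section \<open>Coordinates of constructible points\<close>

text \<open>One equation covers circles (A = 1) and lines (A = 0). With A normalised, the difference
  of two circle equations is linear; the condition on B and C keeps a line from degenerating to the
  plane or the empty set.\<close>

definition curve_over :: "real set \<Rightarrow> complex set \<Rightarrow> bool" where
  "curve_over E G \<longleftrightarrow> (\<exists>A B C D. A \<in> E \<and> B \<in> E \<and> C \<in> E \<and> D \<in> E \<and>
     (A = 1 \<or> A = 0 \<and> (B \<noteq> 0 \<or> C \<noteq> 0)) \<and>
     G = {z. A * ((Re z)\<^sup>2 + (Im z)\<^sup>2) + B * Re z + C * Im z + D = 0})"

lemma curve_overI:
  assumes "A \<in> E" "B \<in> E" "C \<in> E" "D \<in> E" "A = 1 \<or> A = 0 \<and> (B \<noteq> 0 \<or> C \<noteq> 0)"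
  shows "curve_over E {z. A * ((Re z)\<^sup>2 + (Im z)\<^sup>2) + B * Re z + C * Im z + D = 0}"
  unfolding curve_over_def
  by (rule exI[of _ A], rule exI[of _ B], rule exI[of _ C], rule exI[of _ D]) (use assms in simp)

lemma curve_over_mono:
  assumes "curve_over E G" "E \<subseteq> E'"
  shows "curve_over E' G"
proof -
  obtain A B C D where "A \<in> E" "B \<in> E" "C \<in> E" "D \<in> E"
    and nd: "A = 1 \<or> A = 0 \<and> (B \<noteq> 0 \<or> C \<noteq> 0)"
    and G: "G = {z. A * ((Re z)\<^sup>2 + (Im z)\<^sup>2) + B * Re z + C * Im z + D = 0}"
    using assms(1) unfolding curve_over_def by blast
  with assms(2) have "A \<in> E'" "B \<in> E'" "C \<in> E'" "D \<in> E'" by auto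
  then show ?thesis unfolding G using nd by (rule curve_overI)
qed

definition quadratic_over :: "real set \<Rightarrow> real \<Rightarrow> real \<Rightarrow> bool" where
  "quadratic_over E x y \<longleftrightarrow>
     (\<exists>r. r * r \<in> E \<and> (\<forall>E'. field_set E' \<longrightarrow> E \<subseteq> E' \<longrightarrow> r \<in> E' \<longrightarrow> x \<in> E' \<and> y \<in> E'))"

lemma line_circle_quadratic_aux:
  fixes x y :: real
  assumes E: "field_set E" "B \<in> E" "C \<in> E" "D \<in> E" "E1 \<in> E" "E2 \<in> E" "E3 \<in> E"
    and line: "B * x + C * y + D = 0" and circle: "x\<^sup>2 + y\<^sup>2 + E1 * x + E2 * y + E3 = 0"
    and B: "B \<noteq> 0"
  shows "quadratic_over E x y"
proof -
  \<comment> \<open>Eliminating x through the line and clearing B gives a y^2 + b y + c = 0. Setting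
    r = 2 a y + b picks the square root of the discriminant that belongs to this y, so no sign has
    to be chosen.\<close>
  define a b c where "a = C * C + B * B" and "b = 2 * C * D - E1 * B * C + E2 * B * B"
    and "c = D * D - E1 * B * D + E3 * B * B"
  define r where "r = 2 * a * y + b"
  have x: "x = - (C * y + D) / B" using line B by (simp add: field_simps)
  have "B * B * (x\<^sup>2 + y\<^sup>2 + E1 * x + E2 * y + E3) = 0" using circle by simp
  then have "(B * x) * (B * x) + B * B * y * y + E1 * B * (B * x) + E2 * B * B * y + E3 * B * B = 0"
    by (simp add: algebra_simps power2_eq_square)
  moreover have "B * x = - (C * y + D)" using line by simp
  ultimately have quad: "a * y * y + b * y + c = 0"
    by (simp add: a_def b_def c_def algebra_simps)
  have "r * r = b * b - 4 * a * c + 4 * a * (a * y * y + b * y + c)"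
    by (simp add: r_def algebra_simps)
  then have r2: "r * r = b * b - 4 * a * c" using quad by simp
  interpret E: field_set E by fact
  have abc: "a \<in> E" "b \<in> E" "c \<in> E" unfolding a_def b_def c_def
    using E by (auto intro!: E.add E.diff E.mult E.numeral)
  have "a \<noteq> 0" unfolding a_def using B by (simp add: sum_squares_eq_zero_iff)
  have y: "y = (r - b) / (2 * a)" using \<open>a \<noteq> 0\<close> by (simp add: r_def)
  show ?thesis
    unfolding quadratic_over_def
  proof (intro exI[of _ r] conjI allI impI)
    show "r * r \<in> E" unfolding r2 using abc by (intro E.diff E.mult E.numeral)
    fix E' :: "real set" assume E': "field_set E'" "E \<subseteq> E'" "r \<in> E'"
    interpret E': field_set E' by fact
    show yE: "y \<in> E'" unfolding y
      using abc E' by (intro E'.divide E'.diff E'.mult E'.numeral) auto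
    show "x \<in> E'" unfolding x
      using E E' yE by (intro E'.divide E'.uminus E'.add E'.mult) auto
  qed
qed

lemma line_circle_quadratic:
  fixes x y :: real
  assumes E: "field_set E" "B \<in> E" "C \<in> E" "D \<in> E" "E1 \<in> E" "E2 \<in> E" "E3 \<in> E"
    and line: "B * x + C * y + D = 0" and circle: "x\<^sup>2 + y\<^sup>2 + E1 * x + E2 * y + E3 = 0"
    and BC: "B \<noteq> 0 \<or> C \<noteq> 0"
  shows "quadratic_over E x y"
proof (cases "B = 0")
  case False
  then show ?thesis using line_circle_quadratic_aux[OF E] line circle by blast
next
  case True
  then have "C \<noteq> 0" using BC by blast
  then have "quadratic_over E y x"
    using line circle
    by (intro line_circle_quadratic_aux[OF E(1,3,2,4,6,5,7)]) (auto simp: algebra_simps)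
  then show ?thesis unfolding quadratic_over_def by blast
qed

lemma line_line_quadratic:
  fixes x y :: real
  assumes E: "field_set E" "B \<in> E" "C \<in> E" "D \<in> E" "B' \<in> E" "C' \<in> E" "D' \<in> E"
    and l: "B * x + C * y + D = 0" and l': "B' * x + C' * y + D' = 0"
    and det: "B * C' - B' * C \<noteq> 0"
  shows "quadratic_over E x y"
proof -
  interpret E: field_set E by fact
  have "x * (B * C' - B' * C) = C * D' - C' * D" 
  proof -
    have "x * (B * C' - B' * C) = C' * (B * x + C * y + D) - C * (B' * x + C' * y + D') + C * D' - C' * D"
      by (simp add: algebra_simps)
    then show ?thesis using l l' by simp
  qed
  then have x: "x = (C * D' - C' * D) / (B * C' - B' * C)" using det by (simp add: field_simps)
  have "y * (B * C' - B' * C) = B' * D - B * D'" 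
  proof -
    have "y * (B * C' - B' * C) = B * (B' * x + C' * y + D') - B' * (B * x + C * y + D) + B' * D - B * D'"
      by (simp add: algebra_simps)
    then show ?thesis using l l' by simp
  qed
  then have y: "y = (B' * D - B * D') / (B * C' - B' * C)" using det by (simp add: field_simps)
  have "x \<in> E" "y \<in> E" unfolding x y using E by (auto intro!: E.divide E.diff E.mult)
  then show ?thesis unfolding quadratic_over_def using E.zero by (intro exI[of _ 0]) auto
qed

lemma curve_intersection_quadratic:
  assumes E: "field_set E" and G: "curve_over E G" "curve_over E G'" "G \<noteq> G'" "z \<in> G" "z \<in> G'"
  shows "quadratic_over E (Re z) (Im z)"
proof -
  interpret E: field_set E by fact
  obtain A B C D where E1: "A \<in> E" "B \<in> E" "C \<in> E" "D \<in> E" and nd: "A = 1 \<or> A = 0 \<and> (B \<noteq> 0 \<or> C \<noteq> 0)"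
    and Geq: "G = {z. A * ((Re z)\<^sup>2 + (Im z)\<^sup>2) + B * Re z + C * Im z + D = 0}"
    using G(1) unfolding curve_over_def by blast
  obtain A' B' C' D' where E2: "A' \<in> E" "B' \<in> E" "C' \<in> E" "D' \<in> E" and nd': "A' = 1 \<or> A' = 0 \<and> (B' \<noteq> 0 \<or> C' \<noteq> 0)"
    and G'eq: "G' = {z. A' * ((Re z)\<^sup>2 + (Im z)\<^sup>2) + B' * Re z + C' * Im z + D' = 0}"
    using G(2) unfolding curve_over_def by blast
  have eq: "A * ((Re z)\<^sup>2 + (Im z)\<^sup>2) + B * Re z + C * Im z + D = 0"
    using G(4) Geq by simp
  have eq': "A' * ((Re z)\<^sup>2 + (Im z)\<^sup>2) + B' * Re z + C' * Im z + D' = 0"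
    using G(5) G'eq by simp
  consider "A = 0" "A' = 1" | "A = 1" "A' = 0" | "A = 1" "A' = 1" | "A = 0" "A' = 0"
    using nd nd' by blast
  then show ?thesis
  proof cases
    case 1
    then show ?thesis using line_circle_quadratic[OF E E1(2-) E2(2-)] eq eq' nd by simp
  next
    case 2
    then show ?thesis using line_circle_quadratic[OF E E2(2-) E1(2-)] eq eq' nd' by simp
  next
    case 3
    \<comment> \<open>Subtracting two circle equations gives the radical axis. If that degenerates,
      the circles are concentric and, sharing z, equal.\<close>
    have "(B - B') * Re z + (C - C') * Im z + (D - D') = 0"
      using eq eq' 3 by (simp add: algebra_simps)
    moreover have "B - B' \<noteq> 0 \<or> C - C' \<noteq> 0"
    proof (rule ccontr)
      assume "\<not> ?thesis"
      then have "B = B'" "C = C'" by auto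
      moreover from this have "D = D'" using eq eq' 3 by simp
      ultimately show False using G(3) Geq G'eq 3 by simp
    qed
    ultimately show ?thesis
      using line_circle_quadratic[OF E E.diff[OF E1(2) E2(2)] E.diff[OF E1(3) E2(3)]
          E.diff[OF E1(4) E2(4)] E1(2-)] eq 3 by simp
  next
    case 4
    have l: "B * Re z + C * Im z + D = 0" "B' * Re z + C' * Im z + D' = 0" using eq eq' 4 by auto
    \<comment> \<open>Lines with proportional normals and a common point coincide.\<close>
    have "B * C' - B' * C \<noteq> 0"
    proof
      assume det: "B * C' - B' * C = 0"
      obtain k where k: "k \<noteq> 0" "B' = k * B" "C' = k * C"
      proof (cases "B = 0")
        case True
        then have "C \<noteq> 0" "B' = 0" using nd det 4 by auto
        then show ?thesis using that[of "C' / C"] True nd' 4 by simp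
      next
        case False
        then have "C' = (B' / B) * C" using det by (simp add: field_simps)
        then show ?thesis using that[of "B' / B"] False nd' 4 by auto
      qed
      have "D' = k * D + (B' * Re z + C' * Im z + D') - k * (B * Re z + C * Im z + D)"
        by (simp add: k algebra_simps)
      then have "D' = k * D" using l by simp
      then have "B' * x + C' * y + D' = k * (B * x + C * y + D)" for x y
        by (simp add: k algebra_simps)
      then have "G = G'" using Geq G'eq 4 k(1) by simp
      then show False using G(3) by simp
    qed
    then show ?thesis using line_line_quadratic[OF E E1(2-) E2(2-) l] by simp
  qed
qed

lemma affine_hull_curve_over:
  assumes "field_set E" "Re a \<in> E" "Im a \<in> E" "Re b \<in> E" "Im b \<in> E" "a \<noteq> b"
  shows "curve_over E (affine hull {a, b})"
proof -
  interpret E: field_set E by fact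
  define B C where "B = Im a - Im b" and "C = Re b - Re a"
  have nd: "B \<noteq> 0 \<or> C \<noteq> 0" using assms(6) by (auto simp: B_def C_def complex_eq_iff)
  then have N: "C * C + B * B \<noteq> 0" by (auto simp: sum_squares_eq_zero_iff)
  have "affine hull {a, b} = {z. B * Re z + C * Im z + (- B * Re a - C * Im a) = 0}" (is "?L = ?R")
  proof (intro Set.set_eqI iffI)
    fix z assume "z \<in> ?L"
    then obtain u v where "z = u *\<^sub>R a + v *\<^sub>R b" "u + v = 1" by (auto simp: affine_hull_2)
    then have "z = (1 - v) *\<^sub>R a + v *\<^sub>R b" by (simp add: eq_diff_eq)
    then have "Re z = (1 - v) * Re a + v * Re b" "Im z = (1 - v) * Im a + v * Im b" by simp_all
    then show "z \<in> ?R" unfolding mem_Collect_eq B_def C_def by (simp only:) (simp add: algebra_simps)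
  next
    fix z assume "z \<in> ?R"
    then have eq: "B * (Re z - Re a) + C * (Im z - Im a) = 0" by (simp add: algebra_simps)
    \<comment> \<open>The vector (C, - B) is b - a, so v is the coefficient of the orthogonal
      projection of z - a onto b - a.\<close>
    define v where "v = (C * (Re z - Re a) - B * (Im z - Im a)) / (C * C + B * B)"
    define R I where "R = Re z - Re a" and "I = Im z - Im a"
    have v: "v * (C * C + B * B) = C * R - B * I" using N by (simp add: v_def R_def I_def)
    have "(C * C + B * B) * (v * C) = C * (v * (C * C + B * B))" by (simp add: algebra_simps)
    also have "\<dots> = (C * C + B * B) * R - B * (B * R + C * I)" unfolding v by (simp add: algebra_simps)
    finally have 1: "(C * C + B * B) * (v * C) = (C * C + B * B) * R" using eq by (simp add: R_def I_def)
    have "(C * C + B * B) * (v * (- B)) = - B * (v * (C * C + B * B))" by (simp add: algebra_simps)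
    also have "\<dots> = (C * C + B * B) * I - C * (B * R + C * I)" unfolding v by (simp add: algebra_simps)
    finally have "(C * C + B * B) * (v * (- B)) = (C * C + B * B) * I" using eq by (simp add: R_def I_def)
    with 1 have "v * C = R" "v * (- B) = I" using N by (metis mult_cancel_left)+
    then have "z = (1 - v) *\<^sub>R a + v *\<^sub>R b"
      by (simp add: complex_eq_iff B_def C_def R_def I_def algebra_simps)
    then show "z \<in> ?L" unfolding affine_hull_2
      by (intro CollectI exI[of _ "1 - v"] exI[of _ v]) auto
  qed
  moreover have "B \<in> E" "C \<in> E" "- B * Re a - C * Im a \<in> E"
    using assms by (auto simp: B_def C_def intro!: E.diff E.mult E.uminus)
  ultimately show ?thesis using curve_overI[OF E.zero, of B C "- B * Re a - C * Im a"] nd by simp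
qed

lemma sphere_curve_over:
  assumes "field_set E" "Re c \<in> E" "Im c \<in> E" "Re a \<in> E" "Im a \<in> E" "Re b \<in> E" "Im b \<in> E"
  shows "curve_over E (sphere c (dist a b))"
proof -
  interpret E: field_set E by fact
  define D where "D = (Re c)\<^sup>2 + (Im c)\<^sup>2 - (Re a - Re b)\<^sup>2 - (Im a - Im b)\<^sup>2"
  have "sphere c (dist a b) = {z. 1 * ((Re z)\<^sup>2 + (Im z)\<^sup>2) + (-2 * Re c) * Re z + (-2 * Im c) * Im z + D = 0}"
    by (auto simp: D_def dist_norm cmod_def power2_diff algebra_simps)
  moreover have "D \<in> E" "-2 * Re c \<in> E" "-2 * Im c \<in> E"
    unfolding D_def using assms E.numeral by (auto intro!: E.diff E.add E.power E.mult E.uminus)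
  ultimately show ?thesis using curve_overI[OF E.one _ _ _ disjI1[OF refl]] by (simp only:)
qed

text \<open>The real numbers contained in F, which may be fewer than the real parts of its
  elements.\<close>

definition real_part :: "complex set \<Rightarrow> real set" where
  "real_part F = {x. complex_of_real x \<in> F}"

lemma field_set_real_part: "field_set F \<Longrightarrow> field_set (real_part F)"
proof -
  assume "field_set F"
  then interpret field_set F .
  show ?thesis by unfold_locales (auto simp: real_part_def intro: closed)
qed

text \<open>The quantifier over all fields F of the tower replaces composita: several points are
  treated in succession, the field reached for one being the starting field for the next.\<close>

lemma constructible_quadratic_tower:
  assumes L: "field_set L" and S: "\<And>z. z \<in> S \<Longrightarrow> Re z \<in> real_part L \<and> Im z \<in> real_part L"
  shows "z \<in> constructible S \<Longrightarrow>
      \<forall>F\<in>quadratic_tower L. L \<subseteq> F \<longrightarrow> (\<exists>F'\<in>quadratic_tower L. F \<subseteq> F' \<and> Re z \<in> real_part F' \<and> Im z \<in> real_part F')"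
    and "G \<in> drawable S \<Longrightarrow>
      \<forall>F\<in>quadratic_tower L. L \<subseteq> F \<longrightarrow> (\<exists>F'\<in>quadratic_tower L. F \<subseteq> F' \<and> curve_over (real_part F') G)"
proof (induction rule: constructible_drawable.inducts)
  case (given z)
  show ?case
  proof (intro ballI impI)
    fix F assume F: "F \<in> quadratic_tower L" "L \<subseteq> F"
    then have "Re z \<in> real_part F" "Im z \<in> real_part F"
      using S[OF given] by (auto simp: real_part_def)
    then show "\<exists>F'\<in>quadratic_tower L. F \<subseteq> F' \<and> Re z \<in> real_part F' \<and> Im z \<in> real_part F'"
      using F(1) by blast
  qed
next
  case (straightedge a b)
  show ?case
  proof (intro ballI impI)
    fix F assume F: "F \<in> quadratic_tower L" "L \<subseteq> F"
    obtain F1 where F1: "F1 \<in> quadratic_tower L" "F \<subseteq> F1" "Re a \<in> real_part F1" "Im a \<in> real_part F1"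
      using bspec[OF straightedge.IH(2) F(1)] F(2) by blast
    obtain F2 where F2: "F2 \<in> quadratic_tower L" "F1 \<subseteq> F2" "Re b \<in> real_part F2" "Im b \<in> real_part F2"
      using bspec[OF straightedge.IH(4) F1(1)] F(2) F1(2) by blast
    have "curve_over (real_part F2) (affine hull {a, b})"
      using F1 F2 straightedge.hyps field_set_real_part[OF field_set_quadratic_tower[OF F2(1) L]]
      by (intro affine_hull_curve_over) (auto simp: real_part_def)
    then show "\<exists>F'\<in>quadratic_tower L. F \<subseteq> F' \<and> curve_over (real_part F') (affine hull {a, b})"
      using F1 F2 by blast
  qed
next
  case (compass c a b)
  show ?case
  proof (intro ballI impI)
    fix F assume F: "F \<in> quadratic_tower L" "L \<subseteq> F"
    obtain F1 where F1: "F1 \<in> quadratic_tower L" "F \<subseteq> F1" "Re a \<in> real_part F1" "Im a \<in> real_part F1"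
      using bspec[OF compass.IH(4) F(1)] F(2) by blast
    obtain F2 where F2: "F2 \<in> quadratic_tower L" "F1 \<subseteq> F2" "Re b \<in> real_part F2" "Im b \<in> real_part F2"
      using bspec[OF compass.IH(6) F1(1)] F(2) F1(2) by blast
    obtain F3 where F3: "F3 \<in> quadratic_tower L" "F2 \<subseteq> F3" "Re c \<in> real_part F3" "Im c \<in> real_part F3"
      using bspec[OF compass.IH(2) F2(1)] F(2) F1(2) F2(2) by blast
    have "curve_over (real_part F3) (sphere c (dist a b))"
      using F1 F2 F3 field_set_real_part[OF field_set_quadratic_tower[OF F3(1) L]]
      by (intro sphere_curve_over) (auto simp: real_part_def)
    then show "\<exists>F'\<in>quadratic_tower L. F \<subseteq> F' \<and> curve_over (real_part F') (sphere c (dist a b))"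
      using F1 F2 F3 by blast
  qed
next
  case (intersection G G' z)
  show ?case
  proof (intro ballI impI)
    fix F assume F: "F \<in> quadratic_tower L" "L \<subseteq> F"
    obtain F1 where F1: "F1 \<in> quadratic_tower L" "F \<subseteq> F1" "curve_over (real_part F1) G"
      using bspec[OF intersection.IH(2) F(1)] F(2) by blast
    obtain F2 where F2: "F2 \<in> quadratic_tower L" "F1 \<subseteq> F2" "curve_over (real_part F2) G'"
      using bspec[OF intersection.IH(4) F1(1)] F(2) F1(2) by blast
    have field: "field_set F2" using field_set_quadratic_tower[OF F2(1) L] .
    have "curve_over (real_part F2) G"
      by (rule curve_over_mono[OF F1(3)]) (use F2(2) in \<open>auto simp: real_part_def\<close>)
    then have "quadratic_over (real_part F2) (Re z) (Im z)"
      using curve_intersection_quadratic[OF field_set_real_part[OF field]] F2(3) intersection.hyps by blast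
    then obtain r where r: "r * r \<in> real_part F2"
      "\<And>E'. field_set E' \<Longrightarrow> real_part F2 \<subseteq> E' \<Longrightarrow> r \<in> E' \<Longrightarrow> Re z \<in> E' \<and> Im z \<in> E'"
      unfolding quadratic_over_def by blast
    define F3 where "F3 = adjoin F2 (complex_of_real r)"
    have F3: "F3 \<in> quadratic_tower L"
      unfolding F3_def using r(1) F2(1) by (auto intro!: quadratic_tower.step simp: real_part_def)
    have sub: "F2 \<subseteq> F3" "complex_of_real r \<in> F3"
      unfolding F3_def using field_set.subset_adjoin[OF field] field_set.in_adjoin[OF field] by auto
    have "Re z \<in> real_part F3 \<and> Im z \<in> real_part F3"
      using sub field_set_real_part[OF field_set_quadratic_tower[OF F3 L]]
      by (intro r(2)) (auto simp: real_part_def)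
    then show "\<exists>F'\<in>quadratic_tower L. F \<subseteq> F' \<and> Re z \<in> real_part F' \<and> Im z \<in> real_part F'"
      using F1 F2 F3 sub by blast
  qed
qed


section \<open>Sectable angles\<close>

text \<open>The points 0, 1, 1 + \<alpha>, \<alpha> form a rhombus whose diagonal bisects the angle.
  It degenerates for \<alpha> = 1, where 1 is a root, and for \<alpha> = -1, where the perpendicular
  bisector of 1 and -1 yields i.\<close>

lemma unit_square_root_constructible:
  assumes S: "0 \<in> S" "1 \<in> S" and \<alpha>: "\<alpha> \<in> constructible S" "norm \<alpha> = 1"
  shows "\<exists>\<beta>\<in>constructible S. norm \<beta> = 1 \<and> \<beta>\<^sup>2 = \<alpha>"
proof -
  have c01: "0 \<in> constructible S" "1 \<in> constructible S" using S by (auto intro: given)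
  have unit: "sphere c 1 \<in> drawable S" if "c \<in> constructible S" for c
    using compass[OF that c01] by simp
  have on_line: "\<beta> \<in> constructible S"
    if "a \<in> constructible S" "b \<in> constructible S" "a \<noteq> b" "0 \<in> affine hull {a, b}"
      "\<beta> \<in> affine hull {a, b}" "norm \<beta> = 1" for a b \<beta>
  proof -
    have "affine hull {a, b} \<noteq> sphere 0 1" using that(4) by (auto dest: equalityD1)
    then show ?thesis
      using intersection[OF straightedge[OF that(1-3)] unit[OF c01(1)]] that(5,6) by simp
  qed
  consider "\<alpha> = 1" | "\<alpha> = -1" | "\<alpha> \<noteq> 1" "\<alpha> \<noteq> -1" by blast
  then show ?thesis
  proof cases
    case 1
    then show ?thesis using c01 by (intro bexI[of _ 1]) auto
  next
    case 2
    \<comment> \<open>The circles of radius 2 about 1 and -1 meet in P and - P, the apexes of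
      equilateral triangles on the segment from -1 to 1.\<close>
    define P where "P = \<i> * complex_of_real (sqrt 3)"
    have sph: "sphere 1 2 \<in> drawable S" "sphere (-1) 2 \<in> drawable S"
      using compass[OF _ c01(2) \<alpha>(1)] c01 \<alpha>(1) 2 by (auto simp: dist_norm)
    have mem: "P \<in> sphere 1 2 \<inter> sphere (-1) 2" "- P \<in> sphere 1 2 \<inter> sphere (-1) 2"
      by (auto simp: P_def dist_norm cmod_def power_mult_distrib)
    have ne: "sphere (1::complex) 2 \<noteq> sphere (-1) 2"
    proof
      assume "sphere (1::complex) 2 = sphere (-1) 2"
      moreover have "(3::complex) \<in> sphere 1 2" by (simp add: dist_norm)
      ultimately have "(3::complex) \<in> sphere (-1) 2" by simp
      then show False by (simp add: dist_norm)
    qed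
    have P: "P \<in> constructible S" "- P \<in> constructible S"
      using intersection[OF sph ne] mem by blast+
    have "0 \<in> affine hull {P, - P}" unfolding affine_hull_2
      by (intro CollectI exI[of _ "1/2"]) auto
    moreover have "\<i> \<in> affine hull {P, - P}" unfolding affine_hull_2
      by (intro CollectI exI[of _ "(1 + 1 / sqrt 3) / 2"] exI[of _ "(1 - 1 / sqrt 3) / 2"])
        (auto simp: P_def complex_eq_iff field_simps)
    moreover have "P \<noteq> - P" by (simp add: P_def complex_eq_iff)
    ultimately have "\<i> \<in> constructible S" using on_line[OF P] by simp
    then show ?thesis using 2 by (intro bexI[of _ \<i>]) auto
  next
    case 3
    have ne: "sphere 1 1 \<noteq> sphere \<alpha> 1"
    proof
      assume eq: "sphere 1 1 = sphere \<alpha> 1"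
      \<comment> \<open>The point 1 + t lies on the unit circle about 1, on the side away from
        \<alpha>, hence at distance norm (1 - \<alpha>) + 1 from \<alpha>.\<close>
      define t where "t = (1 - \<alpha>) / norm (1 - \<alpha>)"
      have "norm t = 1" using 3 by (simp add: t_def norm_divide)
      then have "1 + t \<in> sphere 1 1" by (simp add: dist_norm)
      then have "1 + t \<in> sphere \<alpha> 1" using eq by simp
      then have "norm (1 + t - \<alpha>) = 1" by (simp add: dist_norm norm_minus_commute)
      moreover have "1 + t - \<alpha> = of_real (1 + 1 / norm (1 - \<alpha>)) * (1 - \<alpha>)"
        by (simp add: t_def algebra_simps)
      then have "norm (1 + t - \<alpha>) = \<bar>1 + 1 / norm (1 - \<alpha>)\<bar> * norm (1 - \<alpha>)"
        by (metis norm_mult norm_of_real real_norm_def)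
      then have "norm (1 + t - \<alpha>) = norm (1 - \<alpha>) + 1"
        using 3 by (simp add: field_simps)
      ultimately show False using 3 by simp
    qed
    have "1 + \<alpha> \<in> constructible S"
      using intersection[OF unit[OF c01(2)] unit[OF \<alpha>(1)] ne] \<alpha>(2) by (simp add: dist_norm)
    moreover have nz: "1 + \<alpha> \<noteq> 0" using 3 by (metis add_eq_0_iff)
    define \<beta> where "\<beta> = (1 + \<alpha>) / norm (1 + \<alpha>)"
    have n\<beta>: "norm \<beta> = 1" using nz by (simp add: \<beta>_def norm_divide)
    have "0 \<in> affine hull {0, 1 + \<alpha>}" by (simp add: hull_inc)
    moreover have "\<beta> \<in> affine hull {0, 1 + \<alpha>}" unfolding affine_hull_2
      by (intro CollectI exI[of _ "1 - 1 / norm (1 + \<alpha>)"] exI[of _ "1 / norm (1 + \<alpha>)"])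
        (auto simp: \<beta>_def scaleR_conv_of_real)
    ultimately have "\<beta> \<in> constructible S" using on_line[OF c01(1)] nz n\<beta> by metis
    moreover have "\<beta>\<^sup>2 = \<alpha>"
    proof -
      have "\<alpha> * cnj \<alpha> = 1" using \<alpha>(2) by (simp flip: complex_norm_square)
      then have "\<alpha> * ((1 + \<alpha>) * cnj (1 + \<alpha>)) = (1 + \<alpha>)\<^sup>2"
        by (simp add: algebra_simps power2_eq_square)
      moreover have "(1 + \<alpha>) * cnj (1 + \<alpha>) = (of_real (norm (1 + \<alpha>)))\<^sup>2"
        by (metis complex_norm_square of_real_power)
      ultimately have "\<alpha> * (of_real (norm (1 + \<alpha>)))\<^sup>2 = (1 + \<alpha>)\<^sup>2" by simp
      then show ?thesis using nz by (simp add: \<beta>_def power_divide field_simps)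
    qed
    ultimately show ?thesis using n\<beta> by blast
  qed
qed

lemma Sect_power_of_two: "Sect (2 ^ k) = {-1..1}"
proof
  show "Sect (2 ^ k) \<subseteq> {-1..1}"
  proof
    fix x assume "x \<in> Sect (2 ^ k)"
    then obtain \<alpha> where "x = Re \<alpha>" "norm \<alpha> = 1" unfolding Sect_def sectable_def angle_def by blast
    then show "x \<in> {-1..1}" using abs_Re_le_cmod[of \<alpha>] by (simp add: abs_le_iff)
  qed
  show "{-1..1} \<subseteq> Sect (2 ^ k)"
  proof
    fix x :: real assume "x \<in> {-1..1}"
    then have x: "x\<^sup>2 \<le> 1" by (simp add: abs_square_le_1 abs_le_iff)
    define \<alpha> where "\<alpha> = Complex x (sqrt (1 - x\<^sup>2))"
    have \<alpha>: "norm \<alpha> = 1" using x by (simp add: \<alpha>_def cmod_def)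
    have "\<exists>\<beta>\<in>constructible {0, 1, \<alpha>}. norm \<beta> = 1 \<and> \<beta> ^ 2 ^ k = \<alpha>"
    proof (induction k)
      case 0
      then show ?case using \<alpha> by (auto intro: given)
    next
      case (Suc k)
      then obtain \<beta> where \<beta>: "\<beta> \<in> constructible {0, 1, \<alpha>}" "norm \<beta> = 1" "\<beta> ^ 2 ^ k = \<alpha>" by blast
      then obtain \<gamma> where "\<gamma> \<in> constructible {0, 1, \<alpha>}" "norm \<gamma> = 1" "\<gamma>\<^sup>2 = \<beta>"
        using unit_square_root_constructible[of "{0, 1, \<alpha>}" \<beta>] by blast
      then show ?case using \<beta> by (intro bexI[of _ \<gamma>]) (auto simp: power_mult)
    qed
    then have "sectable (2 ^ k) \<alpha>" unfolding sectable_def angle_def using \<alpha> by blast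
    moreover have "x = Re \<alpha>" by (simp add: \<alpha>_def)
    ultimately show "x \<in> Sect (2 ^ k)" unfolding Sect_def by blast
  qed
qed

section \<open>Chebyshev polynomials and section by an odd number\<close>

fun chebyshev :: "nat \<Rightarrow> 'a::comm_ring_1 \<Rightarrow> 'a" where
  "chebyshev 0 y = 1"
| "chebyshev (Suc 0) y = y"
| "chebyshev (Suc (Suc n)) y = 2 * y * chebyshev (Suc n) y - chebyshev n y"

text \<open>A unit \<gamma> is a root of X^2 - 2 Re \<gamma> X + 1, so its powers, and hence their
  real parts, obey the Chebyshev recurrence.\<close>

lemma Re_power_chebyshev:
  assumes "norm \<gamma> = 1"
  shows "Re (\<gamma> ^ n) = chebyshev n (Re \<gamma>)"
proof (induction n rule: induct_nat_012)
  case (ge2 n)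
  have "\<gamma> * cnj \<gamma> = 1" using assms by (simp flip: complex_norm_square)
  then have "\<gamma> * \<gamma> = \<gamma> * (\<gamma> + cnj \<gamma>) - 1" by (simp add: algebra_simps)
  then have "\<gamma> * \<gamma> = of_real (2 * Re \<gamma>) * \<gamma> - 1" by (simp add: complex_add_cnj mult.commute)
  then have "(\<gamma> * \<gamma>) * \<gamma> ^ n = (of_real (2 * Re \<gamma>) * \<gamma> - 1) * \<gamma> ^ n" by (simp only:)
  then have "\<gamma> ^ Suc (Suc n) = of_real (2 * Re \<gamma>) * \<gamma> ^ Suc n - \<gamma> ^ n"
    by (simp add: left_diff_distrib mult.assoc)
  then have "Re (\<gamma> ^ Suc (Suc n)) = 2 * Re \<gamma> * Re (\<gamma> ^ Suc n) - Re (\<gamma> ^ n)"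
    by (metis Re_complex_of_real Im_complex_of_real minus_complex.simps(1) mult_zero_left diff_zero times_complex.simps(1))
  then show ?case using ge2 by (simp del: power_Suc)
qed auto

lemma Sect_subset_chebyshev:
  assumes K: "field_set (K :: real set)" and x: "x \<in> Sect (l * n)" "x \<in> K" and n: "odd n"
  shows "\<exists>y\<in>K \<inter> {-1..1}. chebyshev n y = x"
proof -
  interpret K: field_set K by fact
  obtain \<alpha> \<beta> where \<alpha>: "x = Re \<alpha>" "norm \<alpha> = 1"
    and \<beta>: "\<beta> ^ (l * n) = \<alpha>" "\<beta> \<in> constructible {0, 1, \<alpha>}"
    using x(1) unfolding Sect_def sectable_def angle_def by blast
  \<comment> \<open>L is K(\<alpha>), written with the purely imaginary generator i Im \<alpha>,
    whose square x^2 - 1 lies in K: since K is real, elements a + b (i Im \<alpha>) have real part a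
    \<in> K. Adjoining i puts Re \<alpha> and Im \<alpha> separately into L1, as the tower of
    constructible points requires.\<close>
  define L where "L = adjoin (of_real ` K) (\<i> * of_real (Im \<alpha>))"
  define L1 where "L1 = adjoin L \<i>"
  have cK: "field_set (complex_of_real ` K)"
  proof
    show "1 \<in> complex_of_real ` K" using K.one by force
    show "a - b \<in> complex_of_real ` K" "a * b \<in> complex_of_real ` K"
      if "a \<in> complex_of_real ` K" "b \<in> complex_of_real ` K" for a b
      using that K.diff K.mult by (force simp flip: of_real_diff of_real_mult)+
    show "inverse a \<in> complex_of_real ` K" if "a \<in> complex_of_real ` K" for a
      using that K.inverse by (force simp flip: of_real_inverse)
  qed
  have "(Im \<alpha>)\<^sup>2 = 1 - x\<^sup>2" using \<alpha> cmod_power2[of \<alpha>] by simp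
  then have "\<i> * of_real (Im \<alpha>) * (\<i> * of_real (Im \<alpha>)) = complex_of_real (x\<^sup>2 - 1)"
    by (simp add: complex_eq_iff power2_eq_square)
  then have sq: "\<i> * of_real (Im \<alpha>) * (\<i> * of_real (Im \<alpha>)) \<in> complex_of_real ` K"
    using x(2) by (metis K.diff K.one K.power image_eqI)
  have L: "field_set L" unfolding L_def using field_set.field_set_adjoin[OF cK sq] .
  then interpret L: field_set L .
  have "\<i> * \<i> \<in> L" using L.uminus[OF L.one] by simp
  then have L1: "field_set L1" and \<i>: "\<i> * \<i> \<in> L" unfolding L1_def using L.field_set_adjoin by auto
  interpret L1: field_set L1 by fact
  have KL: "complex_of_real ` K \<subseteq> L" "\<i> * of_real (Im \<alpha>) \<in> L" "L \<subseteq> L1" "\<i> \<in> L1"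
    unfolding L_def L1_def
    using field_set.subset_adjoin[OF cK] field_set.in_adjoin[OF cK] L.subset_adjoin L.in_adjoin
    unfolding L_def by blast+
  have "complex_of_real (Im \<alpha>) = - (\<i> * (\<i> * of_real (Im \<alpha>)))" by (simp add: complex_eq_iff)
  then have Im: "complex_of_real (Im \<alpha>) \<in> L1" using KL L1.uminus L1.mult by (metis subsetD)
  have Re: "complex_of_real (Re \<alpha>) \<in> L" using x(2) \<alpha>(1) KL by auto
  have "Re z \<in> real_part L1 \<and> Im z \<in> real_part L1" if "z \<in> {0, 1, \<alpha>}" for z
    using that Re Im KL L1.zero L1.one by (auto simp: real_part_def)
  from constructible_quadratic_tower(1)[OF L1 this \<beta>(2)]
  obtain F where F: "F \<in> quadratic_tower L1" "L1 \<subseteq> F" "Re \<beta> \<in> real_part F" "Im \<beta> \<in> real_part F"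
    using quadratic_tower.base by blast
  interpret F: field_set F using field_set_quadratic_tower[OF F(1) L1] .
  have "\<beta> = of_real (Re \<beta>) + \<i> * of_real (Im \<beta>)" by (simp add: complex_eq)
  moreover have "\<dots> \<in> F" using F KL by (intro F.add F.mult) (auto simp: real_part_def)
  ultimately have \<beta>F: "\<beta> ^ l \<in> F" using F.power by simp
  have "\<alpha> = of_real (Re \<alpha>) + \<i> * of_real (Im \<alpha>)" by (simp add: complex_eq)
  then have \<alpha>L: "\<alpha> \<in> L" using L.add[OF Re KL(2)] by metis
  \<comment> \<open>The n-th root \<beta> ^ l of \<alpha> in F descends to L1, and one further
    descent removes i and reaches L.\<close>
  then have "\<exists>\<gamma>\<in>L1. \<gamma> ^ n = \<alpha>"
    using quadratic_tower_odd_root[OF F(1) L1 _ n] \<beta>F \<beta>(1) KL by (metis power_mult subsetD)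
  then obtain \<gamma> where \<gamma>: "\<gamma> \<in> L" "\<gamma> ^ n = \<alpha>"
    using L.odd_root_descent[OF \<i> \<alpha>L _ _ n] unfolding L1_def by blast
  have "norm \<gamma> ^ n = 1" using \<gamma>(2) \<alpha>(2) by (metis norm_power)
  then have n\<gamma>: "norm \<gamma> = 1" using n by (metis norm_ge_zero odd_pos power_eq_1_iff real_norm_def abs_of_nonneg neq0_conv)
  obtain a b where "\<gamma> = of_real a + of_real b * (\<i> * of_real (Im \<alpha>))" "a \<in> K"
    using \<gamma>(1) unfolding L_def adjoin_def by blast
  then have "Re \<gamma> \<in> K" by simp
  moreover have "Re \<gamma> \<in> {-1..1}" using abs_Re_le_cmod[of \<gamma>] n\<gamma> by (simp add: abs_le_iff)
  moreover have "chebyshev n (Re \<gamma>) = x" using Re_power_chebyshev[OF n\<gamma>, of n] \<gamma>(2) \<alpha>(1) by simp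
  ultimately show ?thesis by blast
qed


section \<open>Number fields as rational vector spaces\<close>

interpretation rat_vs: vector_space "\<lambda>(q::rat) (x::'a::field_char_0). of_rat q * x"
  by unfold_locales (simp_all add: algebra_simps of_rat_add of_rat_mult)

text \<open>\<open>Bs\<close> is a finite spanning set rather than a basis: \<open>card Bs\<close>
  enters as an upper bound for the degree of K.\<close>

locale number_field_basis = field_set K for K :: "'a::field_char_0 set" +
  fixes Bs :: "'a set"
  assumes finite_basis: "finite Bs" and basis_subset: "Bs \<subseteq> K"
    and spanning: "K \<subseteq> rat_vs.span Bs"

lemma number_field_basis:
  assumes "number_field K"
  shows "\<exists>Bs. number_field_basis K Bs"
proof -
  define R :: "'a ring" where "R = ring_of_type_algebra"
  have R [simp]: "carrier R = UNIV" "x \<otimes>\<^bsub>R\<^esub> y = x * y" "x \<oplus>\<^bsub>R\<^esub> y = x + y" "\<one>\<^bsub>R\<^esub> = 1" "\<zero>\<^bsub>R\<^esub> = 0" for x y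
    by (simp_all add: R_def ring_of_type_algebra_def)
  interpret R: field R unfolding R_def by (rule field_from_type_algebra)
  have K: "subfield K R" and fd: "R.finite_dimension \<rat> K"
    using assms by (auto simp: number_field_def R_def)
  note Ksub = subringE[OF subfieldE(1)[OF K]]
  have minus: "\<ominus>\<^bsub>R\<^esub> x = - x" for x
    by (rule R.minus_equality) auto
  have fs: "field_set K"
  proof
    show "1 \<in> K" using Ksub(3) by simp
    show "x * y \<in> K" if "x \<in> K" "y \<in> K" for x y using Ksub(6) that by simp
    show "x - y \<in> K" if "x \<in> K" "y \<in> K" for x y
      using Ksub(7)[OF that(1) Ksub(5)[OF that(2)]] minus by simp
    show "inverse x \<in> K" if "x \<in> K" for x
    proof (cases "x = 0")
      case False
      then have "inv\<^bsub>R\<^esub> x \<in> K" "x * inv\<^bsub>R\<^esub> x = 1" using R.subfield_m_inv[OF K, of x] that by auto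
      then show ?thesis using inverse_unique by metis
    qed (use that in simp)
  qed
  have Q: "subfield \<rat> R"
  proof (rule R.subfieldI')
    show "subring \<rat> R"
      by (rule R.subringI) (auto simp: minus)
    fix k :: 'a assume k: "k \<in> \<rat> - {\<zero>\<^bsub>R\<^esub>}"
    have "inv\<^bsub>R\<^esub> k = inverse k"
      by (rule R.comm_inv_char) (use k in auto)
    then show "inv\<^bsub>R\<^esub> k \<in> \<rat>" using k by simp
  qed
  obtain n where "R.dimension n \<rat> K" using fd unfolding R.finite_dimension_def by blast
  then obtain Us where Us: "set Us \<subseteq> carrier R" "R.independent \<rat> Us" "length Us = n" "R.Span \<rat> Us = K"
    using R.exists_base[OF Q] by blast
  have "R.Span \<rat> Us \<subseteq> rat_vs.span (set Us)" for Us :: "'a list"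
  proof (induction Us)
    case (Cons u Us)
    show ?case
    proof
      fix x assume "x \<in> R.Span \<rat> (u # Us)"
      then obtain k y where "k \<in> \<rat>" "y \<in> R.Span \<rat> Us" "x = k * u + y"
        by (auto simp: R.line_extension_mem_iff)
      moreover from this(1) obtain q where "k = of_rat q" by (rule Rats_cases)
      moreover have "y \<in> rat_vs.span (set (u # Us))"
        using Cons calculation(2) rat_vs.span_mono[of "set Us" "set (u # Us)"] by auto
      ultimately show "x \<in> rat_vs.span (set (u # Us))"
        using rat_vs.span_add[OF rat_vs.span_scale[OF rat_vs.span_base], of u "set (u # Us)"] by simp
    qed
  qed auto
  then have "K \<subseteq> rat_vs.span (set Us)" using Us(4) by blast
  moreover have "set Us \<subseteq> K" using R.Span_base_incl[OF Q Us(1)] Us(4) by blast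
  ultimately have "number_field_basis K (set Us)"
    using fs by (simp add: number_field_basis_def number_field_basis_axioms_def)
  then show ?thesis by blast
qed


section \<open>Absolute values\<close>

locale absolute_value = field_set K for K :: "'a::field_char_0 set" +
  fixes v :: "'a \<Rightarrow> real"
  assumes absolute_value: "absolute_value_on K v"
begin

lemma nonneg: "x \<in> K \<Longrightarrow> 0 \<le> v x"
  using absolute_value by (simp add: absolute_value_on_def)

lemma eq_0_iff: "x \<in> K \<Longrightarrow> v x = 0 \<longleftrightarrow> x = 0"
  using absolute_value by (simp add: absolute_value_on_def)

lemma v_0: "v 0 = 0"
  using eq_0_iff zero by simp

lemma pos: "x \<in> K \<Longrightarrow> x \<noteq> 0 \<Longrightarrow> 0 < v x"
  using nonneg eq_0_iff by (simp add: less_le)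

lemma v_mult: "x \<in> K \<Longrightarrow> y \<in> K \<Longrightarrow> v (x * y) = v x * v y"
  using absolute_value by (simp add: absolute_value_on_def)

lemma v_add: "x \<in> K \<Longrightarrow> y \<in> K \<Longrightarrow> v (x + y) \<le> v x + v y"
  using absolute_value by (simp add: absolute_value_on_def)

lemma v_1: "v 1 = 1"
  using v_mult[OF one one] pos[OF one] by simp

lemma v_power: "x \<in> K \<Longrightarrow> v (x ^ n) = v x ^ n"
  by (induction n) (simp_all add: v_1 v_mult power)

lemma v_uminus: "x \<in> K \<Longrightarrow> v (- x) = v x"
proof -
  assume x: "x \<in> K"
  have "v (-1) * v (-1) = 1" using v_mult[of "-1" "-1"] v_1 one uminus by simp
  then have "v (-1) = 1" using nonneg[of "-1"] one uminus
    by (metis abs_of_nonneg abs_mult_self_eq mult_cancel_left1 power2_eq_1_iff power2_eq_square neg_0_le_iff_le not_one_le_zero)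
  then show ?thesis using v_mult[of "-1" x] x one uminus by simp
qed

lemma v_diff: "x \<in> K \<Longrightarrow> y \<in> K \<Longrightarrow> v (x - y) \<le> v x + v y"
  using v_add[of x "- y"] by (simp add: v_uminus uminus)

lemma v_diff_ge: "x \<in> K \<Longrightarrow> y \<in> K \<Longrightarrow> v x - v y \<le> v (x - y)"
  using v_add[of "x - y" y] by (simp add: diff)

lemma v_inverse: "x \<in> K \<Longrightarrow> v (inverse x) = inverse (v x)"
proof (cases "x = 0")
  case False
  moreover assume x: "x \<in> K"
  ultimately have "v x * v (inverse x) = 1" using v_mult[of x "inverse x"] by (simp add: inverse v_1)
  then show ?thesis by (metis inverse_unique)
qed (simp add: v_0)

lemma v_divide: "x \<in> K \<Longrightarrow> y \<in> K \<Longrightarrow> v (x / y) = v x / v y"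
  by (simp add: divide_inverse v_mult v_inverse inverse)

lemma v_sum: "(\<And>i. i \<in> I \<Longrightarrow> f i \<in> K) \<Longrightarrow> v (sum f I) \<le> (\<Sum>i\<in>I. v (f i))"
proof (induction I rule: infinite_finite_induct)
  case (insert i I)
  then have "v (f i + sum f I) \<le> v (f i) + v (sum f I)" by (intro v_add) (auto intro!: sum)
  then show ?case using insert by force
qed (simp_all add: v_0)

text \<open>The binomial theorem gives v (x + y) ^ n \<le> (n + 1) M ^ n with M the larger value; if
  v (x + y) exceeded M, exponential growth would beat the linear factor.\<close>

lemma ultrametric:
  assumes int: "\<And>n::nat. v (of_nat n) \<le> 1" and x: "x \<in> K" and y: "y \<in> K"
  shows "v (x + y) \<le> max (v x) (v y)"
proof (rule ccontr)
  define M where "M = max (v x) (v y)"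
  assume "\<not> ?thesis"
  then have less: "M < v (x + y)" unfolding M_def by linarith
  have M0: "0 \<le> M" using nonneg x by (simp add: M_def le_max_iff_disj)
  have bound: "v (x + y) ^ n \<le> real (Suc n) * M ^ n" for n
  proof -
    have "v (x + y) ^ n = v (\<Sum>k\<le>n. of_nat (n choose k) * x ^ k * y ^ (n - k))"
      using x y by (simp add: v_power[symmetric] add binomial_ring)
    also have "\<dots> \<le> (\<Sum>k\<le>n. v (of_nat (n choose k) * x ^ k * y ^ (n - k)))"
      using x y by (intro v_sum) (auto intro!: mult power of_nat)
    also have "\<dots> \<le> (\<Sum>k\<le>n. M ^ n)"
    proof (rule sum_mono)
      fix k assume k: "k \<in> {..n}"
      have "v (of_nat (n choose k) * x ^ k * y ^ (n - k)) = v (of_nat (n choose k)) * v x ^ k * v y ^ (n - k)"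
        using x y by (simp add: v_mult v_power mult power of_nat)
      also have "\<dots> \<le> 1 * M ^ k * M ^ (n - k)"
        using int nonneg x y M0
        by (intro mult_mono power_mono) (auto simp: M_def of_nat)
      also have "\<dots> = M ^ n" using k by (simp flip: power_add)
      finally show "v (of_nat (n choose k) * x ^ k * y ^ (n - k)) \<le> M ^ n" .
    qed
    finally show ?thesis by simp
  qed
  define t where "t = M / v (x + y)"
  have t: "0 \<le> t" "t < 1" using less M0 by (auto simp: t_def)
  have ge: "1 \<le> real (Suc n) * t ^ n" for n
    using bound[of n] less M0 by (simp add: t_def power_divide field_simps)
  have "(\<lambda>n. real n * t ^ n + t ^ n) \<longlonglongrightarrow> 0 + 0"
    using t by (intro tendsto_add powser_times_n_limit_0 LIMSEQ_power_zero) auto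
  then have "(\<lambda>n. real (Suc n) * t ^ n) \<longlonglongrightarrow> 0" by (simp add: algebra_simps)
  then have "1 \<le> (0::real)" by (rule tendsto_lowerbound) (use ge in auto)
  then show False by simp
qed

lemma tendsto_v_one_plus:
  assumes "\<And>n. y n \<in> K" "(\<lambda>n. v (y n)) \<longlonglongrightarrow> 0"
  shows "(\<lambda>n. v (1 + y n)) \<longlonglongrightarrow> 1"
proof -
  have "\<bar>v (1 + y n) - 1\<bar> \<le> v (y n)" for n
  proof -
    have "v (1 + y n) \<le> 1 + v (y n)" using v_add[OF one assms(1)] by (simp add: v_1)
    moreover have "1 \<le> v (1 + y n) + v (y n)"
      using v_diff[OF add[OF one assms(1)] assms(1), of n n] by (simp add: v_1)
    ultimately show ?thesis by linarith
  qed
  then have "(\<lambda>n. v (1 + y n) - 1) \<longlonglongrightarrow> 0"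
    by (intro tendsto_rabs_zero_cancel[OF tendsto_sandwich[OF _ _ tendsto_const assms(2)]]) auto
  then show ?thesis by (simp add: LIM_zero_iff)
qed

end

lemma (in field_set) absolute_valueI: "absolute_value_on F v \<Longrightarrow> absolute_value F v"
  using field_set_axioms by (simp add: absolute_value_def absolute_value_axioms_def)


section \<open>Finitely many extensions of an absolute value\<close>

definition extensions :: "'a::field_char_0 set \<Rightarrow> (rat \<Rightarrow> real) \<Rightarrow> ('a \<Rightarrow> real) set" where
  "extensions K a = {v. absolute_value_on K v \<and> (\<forall>q. v (of_rat q) = a q)}"

section \<open>Separation of extensions and weak approximation\<close>

context field_set
begin

lemma extension_absolute_value: "v \<in> extensions F a \<Longrightarrow> absolute_value F v"
  by (rule absolute_valueI) (simp_all add: extensions_def)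

text \<open>The rational \<tau> is a common yardstick. If v x < w x, a large power widens the gap
  beyond the factor a \<tau>, some \<tau> ^ k fits between v (x ^ n) and w (x ^ n), and x ^ n /
  \<tau> ^ k separates v from w. Otherwise w \<le> v everywhere; inverses give v \<le> w, and so v =
  w.\<close>

lemma extension_separation_weak:
  assumes v: "v \<in> extensions F a" and w: "w \<in> extensions F a" and ne: "v \<noteq> w"
    and \<tau>: "0 < a \<tau>" "a \<tau> < 1"
  shows "\<exists>x\<in>F. v x < 1 \<and> 1 \<le> w x"
proof (rule ccontr)
  assume "\<not> ?thesis"
  then have imp: "w x < 1" if "v x < 1" "x \<in> F" for x using that by force
  interpret v: absolute_value F v using extension_absolute_value[OF v] .
  interpret w: absolute_value F w using extension_absolute_value[OF w] .
  have rat: "v (of_rat q) = a q" "w (of_rat q) = a q" for q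
    using v w by (auto simp: extensions_def)
  have le: "w x \<le> v x" if x: "x \<in> F" for x
  proof (rule ccontr)
    assume "\<not> ?thesis"
    then have less: "v x < w x" by simp
    then have "x \<noteq> 0" by (auto simp: v.v_0 w.v_0)
    then have vpos: "0 < v x" using v.pos x by simp
    then have "1 < w x / v x" using less by simp
    then obtain n where "1 / (a \<tau>) < (w x / v x) ^ n" using real_arch_pow by blast
    then have n: "v x ^ n < a \<tau> * w x ^ n" using vpos \<tau> by (simp add: power_divide field_simps)
    \<comment> \<open>The exponent is the logarithm to base a \<tau>, rounded up; as a \<tau> < 1,
      the inequalities reverse when multiplied by its logarithm.\<close>
    obtain k where k: "a \<tau> powi k \<le> w x ^ n" "w x ^ n < a \<tau> powi (k - 1)"
    proof -
      define k where "k = \<lceil>ln (w x ^ n) / ln (a \<tau>)\<rceil>"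
      have lt: "ln (a \<tau>) < 0" using \<tau> by simp
      have wn: "0 < w x ^ n" using less vpos by simp
      have pw: "a \<tau> powi j = exp (of_int j * ln (a \<tau>))" for j
        using \<tau> by (simp add: powr_def flip: powr_real_of_int')
      have "ln (w x ^ n) / ln (a \<tau>) \<le> of_int k" "of_int k - 1 < ln (w x ^ n) / ln (a \<tau>)"
        unfolding k_def by linarith+
      then have "of_int k * ln (a \<tau>) \<le> ln (w x ^ n)" "ln (w x ^ n) < of_int (k - 1) * ln (a \<tau>)"
        using lt by (simp_all add: field_simps)
      then have "exp (of_int k * ln (a \<tau>)) \<le> w x ^ n" "w x ^ n < exp (of_int (k - 1) * ln (a \<tau>))"
        using wn by (metis exp_le_cancel_iff exp_ln, metis exp_less_cancel_iff exp_ln)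
      then show ?thesis using that[of k] pw by simp
    qed
    have "a \<tau> * a \<tau> powi (k - 1) = a \<tau> powi k"
      using \<tau> by (simp add: power_int_diff)
    then have k': "v x ^ n < a \<tau> powi k"
      using n k \<tau> by (smt (verit) mult_less_cancel_left_pos)
    define z where "z = x ^ n / of_rat (\<tau> powi k)"
    have pos: "0 < a \<tau> powi k" using \<tau> by simp
    have pv: "v (of_rat (\<tau> powi k)) = a \<tau> powi k" 
    proof -
      have "v (of_rat \<tau> powi k) = v (of_rat \<tau>) powi k"
        by (simp add: power_int_def v.v_power v.v_inverse power inverse of_rat)
      moreover have "of_rat (\<tau> powi k) = (of_rat \<tau> powi k :: 'a)"
        by (simp add: power_int_def of_rat_power of_rat_inverse)
      ultimately show ?thesis using rat(1)[of \<tau>] by simp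
    qed
    have pv': "w (of_rat (\<tau> powi k)) = a \<tau> powi k" using pv rat by simp
    have zF: "z \<in> F" unfolding z_def using x by (intro divide power of_rat)
    have "v z < 1" unfolding z_def using k' pos pv x
      by (simp add: v.v_divide v.v_power power of_rat)
    moreover have "1 \<le> w z" unfolding z_def using k(1) pos pv' x
      by (simp add: w.v_divide w.v_power power of_rat)
    ultimately show False using imp zF by force
  qed
  have "v x = w x" if "x \<in> F" for x
  proof (cases "x = 0")
    case False
    have "inverse (w x) \<le> inverse (v x)"
      using le[OF inverse[OF that]] by (simp add: v.v_inverse w.v_inverse that)
    then have "v x \<le> w x" using v.pos w.pos that False by (simp add: inverse_le_iff_le)
    then show ?thesis using le[OF that] by simp
  qed (simp add: v.v_0 w.v_0)
  moreover have "v \<in> extensional F" "w \<in> extensional F"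
    using v w by (auto simp: extensions_def absolute_value_on_def)
  ultimately have "v = w" by (intro extensionalityI)
  then show False using ne by simp
qed

text \<open>Weak separation in both directions gives x and y; in the quotient y / x both
  inequalities become strict.\<close>

lemma extension_separation:
  assumes "v \<in> extensions F a" "w \<in> extensions F a" "v \<noteq> w" "0 < a \<tau>" "a \<tau> < 1"
  shows "\<exists>x\<in>F. 1 < v x \<and> w x < 1"
proof -
  interpret v: absolute_value F v using extension_absolute_value[OF assms(1)] .
  interpret w: absolute_value F w using extension_absolute_value[OF assms(2)] .
  obtain x where x: "x \<in> F" "v x < 1" "1 \<le> w x"
    using extension_separation_weak[OF assms] by blast
  obtain y where y: "y \<in> F" "w y < 1" "1 \<le> v y"
    using extension_separation_weak[OF assms(2,1)] assms(3-5) by metis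
  have "x \<noteq> 0" using x w.v_0 by auto
  then have "0 < v x" using v.pos x by simp
  then have "1 < v (y / x)" using x y by (simp add: v.v_divide)
  moreover have "w (y / x) < 1" using x y by (simp add: w.v_divide)
  ultimately show ?thesis using divide x y by blast
qed

text \<open>The Artin-Whaples induction on the number of absolute values that are to be
  small.\<close>

lemma weak_approximation:
  assumes W: "finite W" "W \<subseteq> extensions F a" and v: "v \<in> extensions F a" "v \<notin> W"
    and \<tau>: "0 < a \<tau>" "a \<tau> < 1"
  shows "\<exists>x\<in>F. 1 < v x \<and> (\<forall>w\<in>W. w x < 1)"
  using W v(2)
proof (induction W rule: finite_induct)
  case empty
  interpret v: absolute_value F v using extension_absolute_value[OF v(1)] .
  have "1 < v (of_rat (inverse \<tau>))"
    using v(1) \<tau> one_less_inverse[OF \<tau>] by (simp add: of_rat_inverse v.v_inverse of_rat extensions_def)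
  then show ?case using of_rat by blast
next
  case (insert u W)
  obtain x where x: "x \<in> F" "1 < v x" "\<And>w. w \<in> W \<Longrightarrow> w x < 1" using insert by auto
  obtain y where y: "y \<in> F" "1 < v y" "u y < 1"
    using extension_separation[OF v(1) _ _ \<tau>, of u] insert by blast
  interpret v: absolute_value F v using extension_absolute_value[OF v(1)] .
  interpret u: absolute_value F u using extension_absolute_value[of u a] insert by blast
  have W: "absolute_value F w" if "w \<in> W" for w using extension_absolute_value[of w a] insert that by blast
  have w0: "(\<lambda>n. w x ^ n) \<longlonglongrightarrow> 0" if "w \<in> W" for w
  proof -
    interpret w: absolute_value F w using W[OF that] .
    show ?thesis using x(3)[OF that] w.nonneg[OF x(1)] by (intro LIMSEQ_power_zero) auto
  qed
  show ?case
  \<comment> \<open>For u x \<le> 1, a high power of x beats w y at every w in W while u (x ^ n y)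
    stays below 1.\<close>
  proof (cases "u x \<le> 1")
    case True
    have "eventually (\<lambda>n. w (x ^ n * y) < 1) sequentially" if "w \<in> W" for w
    proof -
      interpret w: absolute_value F w using W[OF that] .
      have "(\<lambda>n. w x ^ n * w y) \<longlonglongrightarrow> 0 * w y"
        by (rule tendsto_mult[OF w0[OF that] tendsto_const])
      then show ?thesis using x y
        by (intro order_tendstoD(2)[of _ 0]) (simp_all add: w.v_mult w.v_power power)
    qed
    then have "eventually (\<lambda>n. \<forall>w\<in>W. w (x ^ n * y) < 1) sequentially"
      using insert by (simp add: eventually_ball_finite)
    from eventually_happens'[OF sequentially_bot this] obtain n where n: "\<forall>w\<in>W. w (x ^ n * y) < 1" ..
    have "1 \<le> v x ^ n" using x by (simp add: one_le_power)
    then have "1 < v x ^ n * v y" using y by (smt (verit) mult_le_cancel_right1)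
    moreover have "u x ^ n * u y < 1"
      using True y u.nonneg x by (smt (verit) mult_right_le_one_le power_le_one mult.commute zero_le_power)
    ultimately show ?thesis
      using n x y by (intro bexI[of _ "x ^ n * y"])
        (auto simp: v.v_mult v.v_power u.v_mult u.v_power power mult)
  next
    case False
    \<comment> \<open>The factor x ^ n / (1 + x ^ n) tends to 1 where x is large, that is at v and
      u, and to 0 at every w in W. So z n behaves like y at v and u and is small on W.\<close>
    define z where "z n = x ^ n / (1 + x ^ n) * y" for n
    have zF: "z n \<in> F" for n unfolding z_def using x y by (intro mult divide add one power)
    have big: "(\<lambda>n. s (z n)) \<longlonglongrightarrow> s y" if s: "absolute_value F s" "1 < s x" for s
    proof -
      interpret s: absolute_value F s by fact
      have xn: "x \<noteq> 0" using s(2) s.v_0 by auto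
      have "(\<lambda>n. (inverse (s x)) ^ n) \<longlonglongrightarrow> 0"
        using s(2) by (intro LIMSEQ_power_zero) (simp add: inverse_less_1_iff)
      then have "(\<lambda>n. s (inverse (x ^ n))) \<longlonglongrightarrow> 0"
        using x by (simp add: s.v_inverse s.v_power power power_inverse)
      then have "(\<lambda>n. s (1 + inverse (x ^ n))) \<longlonglongrightarrow> 1"
        using x by (intro s.tendsto_v_one_plus) (auto intro: inverse power)
      then have "(\<lambda>n. inverse (s (1 + inverse (x ^ n))) * s y) \<longlonglongrightarrow> inverse 1 * s y"
        by (intro tendsto_intros) auto
      moreover have "s (z n) = inverse (s (1 + inverse (x ^ n))) * s y" for n
      proof -
        have "x ^ n / (1 + x ^ n) = inverse (1 + inverse (x ^ n))"
          using xn by (simp add: divide_simps add.commute)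
        then show ?thesis unfolding z_def using x y
          by (simp add: s.v_mult s.v_inverse inverse add one power)
      qed
      ultimately show ?thesis by simp
    qed
    have small: "(\<lambda>n. s (z n)) \<longlonglongrightarrow> 0" if s: "absolute_value F s" "(\<lambda>n. s x ^ n) \<longlonglongrightarrow> 0" for s
    proof -
      interpret s: absolute_value F s by fact
      have "(\<lambda>n. s (1 + x ^ n)) \<longlonglongrightarrow> 1"
        using x s(2) by (intro s.tendsto_v_one_plus) (auto intro: power simp: s.v_power)
      then have "(\<lambda>n. s x ^ n / s (1 + x ^ n) * s y) \<longlonglongrightarrow> 0 / 1 * s y"
        by (rule tendsto_mult[OF tendsto_divide[OF s(2)] tendsto_const]) simp
      moreover have "s (z n) = s x ^ n / s (1 + x ^ n) * s y" for n
        unfolding z_def using x y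
        by (simp add: s.v_mult s.v_divide s.v_power mult divide add one power)
      ultimately show ?thesis by simp
    qed
    have "eventually (\<lambda>n. 1 < v (z n)) sequentially"
      using big[OF v.absolute_value_axioms x(2)] y by (intro order_tendstoD(1))
    moreover have "eventually (\<lambda>n. u (z n) < 1) sequentially"
      using big[OF u.absolute_value_axioms] False y by (intro order_tendstoD(2)) auto
    moreover have "eventually (\<lambda>n. w (z n) < 1) sequentially" if "w \<in> W" for w
      using order_tendstoD(2)[OF small[OF W[OF that] w0[OF that]]] by simp
    then have "eventually (\<lambda>n. \<forall>w\<in>W. w (z n) < 1) sequentially"
      using insert.hyps(1) by (intro eventually_ball_finite ballI)
    ultimately have "eventually (\<lambda>n. 1 < v (z n) \<and> u (z n) < 1 \<and> (\<forall>w\<in>W. w (z n) < 1)) sequentially"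
      by (intro eventually_conj)
    from eventually_happens'[OF sequentially_bot this]
    obtain n where "1 < v (z n) \<and> u (z n) < 1 \<and> (\<forall>w\<in>W. w (z n) < 1)" ..
    then show ?thesis using zF by blast
  qed
qed

end

text \<open>Elements y v that are large at v and tiny at the other extensions behave like a
  diagonally dominant matrix and are independent over \<rat>; hence there are at most
  \<open>card Bs\<close> extensions.\<close>

lemma (in number_field_basis) finite_extensions:
  assumes \<tau>: "0 < a \<tau>" "a \<tau> < 1"
  shows "finite (extensions K a)"
proof -
  have "card V \<le> card Bs" if V: "finite V" "V \<subseteq> extensions K a" for V
  proof -
    have "\<forall>v\<in>V. \<exists>x\<in>K. 1 < v x \<and> (\<forall>w\<in>V - {v}. w x < 1)"
      using V weak_approximation[where a = a and \<tau> = \<tau>] \<tau> by blast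
    then obtain f where f: "\<And>v. v \<in> V \<Longrightarrow> f v \<in> K" "\<And>v. v \<in> V \<Longrightarrow> 1 < v (f v)"
      "\<And>v w. v \<in> V \<Longrightarrow> w \<in> V \<Longrightarrow> w \<noteq> v \<Longrightarrow> w (f v) < 1" by (metis DiffI singletonD)
    have av: "absolute_value K v" if "v \<in> V" for v using extension_absolute_value[of v a] V that by blast
    \<comment> \<open>Fewer than card V off-diagonal terms, each at most e times the largest
      coefficient, add up to less than that coefficient.\<close>
    define e where "e = 1 / (real (card V) + 1)"
    have e: "0 < e" by (simp add: e_def)
    have "eventually (\<lambda>n. w (f v) ^ n < e) sequentially" if "v \<in> V" "w \<in> V - {v}" for v w
    proof -
      interpret w: absolute_value K w using av that by blast
      have "(\<lambda>n. w (f v) ^ n) \<longlonglongrightarrow> 0"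
        using that f w.nonneg by (intro LIMSEQ_power_zero) auto
      then show ?thesis using e by (intro order_tendstoD(2))
    qed
    then have "eventually (\<lambda>n. \<forall>v\<in>V. \<forall>w\<in>V - {v}. w (f v) ^ n < e) sequentially"
      using V(1) by (intro eventually_ball_finite ballI) auto
    then have "eventually (\<lambda>n. (\<forall>v\<in>V. \<forall>w\<in>V - {v}. w (f v) ^ n < e) \<and> n > 0) sequentially"
      using eventually_gt_at_top by (intro eventually_conj)
    from eventually_happens'[OF sequentially_bot this]
    obtain n where n: "\<forall>v\<in>V. \<forall>w\<in>V - {v}. w (f v) ^ n < e" "n > 0" by blast
    define y where "y v = f v ^ n" for v
    have yK: "y v \<in> K" if "v \<in> V" for v using that f by (simp add: y_def power)
    have big: "1 < v (y v)" if "v \<in> V" for v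
    proof -
      interpret v: absolute_value K v using av that .
      show ?thesis using f that n(2) by (simp add: y_def v.v_power)
    qed
    have small: "w (y v) < e" if "v \<in> V" "w \<in> V" "w \<noteq> v" for v w
    proof -
      interpret w: absolute_value K w using av that(2) .
      show ?thesis using f that n(1) by (simp add: y_def w.v_power)
    qed
    have e1: "e \<le> 1" by (simp add: e_def)
    have inj: "inj_on y V"
    proof (rule inj_onI)
      fix v w assume "v \<in> V" "w \<in> V" "y v = y w"
      then show "v = w" using big[of v] small[of w v] e1 by force
    qed
    have "rat_vs.independent (y ` V)"
    proof (rule notI)
      assume "rat_vs.dependent (y ` V)"
      then obtain c where c: "\<exists>z\<in>y ` V. c z \<noteq> 0" "(\<Sum>z\<in>y ` V. of_rat (c z) * z) = 0"
        using rat_vs.dependent_finite[of "y ` V"] V(1) by blast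
      define d where "d v = c (y v)" for v
      have sum0: "(\<Sum>v\<in>V. of_rat (d v) * y v) = 0"
        using c(2) inj by (simp add: d_def sum.reindex)
      obtain v1 where v1: "v1 \<in> V" "d v1 \<noteq> 0" using c(1) by (auto simp: d_def)
      \<comment> \<open>In a vanishing combination, take the v whose rational coefficient is largest
        under the common restriction a. Measured by v, its term outweighs all others
        together.\<close>
      define M where "M = Max ((\<lambda>v. a (d v)) ` V)"
      have "M \<in> (\<lambda>v. a (d v)) ` V" unfolding M_def by (rule Max_in) (use V(1) v1(1) in auto)
      then obtain v where "v \<in> V" "M = a (d v)" by blast
      then have v: "v \<in> V" "\<And>w. w \<in> V \<Longrightarrow> a (d w) \<le> a (d v)"
        using Max_ge[of "(\<lambda>v. a (d v)) ` V"] V(1) by (auto simp: M_def)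
      interpret v: absolute_value K v using av v(1) .
      have va: "v (of_rat q) = a q" for q using v(1) V(2) by (auto simp: extensions_def)
      have a0: "0 \<le> a q" for q using v.nonneg[OF of_rat, of q] va by simp
      have "0 < a (d v1)" using v.pos[OF of_rat, of "d v1"] va v1 by simp
      then have pos: "0 < a (d v)" using v(2)[OF v1(1)] by simp
      have "of_rat (d v) * y v = - (\<Sum>w\<in>V - {v}. of_rat (d w) * y w)"
        using sum0 V(1) v(1) by (simp add: sum.remove[of V v] add_eq_0_iff)
      then have "v (of_rat (d v) * y v) = v (\<Sum>w\<in>V - {v}. of_rat (d w) * y w)"
        using yK v.v_uminus by (metis (no_types, lifting) DiffD1 mult of_rat sum)
      also have "\<dots> \<le> (\<Sum>w\<in>V - {v}. v (of_rat (d w) * y w))"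
        using yK by (intro v.v_sum) (auto intro: mult of_rat)
      also have "\<dots> \<le> (\<Sum>w\<in>V - {v}. a (d v) * e)"
      proof (rule sum_mono)
        fix w assume w: "w \<in> V - {v}"
        have "v (of_rat (d w) * y w) = a (d w) * v (y w)"
          using w yK by (simp add: v.v_mult of_rat va)
        also have "\<dots> \<le> a (d v) * e"
          using w v a0 small[of w v] v.nonneg yK by (intro mult_mono) (auto simp: less_imp_le)
        finally show "v (of_rat (d w) * y w) \<le> a (d v) * e" .
      qed
      also have "\<dots> \<le> real (card V) * (a (d v) * e)"
        using a0 e V(1) card_mono[of V "V - {v}"] by (simp add: mult_right_mono)
      also have "\<dots> < a (d v)" using pos by (simp add: e_def field_simps)
      finally have "v (of_rat (d v) * y v) < a (d v)" .
      moreover have "v (of_rat (d v) * y v) = a (d v) * v (y v)"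
        using v(1) yK by (simp add: v.v_mult of_rat va)
      ultimately show False using pos big[OF v(1)] by simp
    qed
    then have "card (y ` V) \<le> card Bs"
      using rat_vs.independent_span_bound[OF finite_basis] yK spanning by blast
    then show ?thesis using inj by (simp add: card_image)
  qed
  then show ?thesis by (intro conjunct1[OF finite_if_finite_subsets_card_bdd])
qed


section \<open>Local degrees are positive\<close>

lemma null_squeeze:
  fixes f g :: "nat \<Rightarrow> real"
  assumes "g \<longlonglongrightarrow> 0" "\<And>n. 0 \<le> f n" "\<And>n. f n \<le> g n"
  shows "f \<longlonglongrightarrow> 0"
  by (rule tendsto_sandwich[OF _ _ tendsto_const assms(1)]) (use assms(2,3) in auto)

section \<open>The completion as a field over the completion of the rationals\<close>

context absolute_value
begin

abbreviation Cs :: "(nat \<Rightarrow> 'a) ring" where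
  "Cs \<equiv> cauchy_seqs K v"

abbreviation Kv :: "(nat \<Rightarrow> 'a) set ring" where
  "Kv \<equiv> completion K v"

definition cauchy :: "(nat \<Rightarrow> 'a) \<Rightarrow> bool" where
  "cauchy s \<longleftrightarrow> (\<forall>e>0. \<exists>N. \<forall>i\<ge>N. \<forall>j\<ge>N. v (s i - s j) < e)"

lemma carrier_cauchy_seqs: "s \<in> carrier Cs \<longleftrightarrow> (\<forall>n. s n \<in> K) \<and> cauchy s"
  by (auto simp: cauchy_seqs_def cauchy_def)

lemma in_null_seqs:
  "s \<in> null_seqs K v \<longleftrightarrow> (\<forall>n. s n \<in> K) \<and> cauchy s \<and> (\<lambda>n. v (s n)) \<longlonglongrightarrow> 0"
  by (simp add: null_seqs_def carrier_cauchy_seqs)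

lemma cauchy_const: "cauchy (\<lambda>_. x)"
  by (auto simp: cauchy_def v_0)

lemma cauchy_add:
  assumes "\<forall>n. s n \<in> K" "cauchy s" "\<forall>n. t n \<in> K" "cauchy t"
  shows "cauchy (\<lambda>n. s n + t n)"
  unfolding cauchy_def
proof (intro allI impI)
  fix e :: real assume "0 < e"
  then have "0 < e / 2" by simp
  then obtain M N where M: "\<forall>i\<ge>M. \<forall>j\<ge>M. v (s i - s j) < e / 2"
    and N: "\<forall>i\<ge>N. \<forall>j\<ge>N. v (t i - t j) < e / 2"
    using assms(2,4) unfolding cauchy_def by meson
  have "v (s i + t i - (s j + t j)) < e" if "i \<ge> max M N" "j \<ge> max M N" for i j
  proof -
    have eq: "s i + t i - (s j + t j) = (s i - s j) + (t i - t j)" by simp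
    have "v (s i + t i - (s j + t j)) \<le> v (s i - s j) + v (t i - t j)"
      unfolding eq by (rule v_add) (use assms(1,3) diff in auto)
    moreover have "v (s i - s j) < e / 2" "v (t i - t j) < e / 2" using M N that by auto
    ultimately show ?thesis by linarith
  qed
  then show "\<exists>N. \<forall>i\<ge>N. \<forall>j\<ge>N. v (s i + t i - (s j + t j)) < e" by blast
qed

lemma cauchy_bounded:
  assumes "\<forall>n. s n \<in> K" "cauchy s"
  shows "\<exists>M>0. \<forall>n. v (s n) \<le> M"
proof -
  obtain N where N: "\<forall>i\<ge>N. \<forall>j\<ge>N. v (s i - s j) < 1"
    using assms(2) unfolding cauchy_def by (meson zero_less_one)
  define M where "M = 1 + v (s N) + (\<Sum>i<N. v (s i))"
  have nn: "0 \<le> v (s i)" for i using nonneg assms(1) by simp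
  have S: "0 \<le> (\<Sum>i<N. v (s i))" using nn by (intro sum_nonneg)
  have "v (s n) \<le> M" for n
  proof (cases "n < N")
    case True
    then have "v (s n) \<le> (\<Sum>i<N. v (s i))" using nn by (intro member_le_sum) auto
    then show ?thesis using nn[of N] by (simp add: M_def)
  next
    case False
    then have "v (s n - s N) < 1" using N by simp
    then show ?thesis using v_diff_ge[of "s n" "s N"] assms(1) S by (simp add: M_def)
  qed
  moreover have "0 < M" using nn[of N] S by (simp add: M_def)
  ultimately show ?thesis by blast
qed

lemma cauchy_mult:
  assumes s: "\<forall>n. s n \<in> K" "cauchy s" and t: "\<forall>n. t n \<in> K" "cauchy t"
  shows "cauchy (\<lambda>n. s n * t n)"
  unfolding cauchy_def
proof (intro allI impI)
  fix e :: real assume e: "0 < e"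
  obtain A where A: "0 < A" "\<And>n. v (s n) \<le> A" using cauchy_bounded[OF s] by blast
  obtain B where B: "0 < B" "\<And>n. v (t n) \<le> B" using cauchy_bounded[OF t] by blast
  have "0 < e / (2 * B)" "0 < e / (2 * A)" using e A B by auto
  then obtain M N where M: "\<forall>i\<ge>M. \<forall>j\<ge>M. v (s i - s j) < e / (2 * B)"
    and N: "\<forall>i\<ge>N. \<forall>j\<ge>N. v (t i - t j) < e / (2 * A)"
    using s(2) t(2) unfolding cauchy_def by meson
  have "v (s i * t i - s j * t j) < e" if ij: "i \<ge> max M N" "j \<ge> max M N" for i j
  proof -
    have "s i * t i - s j * t j = (s i - s j) * t i + s j * (t i - t j)" by (simp add: algebra_simps)
    then have "v (s i * t i - s j * t j) \<le> v (s i - s j) * v (t i) + v (s j) * v (t i - t j)"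
      using v_add[of "(s i - s j) * t i" "s j * (t i - t j)"] s t diff mult v_mult by simp
    also have "\<dots> \<le> v (s i - s j) * B + A * v (t i - t j)"
      using A B nonneg diff s(1) t(1) by (intro add_mono mult_mono) auto
    also have "v (s i - s j) * B < e / 2" using M ij B by (simp add: field_simps)
    also have "A * v (t i - t j) < e / 2" using N ij A by (simp add: field_simps)
    finally show ?thesis by simp
  qed
  then show "\<exists>N. \<forall>i\<ge>N. \<forall>j\<ge>N. v (s i * t i - s j * t j) < e" by blast
qed

lemma cauchy_uminus:
  assumes "\<forall>n. s n \<in> K" "cauchy s"
  shows "cauchy (\<lambda>n. - s n)"
  using cauchy_mult[OF _ cauchy_const[of "-1"] assms] one uminus by simp

lemma cauchy_diff:
  assumes "\<forall>n. s n \<in> K" "cauchy s" "\<forall>n. t n \<in> K" "cauchy t"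
  shows "cauchy (\<lambda>n. s n - t n)"
  using cauchy_add[OF assms(1,2) _ cauchy_uminus[OF assms(3,4)]] assms(3) uminus by simp

lemma cauchy_null:
  assumes "\<forall>n. s n \<in> K" "(\<lambda>n. v (s n)) \<longlonglongrightarrow> 0"
  shows "cauchy s"
  unfolding cauchy_def
proof (intro allI impI)
  fix e :: real assume "0 < e"
  then have "eventually (\<lambda>n. v (s n) < e / 2) sequentially"
    using assms(2) by (intro order_tendstoD(2)) auto
  then obtain N where N: "\<And>n. n \<ge> N \<Longrightarrow> v (s n) < e / 2" unfolding eventually_sequentially by blast
  have "v (s i - s j) < e" if "i \<ge> N" "j \<ge> N" for i j
    using v_diff[of "s i" "s j"] assms(1) N[OF that(1)] N[OF that(2)] by simp
  then show "\<exists>N. \<forall>i\<ge>N. \<forall>j\<ge>N. v (s i - s j) < e" by blast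
qed

text \<open>A Cauchy sequence that is not null is eventually bounded away from 0. Finitely many
  terms may still vanish, and there inverse 0 = 0; so the product with the inverse is 1 only modulo
  null sequences.\<close>

lemma cauchy_inverse:
  assumes s: "\<forall>n. s n \<in> K" "cauchy s" and nn: "\<not> (\<lambda>n. v (s n)) \<longlonglongrightarrow> 0"
  shows "cauchy (\<lambda>n. inverse (s n))" and "(\<lambda>n. v (s n * inverse (s n) - 1)) \<longlonglongrightarrow> 0"
proof -
  obtain e where e: "0 < e" "\<And>N. \<exists>n\<ge>N. e \<le> v (s n)"
    using nn s(1) nonneg unfolding LIMSEQ_def by (force simp: dist_norm)
  then have "0 < e / 2" by simp
  then obtain N where N: "\<forall>i\<ge>N. \<forall>j\<ge>N. v (s i - s j) < e / 2"
    using s(2) unfolding cauchy_def by meson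
  obtain m where m: "m \<ge> N" "e \<le> v (s m)" using e(2) by blast
  have low: "e / 2 \<le> v (s n)" if "n \<ge> N" for n
  proof -
    have "v (s m - s n) < e / 2" using N m that by blast
    then show ?thesis using v_diff_ge[of "s m" "s n"] s(1) m(2) by simp
  qed
  then have nz: "s n \<noteq> 0" if "n \<ge> N" for n using that e(1) v_0 by fastforce
  show "cauchy (\<lambda>n. inverse (s n))"
    unfolding cauchy_def
  proof (intro allI impI)
    fix d :: real assume d: "0 < d"
    then have "0 < d * (e / 2 * (e / 2))" using e(1) by simp
    then obtain M where M: "\<forall>i\<ge>M. \<forall>j\<ge>M. v (s i - s j) < d * (e / 2 * (e / 2))"
      using s(2) unfolding cauchy_def by meson
    have "v (inverse (s i) - inverse (s j)) < d" if ij: "i \<ge> max M N" "j \<ge> max M N" for i j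
    proof -
      have "inverse (s i) - inverse (s j) = (s j - s i) / (s i * s j)"
        using nz ij by (simp add: field_simps)
      then have "v (inverse (s i) - inverse (s j)) = v (s j - s i) / (v (s i) * v (s j))"
        using s(1) diff mult by (simp add: v_divide v_mult)
      also have "\<dots> \<le> v (s j - s i) / (e / 2 * (e / 2))"
        using low ij e(1) nonneg diff s(1) by (intro divide_left_mono mult_mono mult_pos_pos) (auto intro: less_le_trans[of 0 "e / 2"])
      also have "\<dots> < d"
        using M ij e(1) by (simp add: field_simps)
      finally show ?thesis .
    qed
    then show "\<exists>N. \<forall>i\<ge>N. \<forall>j\<ge>N. v (inverse (s i) - inverse (s j)) < d" by blast
  qed
  have "eventually (\<lambda>n. v (s n * inverse (s n) - 1) = 0) sequentially"
    unfolding eventually_sequentially using nz v_0 by (intro exI[of _ N]) auto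
  then show "(\<lambda>n. v (s n * inverse (s n) - 1)) \<longlonglongrightarrow> 0" by (rule tendsto_eventually)
qed

lemma cring_cauchy_seqs: "cring Cs"
proof (rule cringI)
  let ?R = Cs
  have ops: "x \<oplus>\<^bsub>?R\<^esub> y = (\<lambda>n. x n + y n)" "x \<otimes>\<^bsub>?R\<^esub> y = (\<lambda>n. x n * y n)"
    "\<one>\<^bsub>?R\<^esub> = (\<lambda>_. 1)" "\<zero>\<^bsub>?R\<^esub> = (\<lambda>_. 0)" for x y
    by (simp_all add: cauchy_seqs_def)
  show "abelian_group ?R"
  proof (rule abelian_groupI)
    fix x assume x: "x \<in> carrier ?R"
    show "\<exists>y\<in>carrier ?R. y \<oplus>\<^bsub>?R\<^esub> x = \<zero>\<^bsub>?R\<^esub>"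
      using x uminus by (intro bexI[of _ "\<lambda>n. - x n"]) (auto simp: ops carrier_cauchy_seqs cauchy_uminus)
  qed (auto simp: ops carrier_cauchy_seqs cauchy_add cauchy_const add zero fun_eq_iff)
  show "comm_monoid ?R"
    by (rule comm_monoidI) (auto simp: ops carrier_cauchy_seqs cauchy_mult cauchy_const mult one fun_eq_iff)
  show "(x \<oplus>\<^bsub>?R\<^esub> y) \<otimes>\<^bsub>?R\<^esub> z = x \<otimes>\<^bsub>?R\<^esub> z \<oplus>\<^bsub>?R\<^esub> y \<otimes>\<^bsub>?R\<^esub> z" for x y z
    by (auto simp: ops fun_eq_iff algebra_simps)
qed

lemma cauchy_seqs_ops:
  "x \<oplus>\<^bsub>Cs\<^esub> y = (\<lambda>n. x n + y n)" "x \<otimes>\<^bsub>Cs\<^esub> y = (\<lambda>n. x n * y n)"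
  "\<one>\<^bsub>Cs\<^esub> = (\<lambda>_. 1)" "\<zero>\<^bsub>Cs\<^esub> = (\<lambda>_. 0)"
  by (simp_all add: cauchy_seqs_def)

lemma cauchy_seqs_a_inv:
  assumes "x \<in> carrier Cs"
  shows "\<ominus>\<^bsub>Cs\<^esub> x = (\<lambda>n. - x n)"
proof -
  interpret cring Cs by (rule cring_cauchy_seqs)
  show ?thesis using assms uminus
    by (intro minus_equality) (auto simp: cauchy_seqs_ops carrier_cauchy_seqs cauchy_uminus)
qed

lemma cauchy_seqs_minus:
  assumes "x \<in> carrier Cs" "y \<in> carrier Cs"
  shows "x \<ominus>\<^bsub>Cs\<^esub> y = (\<lambda>n. x n - y n)"
  using assms by (simp add: a_minus_def cauchy_seqs_a_inv cauchy_seqs_ops)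

lemma ideal_null_seqs: "ideal (null_seqs K v) Cs"
proof (rule idealI)
  let ?R = Cs and ?N = "null_seqs K v"
  interpret R: cring ?R by (rule cring_cauchy_seqs)
  show "ring ?R" by (rule R.ring_axioms)
  have mult_null: "(\<lambda>n. x n * a n) \<in> ?N" if a: "a \<in> ?N" and x: "x \<in> carrier ?R" for a x
  proof -
    have x': "\<forall>n. x n \<in> K" "cauchy x" using x by (auto simp: carrier_cauchy_seqs)
    have a': "\<forall>n. a n \<in> K" "cauchy a" "(\<lambda>n. v (a n)) \<longlonglongrightarrow> 0" using a by (auto simp: in_null_seqs)
    obtain M where M: "0 < M" "\<And>n. v (x n) \<le> M" using cauchy_bounded[OF x'] by blast
    have "(\<lambda>n. M * v (a n)) \<longlonglongrightarrow> M * 0" using a'(3) by (intro tendsto_intros)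
    then have "(\<lambda>n. M * v (a n)) \<longlonglongrightarrow> 0" by simp
    then have "(\<lambda>n. v (x n * a n)) \<longlonglongrightarrow> 0"
      using x' a' M nonneg mult by (elim null_squeeze) (auto simp: v_mult mult_right_mono)
    then show ?thesis using x' a' mult cauchy_mult by (simp add: in_null_seqs)
  qed
  show "subgroup ?N (add_monoid ?R)"
  proof
    show "?N \<subseteq> carrier (add_monoid ?R)" by (auto simp: null_seqs_def)
    show "\<one>\<^bsub>add_monoid ?R\<^esub> \<in> ?N"
      by (auto simp: cauchy_seqs_ops in_null_seqs zero cauchy_const v_0)
    show "x \<otimes>\<^bsub>add_monoid ?R\<^esub> y \<in> ?N" if xy: "x \<in> ?N" "y \<in> ?N" for x y
    proof -
      have "(\<lambda>n. v (x n) + v (y n)) \<longlonglongrightarrow> 0 + 0" using xy by (intro tendsto_add) (auto simp: in_null_seqs)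
      then have "(\<lambda>n. v (x n) + v (y n)) \<longlonglongrightarrow> 0" by simp
      then have "(\<lambda>n. v (x n + y n)) \<longlonglongrightarrow> 0"
        using xy v_add nonneg add by (elim null_squeeze) (auto simp: in_null_seqs)
      then show ?thesis using xy add cauchy_add by (simp add: in_null_seqs cauchy_seqs_ops)
    qed
    show "inv\<^bsub>add_monoid ?R\<^esub> x \<in> ?N" if x: "x \<in> ?N" for x
    proof -
      have xc: "x \<in> carrier ?R" using x by (simp add: null_seqs_def)
      have "inv\<^bsub>add_monoid ?R\<^esub> x = (\<lambda>n. - x n)"
        using cauchy_seqs_a_inv[OF xc] by (simp add: a_inv_def)
      moreover have "(\<lambda>n. - x n) \<in> ?N"
        using x by (simp add: in_null_seqs v_uminus uminus cauchy_uminus)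
      ultimately show ?thesis by simp
    qed
  qed
  show "x \<otimes>\<^bsub>?R\<^esub> a \<in> ?N" if "a \<in> ?N" "x \<in> carrier ?R" for a x
    using mult_null[OF that] by (simp add: cauchy_seqs_ops)
  show "a \<otimes>\<^bsub>?R\<^esub> x \<in> ?N" if "a \<in> ?N" "x \<in> carrier ?R" for a x
    using mult_null[OF that] by (simp add: cauchy_seqs_ops mult.commute)
qed

abbreviation coset :: "(nat \<Rightarrow> 'a) \<Rightarrow> (nat \<Rightarrow> 'a) set" where
  "coset s \<equiv> null_seqs K v +>\<^bsub>Cs\<^esub> s"

lemma coset_eq:
  assumes "s \<in> carrier Cs" "\<forall>n. t n \<in> K" "(\<lambda>n. v (s n - t n)) \<longlonglongrightarrow> 0"
  shows "t \<in> carrier Cs" "coset s = coset t"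
proof -
  interpret R: cring Cs by (rule cring_cauchy_seqs)
  have s: "\<forall>n. s n \<in> K" "cauchy s" using assms(1) by (auto simp: carrier_cauchy_seqs)
  have d: "\<forall>n. s n - t n \<in> K" using s assms(2) diff by blast
  have c: "cauchy (\<lambda>n. s n - t n)" using cauchy_null[OF d assms(3)] .
  have "cauchy (\<lambda>n. s n - (s n - t n))" using cauchy_diff[OF s d c] .
  then show t: "t \<in> carrier Cs" using assms(2) by (simp add: carrier_cauchy_seqs)
  have "s \<ominus>\<^bsub>Cs\<^esub> t \<in> null_seqs K v"
    using cauchy_seqs_minus[OF assms(1) t] d c assms(3) by (simp add: in_null_seqs)
  then show "coset s = coset t"
    using R.quotient_eq_iff_same_a_r_cos[OF ideal_null_seqs assms(1) t] by simp
qed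

lemma completion_ring_hom: "ring_hom_ring Cs Kv coset"
  using ideal.rcos_ring_hom_ring[OF ideal_null_seqs] by (simp add: completion_def)

lemma carrier_completion: "carrier Kv = coset ` carrier Cs"
  by (auto simp: completion_def FactRing_def A_RCOSETS_def')

lemma coset_inverse:
  assumes s: "s \<in> carrier Cs" and nz: "coset s \<noteq> \<zero>\<^bsub>Kv\<^esub>"
  shows "(\<lambda>n. inverse (s n)) \<in> carrier Cs"
    and "coset s \<otimes>\<^bsub>Kv\<^esub> coset (\<lambda>n. inverse (s n)) = \<one>\<^bsub>Kv\<^esub>"
proof -
  interpret h: ring_hom_ring Cs Kv coset by (rule completion_ring_hom)
  have sK: "\<forall>n. s n \<in> K" "cauchy s" using s by (auto simp: carrier_cauchy_seqs)
  have nn: "\<not> (\<lambda>n. v (s n)) \<longlonglongrightarrow> 0"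
    using coset_eq(2)[OF s, of "\<lambda>_. 0"] nz zero h.hom_zero by (auto simp: cauchy_seqs_ops)
  show t: "(\<lambda>n. inverse (s n)) \<in> carrier Cs"
    using cauchy_inverse(1)[OF sK nn] sK inverse by (simp add: carrier_cauchy_seqs)
  have "coset s \<otimes>\<^bsub>Kv\<^esub> coset (\<lambda>n. inverse (s n)) = coset (\<lambda>n. s n * inverse (s n))"
    using h.hom_mult[OF s t] by (simp add: cauchy_seqs_ops)
  also have "\<dots> = coset (\<lambda>_. 1)"
    using h.R.m_closed[OF s t] cauchy_inverse(2)[OF sK nn] one
    by (intro coset_eq(2)) (auto simp: cauchy_seqs_ops)
  also have "\<dots> = \<one>\<^bsub>Kv\<^esub>" using h.hom_one by (simp add: cauchy_seqs_ops)
  finally show "coset s \<otimes>\<^bsub>Kv\<^esub> coset (\<lambda>n. inverse (s n)) = \<one>\<^bsub>Kv\<^esub>" .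
qed

lemma field_completion: "field Kv"
proof -
  interpret N: ideal "null_seqs K v" Cs by (rule ideal_null_seqs)
  interpret C: cring Kv
    using N.quotient_is_cring[OF cring_cauchy_seqs] by (simp add: completion_def)
  interpret h: ring_hom_ring Cs Kv coset by (rule completion_ring_hom)
  have zero_eq: "\<zero>\<^bsub>Kv\<^esub> = coset (\<lambda>_. 0)" using h.hom_zero by (simp add: cauchy_seqs_ops)
  have one_eq: "\<one>\<^bsub>Kv\<^esub> = coset (\<lambda>_. 1)" using h.hom_one by (simp add: cauchy_seqs_ops)
  show ?thesis
  proof (rule C.cring_fieldI2)
    show "\<zero>\<^bsub>Kv\<^esub> \<noteq> \<one>\<^bsub>Kv\<^esub>"
    proof
      assume "\<zero>\<^bsub>Kv\<^esub> = \<one>\<^bsub>Kv\<^esub>"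
      then have "(\<lambda>_. 1) \<ominus>\<^bsub>Cs\<^esub> (\<lambda>_. 0) \<in> null_seqs K v"
        using N.quotient_eq_iff_same_a_r_cos[OF ideal_null_seqs N.one_closed N.zero_closed]
        by (simp add: zero_eq one_eq cauchy_seqs_ops)
      then have "(\<lambda>_. 1) \<in> null_seqs K v"
        using cauchy_seqs_minus[OF N.one_closed N.zero_closed] by (simp add: cauchy_seqs_ops)
      then have "(\<lambda>n::nat. 1::real) \<longlonglongrightarrow> 0" by (simp add: in_null_seqs v_1)
      then show False by (simp add: LIMSEQ_const_iff)
    qed
    fix a assume a: "a \<in> carrier Kv" "a \<noteq> \<zero>\<^bsub>Kv\<^esub>"
    then obtain s where s: "s \<in> carrier Cs" "a = coset s" by (auto simp: carrier_completion)
    then show "\<exists>b\<in>carrier Kv. a \<otimes>\<^bsub>Kv\<^esub> b = \<one>\<^bsub>Kv\<^esub>"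
      using coset_inverse[of s] a(2) by (auto simp: carrier_completion)
  qed
qed

lemma rat_completion_eq:
  "rat_completion K v = coset ` {s \<in> carrier Cs. \<forall>n. s n \<in> \<rat>}"
  by (auto simp: rat_completion_def)

lemma subfield_rat_completion: "subfield (rat_completion K v) Kv"
proof -
  interpret C: field Kv by (rule field_completion)
  interpret h: ring_hom_ring Cs Kv coset by (rule completion_ring_hom)
  let ?Q = "{s \<in> carrier Cs. \<forall>n. s n \<in> \<rat>}"
  have "subring ?Q Cs"
    by (rule h.R.subringI)
      (auto simp: cauchy_seqs_ops cauchy_seqs_a_inv carrier_cauchy_seqs cauchy_const cauchy_add
        cauchy_mult cauchy_uminus one add mult uminus)
  then have sub: "subring (rat_completion K v) Kv"
    unfolding rat_completion_eq by (rule h.img_is_subring)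
  show ?thesis
  proof (rule C.subfieldI'[OF sub])
    fix a assume a: "a \<in> rat_completion K v - {\<zero>\<^bsub>Kv\<^esub>}"
    then obtain s where s: "s \<in> carrier Cs" "\<forall>n. s n \<in> \<rat>" "a = coset s"
      by (auto simp: rat_completion_eq)
    have nz: "coset s \<noteq> \<zero>\<^bsub>Kv\<^esub>" using a s(3) by simp
    note t = coset_inverse[OF s(1) nz]
    then have "inv\<^bsub>Kv\<^esub> a = coset (\<lambda>n. inverse (s n))"
      using s by (intro C.comm_inv_char) (auto simp: carrier_completion)
    then show "inv\<^bsub>Kv\<^esub> a \<in> rat_completion K v"
      using s t by (auto simp: rat_completion_eq)
  qed
qed

text \<open>
  If the rational coefficients \<open>q n\<close> of \<open>e\<close> do not form a Cauchy sequence, then \<open>- e\<close> is a limit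
  of elements of the span of the remaining vectors, so that \<open>e\<close> can be eliminated.
\<close>

lemma coset_in_Span:
  assumes "set es \<subseteq> K" "s \<in> carrier Cs" "\<forall>n. s n \<in> rat_vs.span (set es)"
  shows "coset s \<in> ring.Span Kv (rat_completion K v) (map (\<lambda>e. coset (\<lambda>_. e)) es)"
  using assms
proof (induction es arbitrary: s)
  case Nil
  interpret C: field Kv by (rule field_completion)
  interpret h: ring_hom_ring Cs Kv coset by (rule completion_ring_hom)
  have "s = (\<lambda>_. 0)" using Nil(3) by (auto simp: fun_eq_iff)
  then show ?case using h.hom_zero by (simp add: cauchy_seqs_ops)
next
  case (Cons e es)
  interpret C: field Kv by (rule field_completion)
  interpret h: ring_hom_ring Cs Kv coset by (rule completion_ring_hom)
  let ?S = "C.Span (rat_completion K v) (map (\<lambda>e. coset (\<lambda>_. e)) es)"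
  have e: "e \<in> K" and es: "set es \<subseteq> K" using Cons.prems(1) by auto
  have spanK: "x \<in> K" if "x \<in> rat_vs.span (set es)" for x
    using that es by (induction rule: rat_vs.span_induct_alt) (auto intro!: zero add mult of_rat)
  have s: "\<forall>n. s n \<in> K" "cauchy s" using Cons.prems(2) by (auto simp: carrier_cauchy_seqs)
  have "\<forall>n. \<exists>q. s n - of_rat q * e \<in> rat_vs.span (set es)"
    using Cons.prems(3) rat_vs.span_insert[of e "set es"] by auto
  then obtain q where q: "\<And>n. s n - of_rat (q n) * e \<in> rat_vs.span (set es)" by metis
  have ec: "(\<lambda>_. e) \<in> carrier Cs" using e by (simp add: carrier_cauchy_seqs cauchy_const)
  show ?case
  proof (cases "cauchy (\<lambda>n. of_rat (q n))")
    case True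
    define w where "w n = s n - of_rat (q n) * e" for n
    have qc: "(\<lambda>n. of_rat (q n)) \<in> carrier Cs"
      using True of_rat by (simp add: carrier_cauchy_seqs)
    then have qe: "(\<lambda>n. of_rat (q n) * e) \<in> carrier Cs"
      using h.R.m_closed[OF qc ec] by (simp add: cauchy_seqs_ops)
    have wc: "w \<in> carrier Cs"
      unfolding w_def using h.R.minus_closed[OF Cons.prems(2) qe] cauchy_seqs_minus[OF Cons.prems(2) qe] by simp
    have "\<forall>n. w n \<in> rat_vs.span (set es)" using q by (simp add: w_def)
    then have w: "coset w \<in> ?S" by (rule Cons.IH[OF es wc])
    have "s = (\<lambda>n. of_rat (q n)) \<otimes>\<^bsub>Cs\<^esub> (\<lambda>_. e) \<oplus>\<^bsub>Cs\<^esub> w"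
      by (simp add: cauchy_seqs_ops w_def)
    then have "coset s = coset (\<lambda>n. of_rat (q n)) \<otimes>\<^bsub>Kv\<^esub> coset (\<lambda>_. e) \<oplus>\<^bsub>Kv\<^esub> coset w"
      using h.hom_add h.hom_mult qc ec wc h.R.m_closed by metis
    moreover have "coset (\<lambda>n. of_rat (q n)) \<in> rat_completion K v"
      using qc by (auto simp: rat_completion_eq)
    ultimately show ?thesis using w by (auto simp: C.line_extension_mem_iff)
  next
    case False
    then obtain \<epsilon> where \<epsilon>: "0 < \<epsilon>" "\<And>N. \<exists>i\<ge>N. \<exists>j\<ge>N. \<epsilon> \<le> v (of_rat (q i) - of_rat (q j))"
      unfolding cauchy_def by (metis not_less)
    \<comment> \<open>For late i, j the difference s i - s j is small while q i - q j has size at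
      least \<epsilon>. Their quotient is small and equals e plus an element of the span of
      \<open>es\<close>.\<close>
    have approx: "\<exists>u\<in>rat_vs.span (set es). v (e + u) < \<eta>" if \<eta>: "0 < \<eta>" for \<eta>
    proof -
      have "0 < \<eta> * \<epsilon>" using \<eta> \<epsilon> by simp
      then obtain N where N: "\<forall>i\<ge>N. \<forall>j\<ge>N. v (s i - s j) < \<eta> * \<epsilon>" using s(2) unfolding cauchy_def by meson
      obtain i j where ij: "i \<ge> N" "j \<ge> N" "\<epsilon> \<le> v (of_rat (q i) - of_rat (q j))" using \<epsilon>(2) by blast
      define r where "r = q i - q j"
      define u where "u = of_rat (inverse r) * ((s i - of_rat (q i) * e) - (s j - of_rat (q j) * e))"
      have r: "of_rat r = of_rat (q i) - (of_rat (q j) :: 'a)" by (simp add: r_def of_rat_diff)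
      have "v (of_rat r) \<ge> \<epsilon>" using ij(3) by (simp add: r)
      moreover from this have r0: "r \<noteq> 0" using \<epsilon>(1) v_0 by auto
      ultimately have "v (s i - s j) / v (of_rat r) \<le> v (s i - s j) / \<epsilon>"
        using \<epsilon>(1) nonneg diff s(1) by (intro divide_left_mono) auto
      also have "\<dots> < \<eta>" using N ij \<epsilon>(1) by (simp add: field_simps)
      finally have small: "v (s i - s j) / v (of_rat r) < \<eta>" .
      have "of_rat (inverse r) * (of_rat r * e) = (e::'a)" using r0 by (simp add: of_rat_inverse)
      then have "e + u = of_rat (inverse r) * (s i - s j)"
        by (simp add: u_def r algebra_simps)
      then have "e + u = (s i - s j) / of_rat r" by (simp add: of_rat_inverse divide_inverse mult.commute)
      then have "v (e + u) < \<eta>" using small s(1) diff of_rat by (simp add: v_divide)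
      moreover have "u \<in> rat_vs.span (set es)"
        unfolding u_def by (intro rat_vs.span_scale rat_vs.span_diff q)
      ultimately show ?thesis by blast
    qed
    \<comment> \<open>The error e + u n will be multiplied by q n, which may be unbounded, so the
      tolerance is divided by the size of q n; the summand 1 keeps the denominator positive.\<close>
    have "\<forall>n. \<exists>u\<in>rat_vs.span (set es). v (e + u) < 1 / (real (Suc n) * (1 + v (of_rat (q n))))"
    proof
      fix n
      have "0 < 1 / (real (Suc n) * (1 + v (of_rat (q n))))"
        using nonneg[OF of_rat, of "q n"] by (intro divide_pos_pos mult_pos_pos) auto
      then show "\<exists>u\<in>rat_vs.span (set es). v (e + u) < 1 / (real (Suc n) * (1 + v (of_rat (q n))))"
        by (rule approx)
    qed
    then obtain u where u: "\<And>n. u n \<in> rat_vs.span (set es)"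
      "\<And>n. v (e + u n) < 1 / (real (Suc n) * (1 + v (of_rat (q n))))" by metis
    define w where "w n = (s n - of_rat (q n) * e) - of_rat (q n) * u n" for n
    have wspan: "\<forall>n. w n \<in> rat_vs.span (set es)"
      unfolding w_def by (intro allI rat_vs.span_diff[OF q] rat_vs.span_scale u(1))
    have bound: "v (s n - w n) \<le> 1 / real (Suc n)" for n
    proof -
      have nq: "0 \<le> v (of_rat (q n))" using nonneg of_rat by blast
      have eu: "e + u n \<in> K" using e spanK u(1) add by blast
      have "s n - w n = of_rat (q n) * (e + u n)" by (simp add: w_def algebra_simps)
      then have "v (s n - w n) = v (of_rat (q n)) * v (e + u n)" using v_mult[OF of_rat eu] by simp
      also have "\<dots> \<le> (1 + v (of_rat (q n))) * (1 / (real (Suc n) * (1 + v (of_rat (q n)))))"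
        using u(2)[of n] nq nonneg[OF eu] by (intro mult_mono) auto
      also have "\<dots> = 1 / real (Suc n)" using nq by simp
      finally show ?thesis .
    qed
    have wK: "\<forall>n. w n \<in> K" using wspan spanK by blast
    have "(\<lambda>n. v (s n - w n)) \<longlonglongrightarrow> 0"
      using bound nonneg diff s(1) wK by (intro null_squeeze[OF LIMSEQ_Suc[OF lim_1_over_n]]) auto
    note eq = coset_eq[OF Cons.prems(2) wK this]
    have w: "coset w \<in> ?S" using Cons.IH[OF es eq(1) wspan] .
    have "\<zero>\<^bsub>Kv\<^esub> \<in> rat_completion K v"
      using subringE(2)[OF subfieldE(1)[OF subfield_rat_completion]] .
    moreover have "coset w \<in> carrier Kv" "coset (\<lambda>_. e) \<in> carrier Kv"
      using eq(1) ec by (auto simp: carrier_completion)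
    then have "coset s = \<zero>\<^bsub>Kv\<^esub> \<otimes>\<^bsub>Kv\<^esub> coset (\<lambda>_. e) \<oplus>\<^bsub>Kv\<^esub> coset w"
      using eq(2) by simp
    ultimately show ?thesis using w unfolding list.map C.Span.simps foldr_Cons o_apply C.line_extension_mem_iff by blast
  qed
qed

end

text \<open>The images of \<open>Bs\<close> span the completion over the completion of \<rat>, so
  \<open>dim\<close> is a genuine dimension; it is positive because a field is not the zero
  space.\<close>

lemma (in number_field_basis) local_degree_pos:
  assumes "absolute_value_on K v"
  shows "0 < local_degree K v"
proof -
  interpret absolute_value K v by (rule absolute_valueI) (use assms in auto)
  interpret C: field Kv by (rule field_completion)
  note Q = subfield_rat_completion
  obtain es where es: "set es = Bs" using finite_basis finite_list by blast
  let ?U = "map (\<lambda>e. coset (\<lambda>_. e)) es"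
  have U: "set ?U \<subseteq> carrier Kv"
    using basis_subset es by (auto simp: carrier_completion carrier_cauchy_seqs cauchy_const)
  have "carrier Kv \<subseteq> C.Span (rat_completion K v) ?U"
  proof
    fix a assume "a \<in> carrier Kv"
    then obtain s where s: "s \<in> carrier Cs" "a = coset s" by (auto simp: carrier_completion)
    then have "\<forall>n. s n \<in> rat_vs.span (set es)" using spanning es by (auto simp: carrier_cauchy_seqs)
    then show "a \<in> C.Span (rat_completion K v) ?U" using coset_in_Span s es basis_subset by simp
  qed
  then have "C.Span (rat_completion K v) ?U = carrier Kv"
    using C.Span_in_carrier[OF subringE(1)[OF subfieldE(1)[OF Q]] U] by blast
  then have "C.finite_dimension (rat_completion K v) (carrier Kv)"
    using C.Span_finite_dimension[OF Q U] by simp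
  then have dim: "C.dimension (local_degree K v) (rat_completion K v) (carrier Kv)"
    using C.finite_dimensionE[OF Q] by (simp add: local_degree_def over_def)
  have "local_degree K v \<noteq> 0"
  proof
    assume "local_degree K v = 0"
    then have "carrier Kv = {\<zero>\<^bsub>Kv\<^esub>}"
      using C.dimension_zero[OF Q] dim by simp
    then show False using C.one_closed C.one_not_zero by blast
  qed
  then show ?thesis by simp
qed


section \<open>Integer polynomials with a given root\<close>

text \<open>Integer coefficients allow one polynomial to be evaluated in K and in \<complex>, and
  keep divisibility by a prime available.\<close>

definition ipoly :: "int poly \<Rightarrow> 'a::field_char_0 \<Rightarrow> 'a" where
  "ipoly f x = poly (map_poly of_int f) x"

lemma ipoly_altdef: "ipoly f x = (\<Sum>i\<le>degree f. of_int (coeff f i) * x ^ i)"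
  by (simp add: ipoly_def poly_altdef degree_map_poly coeff_map_poly)

lemma ipoly_bounded_degree:
  "degree f \<le> n \<Longrightarrow> ipoly f x = (\<Sum>i\<le>n. of_int (coeff f i) * x ^ i)"
  unfolding ipoly_altdef by (rule sum.mono_neutral_left) (auto simp: coeff_eq_0)

lemma ipoly_0 [simp]: "ipoly 0 x = 0"
  by (simp add: ipoly_def)

lemma ipoly_pCons [simp]: "ipoly (pCons a f) x = of_int a + x * ipoly f x"
  by (cases "a = 0 \<and> f = 0") (auto simp: ipoly_def map_poly_pCons)

lemma ipoly_1 [simp]: "ipoly 1 x = 1"
  by (simp add: one_pCons)

lemma ipoly_add [simp]: "ipoly (f + g) x = ipoly f x + ipoly g x"
  by (induction f g rule: poly_induct2) (auto simp: algebra_simps)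

lemma ipoly_smult [simp]: "ipoly (smult a f) x = of_int a * ipoly f x"
  by (induction f) (auto simp: algebra_simps)

lemma ipoly_mult [simp]: "ipoly (f * g) x = ipoly f x * ipoly g x"
  by (induction f) (auto simp: algebra_simps)

lemma ipoly_diff [simp]: "ipoly (f - g) x = ipoly f x - ipoly g x"
  using ipoly_add[of "f - g" g x] by (simp del: ipoly_add)

lemma ipoly_monom [simp]: "ipoly (monom a n) x = of_int a * x ^ n"
  by (induction n) (auto simp: monom_0 monom_Suc)

lemma ipoly_sum [simp]: "ipoly (sum f I) x = (\<Sum>i\<in>I. ipoly (f i) x)"
  by (induction I rule: infinite_finite_induct) auto

lemma (in field_set) ipoly_closed: "x \<in> F \<Longrightarrow> ipoly f x \<in> F"
  by (induction f) (auto intro: closed)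

lemma clear_denominators:
  fixes c :: "nat \<Rightarrow> rat"
  obtains N :: int and m :: "nat \<Rightarrow> int" where "N > 0" "\<And>i. i \<le> d \<Longrightarrow> of_int N * c i = of_int (m i)"
proof -
  define N where "N = (\<Prod>i\<le>d. snd (quotient_of (c i)))"
  have "N > 0" unfolding N_def by (intro prod_pos) (simp add: quotient_of_denom_pos')
  moreover have "\<exists>m. of_int N * c i = of_int m" if "i \<le> d" for i
  proof -
    have "snd (quotient_of (c i)) dvd N" unfolding N_def using that by (intro dvd_prodI) auto
    then obtain k where k: "N = snd (quotient_of (c i)) * k" by (rule dvdE)
    have "c i = of_int (fst (quotient_of (c i))) / of_int (snd (quotient_of (c i)))"
      by (rule quotient_of_div) simp
    moreover have "snd (quotient_of (c i)) \<noteq> 0" using quotient_of_denom_pos'[of "c i"] by simp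
    ultimately have "of_int (snd (quotient_of (c i))) * c i = of_int (fst (quotient_of (c i)))"
      by (simp add: nonzero_eq_divide_eq mult.commute)
    then have "of_int N * c i = of_int (k * fst (quotient_of (c i)))"
      by (simp add: k algebra_simps)
    then show ?thesis by blast
  qed
  then have "\<exists>m. \<forall>i\<le>d. of_int N * c i = of_int (m i)" by metis
  ultimately show ?thesis using that by blast
qed

lemma (in number_field_basis) int_poly_root:
  assumes x: "x \<in> K"
  shows "\<exists>f. f \<noteq> 0 \<and> degree f \<le> card Bs \<and> ipoly f x = 0"
proof -
  define d where "d = card Bs"
  have "\<exists>c. (\<exists>i\<le>d. c i \<noteq> 0) \<and> (\<Sum>i\<le>d. of_rat (c i) * x ^ i) = 0"
  \<comment> \<open>Dependence is a property of sets, so coinciding powers are treated apart: they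
    give the relation x ^ i - x ^ j = 0.\<close>
  proof (cases "inj_on (\<lambda>i. x ^ i) {..d}")
    case False
    then obtain i j where ij: "i \<le> d" "j \<le> d" "i \<noteq> j" "x ^ i = x ^ j" by (auto simp: inj_on_def)
    define c :: "nat \<Rightarrow> rat" where "c k = (if k = i then 1 else 0) - (if k = j then 1 else 0)" for k
    have "of_rat (c k) * x ^ k = (if k = i then x ^ k else 0) - (if k = j then x ^ k else 0)" for k
      by (simp add: c_def of_rat_diff)
    then have "(\<Sum>k\<le>d. of_rat (c k) * x ^ k) = 0"
      using ij by (simp add: sum_subtractf sum.delta)
    moreover have "c i \<noteq> 0" using ij by (simp add: c_def)
    ultimately show ?thesis using ij(1) by blast
  next
    case True
    let ?S = "(\<lambda>i. x ^ i) ` {..d}"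
    have "card ?S = Suc d" using True by (simp add: card_image)
    moreover have "?S \<subseteq> rat_vs.span Bs" using spanning power[OF x] by blast
    ultimately have "rat_vs.dependent ?S"
      using rat_vs.independent_span_bound[OF finite_basis, of ?S] by (auto simp: d_def)
    then obtain u where u: "\<exists>z\<in>?S. u z \<noteq> 0" "(\<Sum>z\<in>?S. of_rat (u z) * z) = 0"
      using rat_vs.dependent_finite[of ?S] by blast
    have "(\<Sum>i\<le>d. of_rat (u (x ^ i)) * x ^ i) = 0" using u(2) True by (simp add: sum.reindex)
    then show ?thesis using u(1) by (intro exI[of _ "\<lambda>i. u (x ^ i)"]) auto
  qed
  then obtain c where c: "\<exists>i\<le>d. c i \<noteq> 0" "(\<Sum>i\<le>d. of_rat (c i) * x ^ i) = 0" by blast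
  obtain N m where N: "N > 0" "\<And>i. i \<le> d \<Longrightarrow> of_int N * c i = of_int (m i)"
    using clear_denominators[of d c] by metis
  define f where "f = (\<Sum>i\<le>d. monom (m i) i)"
  have co: "coeff f i = (if i \<le> d then m i else 0)" for i
    by (simp add: f_def coeff_sum sum.delta')
  have m: "of_int (m i) = of_int N * (of_rat (c i) :: 'a)" if "i \<le> d" for i
    using N(2)[OF that] by (metis of_rat_mult of_rat_of_int_eq)
  have "ipoly f x = of_int N * (\<Sum>i\<le>d. of_rat (c i) * x ^ i)"
    by (simp add: f_def sum_distrib_left m mult.assoc)
  then have "ipoly f x = 0" using c(2) by simp
  moreover have "f \<noteq> 0"
  proof -
    obtain i where i: "i \<le> d" "c i \<noteq> 0" using c(1) by blast
    then have "of_int (m i) \<noteq> (0::rat)" using N by (metis mult_eq_0_iff of_int_eq_0_iff less_irrefl)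
    then have "coeff f i \<noteq> 0" using i co by simp
    then show ?thesis by auto
  qed
  moreover have "degree f \<le> d" by (rule degree_le) (simp add: co)
  ultimately show ?thesis unfolding d_def by blast
qed

text \<open>Primitivity makes the divisibility hold over the integers. In particular the leading
  coefficient of f divides that of every integer polynomial vanishing at x, so a prime dividing it
  measures a failure of integrality of x.\<close>

definition minimal_poly :: "int poly \<Rightarrow> 'a::field_char_0 \<Rightarrow> bool" where
  "minimal_poly f x \<longleftrightarrow> content f = 1 \<and> ipoly f x = 0 \<and> (\<forall>g. ipoly g x = 0 \<longrightarrow> f dvd g)"

text \<open>Take the primitive part of a vanishing polynomial of least degree. Pseudo-division shows
  that f divides a g for some nonzero integer a, and Gauss's lemma on contents cancels a.\<close>

lemma minimal_poly_exists:
  fixes x :: "'a::field_char_0"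
  assumes "g \<noteq> 0" "ipoly g x = 0"
  shows "\<exists>f. minimal_poly f x"
proof -
  define P where "P h \<longleftrightarrow> h \<noteq> 0 \<and> ipoly h x = 0" for h
  have "P g" using assms by (simp add: P_def)
  then obtain h where h: "P h" "\<And>h'. P h' \<Longrightarrow> degree h \<le> degree h'"
    using arg_min_nat_lemma[of P g degree] by blast
  define f where "f = primitive_part h"
  have f0: "f \<noteq> 0" and cf: "content f = 1" and df: "degree f = degree h"
    using h(1) by (simp_all add: f_def P_def)
  have "ipoly h x = of_int (content h) * ipoly f x"
    unfolding f_def by (metis ipoly_smult content_times_primitive_part)
  then have fx: "ipoly f x = 0" using h(1) by (auto simp: P_def)
  have "f dvd g" if gx: "ipoly g x = 0" for g
  proof -
    obtain a q where a: "a \<noteq> 0" "smult a g = f * q + pseudo_mod g f"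
      using pseudo_mod(1)[OF f0] by blast
    have "of_int a * ipoly g x = ipoly f x * ipoly q x + ipoly (pseudo_mod g f) x"
      using arg_cong[OF a(2), of "\<lambda>h. ipoly h x"] by simp
    then have "ipoly (pseudo_mod g f) x = 0" using gx fx by simp
    then have "pseudo_mod g f = 0"
      using pseudo_mod(2)[OF f0, of g] h(2)[of "pseudo_mod g f"] df unfolding P_def by fastforce
    then have eq: "smult a g = f * q" using a(2) by simp
    then have "normalize a * content g = content q"
      using cf by (metis content_mult content_smult mult_1)
    then have "a dvd content q" by (metis dvd_triv_left normalize_dvd_iff)
    then have "[:a:] dvd q" by (simp add: const_poly_dvd_iff_dvd_content)
    then obtain q' where "q = [:a:] * q'" by (rule dvdE)
    then have "smult a g = smult a (f * q')" using eq by simp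
    then have "g = f * q'" using a(1) by (metis smult_cancel)
    then show ?thesis by simp
  qed
  then show ?thesis using cf fx unfolding minimal_poly_def by blast
qed

lemma (in number_field_basis) minimal_poly_exists:
  assumes "x \<in> K"
  shows "\<exists>f. minimal_poly f x \<and> f \<noteq> 0 \<and> degree f \<le> card Bs"
proof -
  obtain g where g: "g \<noteq> 0" "degree g \<le> card Bs" "ipoly g x = 0"
    using int_poly_root[OF assms] by blast
  then obtain f where f: "minimal_poly f x" using minimal_poly_exists by blast
  then have "f dvd g" using g(3) by (simp add: minimal_poly_def)
  then have "degree f \<le> card Bs" "f \<noteq> 0" using dvd_imp_degree_le[of f g] g by auto
  then show ?thesis using f by blast
qed


section \<open>Existence of extensions of the p-adic absolute value\<close>

lemma chain_Union_pair:
  assumes "subset.chain \<A> \<C>" "a \<in> \<Union>\<C>" "b \<in> \<Union>\<C>"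
  shows "\<exists>J\<in>\<C>. a \<in> J \<and> b \<in> J"
proof -
  obtain A B where AB: "A \<in> \<C>" "B \<in> \<C>" "a \<in> A" "b \<in> B" using assms(2,3) by blast
  then have "A \<subseteq> B \<or> B \<subseteq> A" using assms(1) by (auto simp: subset_chain_def)
  then show ?thesis using AB by blast
qed

text \<open>A ring together with a proper ideal is encoded by one set: a subring without 1. The ring
  is recovered later as the set of its multipliers.\<close>

definition nonunital :: "'a::field_char_0 set \<Rightarrow> bool" where
  "nonunital J \<longleftrightarrow> 0 \<in> J \<and> (\<forall>x\<in>J. \<forall>y\<in>J. x - y \<in> J \<and> x * y \<in> J) \<and> 1 \<notin> J"

text \<open>
  A maximal such \<open>I\<close> is the maximal ideal of a valuation ring, namely of its multiplier ring \<open>R\<close>;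
  this is a form of Chevalley's extension theorem.
\<close>

locale maximal_nonunital = field_set K for K :: "'a::field_char_0 set" +
  fixes I :: "'a set"
  assumes I_subset: "I \<subseteq> K" and nonunital_I: "nonunital I"
    and maximal: "J \<subseteq> K \<Longrightarrow> nonunital J \<Longrightarrow> I \<subseteq> J \<Longrightarrow> J = I"
begin

lemma I_zero: "0 \<in> I" and I_one: "1 \<notin> I"
  and I_diff: "x \<in> I \<Longrightarrow> y \<in> I \<Longrightarrow> x - y \<in> I"
  and I_mult: "x \<in> I \<Longrightarrow> y \<in> I \<Longrightarrow> x * y \<in> I"
  using nonunital_I by (auto simp: nonunital_def)

lemma I_uminus: "x \<in> I \<Longrightarrow> - x \<in> I"
  using I_diff[OF I_zero] by fastforce

lemma I_add: "x \<in> I \<Longrightarrow> y \<in> I \<Longrightarrow> x + y \<in> I"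
  using I_diff[of x "- y"] I_uminus by fastforce

lemma I_sum: "(\<And>i. i \<in> A \<Longrightarrow> f i \<in> I) \<Longrightarrow> sum f A \<in> I"
  by (induction A rule: infinite_finite_induct) (auto intro: I_zero I_add)

definition R :: "'a set" where
  "R = {r \<in> K. \<forall>i\<in>I. r * i \<in> I}"

lemma R_subset: "R \<subseteq> K" by (auto simp: R_def)

lemma R_I: "r \<in> R \<Longrightarrow> i \<in> I \<Longrightarrow> r * i \<in> I" by (auto simp: R_def)

lemma I_subset_R: "I \<subseteq> R" using I_subset I_mult by (auto simp: R_def)

lemma R_one: "1 \<in> R" by (auto simp: R_def one)

lemma R_mult: "x \<in> R \<Longrightarrow> y \<in> R \<Longrightarrow> x * y \<in> R" by (auto simp: R_def mult mult.assoc)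

lemma R_diff: "x \<in> R \<Longrightarrow> y \<in> R \<Longrightarrow> x - y \<in> R" by (auto simp: R_def diff left_diff_distrib I_diff)

lemma R_zero: "0 \<in> R" using R_diff[OF R_one R_one] by simp

lemma R_uminus: "x \<in> R \<Longrightarrow> - x \<in> R" using R_diff[OF R_zero] by fastforce

lemma R_add: "x \<in> R \<Longrightarrow> y \<in> R \<Longrightarrow> x + y \<in> R" using R_diff[of x "- y"] R_uminus by fastforce

lemma R_power: "x \<in> R \<Longrightarrow> x ^ n \<in> R" by (induction n) (auto intro: R_one R_mult)

lemma R_of_nat: "of_nat n \<in> R" by (induction n) (auto intro: R_zero R_one R_add)

lemma R_of_int: "of_int n \<in> R"
  by (cases n) (auto intro: R_of_nat R_uminus simp del: of_nat_Suc)

lemma I_unit: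
  assumes "r \<in> I" "r \<noteq> 0"
  shows "inverse r \<notin> R"
  using R_I[OF _ assms(1), of "inverse r"] assms(2) I_one by auto

text \<open>The values at y of polynomials with all coefficients in I form a set closed under the
  operations and containing I and y I. If it misses 1, maximality makes it equal to I.\<close>

lemma multiplier_if_proper:
  assumes y: "y \<in> K" and proper: "\<not> (\<exists>f. (\<forall>i. coeff f i \<in> I) \<and> poly f y = 1)"
  shows "y \<in> R"
proof -
  define J where "J = {poly f y | f. \<forall>i. coeff f i \<in> I}"
  have "J \<subseteq> K"
  proof
    fix z assume "z \<in> J"
    then obtain f where "z = poly f y" "\<forall>i. coeff f i \<in> I" unfolding J_def by blast
    then show "z \<in> K" using y I_subset by (auto simp: poly_altdef intro!: sum mult power)
  qed
  moreover have "nonunital J"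
    unfolding nonunital_def
  proof (intro conjI ballI)
    show "0 \<in> J" unfolding J_def using I_zero by (intro CollectI exI[of _ 0]) auto
    show "1 \<notin> J" unfolding J_def using proper by force
    fix a b assume "a \<in> J" "b \<in> J"
    then obtain f g where fg: "a = poly f y" "b = poly g y"
      "\<forall>i. coeff f i \<in> I" "\<forall>i. coeff g i \<in> I" unfolding J_def by blast
    show "a - b \<in> J" unfolding J_def using fg I_diff by (intro CollectI exI[of _ "f - g"]) auto
    show "a * b \<in> J" unfolding J_def using fg
      by (intro CollectI exI[of _ "f * g"]) (auto simp: coeff_mult intro!: I_sum I_mult)
  qed
  moreover have "I \<subseteq> J"
  proof
    fix i assume "i \<in> I"
    then show "i \<in> J" unfolding J_def using I_zero
      by (intro CollectI exI[of _ "[:i:]"]) (auto simp: coeff_pCons split: nat.splits)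
  qed
  ultimately have J: "J = I" by (rule maximal)
  have "y * i \<in> I" if "i \<in> I" for i
  proof -
    have "y * i \<in> J" unfolding J_def using that I_zero
      by (intro CollectI exI[of _ "[:0, i:]"]) (auto simp: coeff_pCons split: nat.splits)
    then show ?thesis using J by simp
  qed
  then show ?thesis using y by (simp add: R_def)
qed

text \<open>Since 1 - g0 is the sum of the terms g_k z ^ k for k \<ge> 1, the top term times 1 - g0
  becomes a combination of lower powers y ^ (n - k). So the relation for y is multiplied by 1 - g0,
  its top term replaced, and g0 added to restore the value 1.\<close>

lemma relation_reduce:
  assumes f: "\<forall>i. coeff f i \<in> I" "poly f y = 1"
    and g: "\<forall>i. coeff g i \<in> I" "poly g z = 1"
    and yz: "y * z = 1" and deg: "degree g \<le> degree f"
  shows "\<exists>f'. (\<forall>i. coeff f' i \<in> I) \<and> poly f' y = 1 \<and> degree f' < degree f"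
proof -
  define n m a g0 where "n = degree f" and "m = degree g"
    and "a = coeff f n" and "g0 = coeff g 0"
  have n0: "n \<noteq> 0"
  proof
    assume "n = 0"
    then have "poly f y = coeff f 0" by (simp add: n_def poly_altdef)
    then show False using f I_one by metis
  qed
  define f1 where "f1 = f - monom a n"
  define f2 where "f2 = (\<Sum>k=1..m. monom (a * coeff g k) (n - k))"
  define f' where "f' = [:g0:] + smult (1 - g0) f1 + f2"
  have c1: "coeff f1 i \<in> I" for i unfolding f1_def using f I_diff I_zero by (auto simp: a_def)
  have c2: "coeff f2 i \<in> I" for i
    unfolding f2_def using f g I_mult I_zero by (auto simp: coeff_sum a_def intro!: I_sum)
  have c0: "coeff [:g0:] i \<in> I" for i
    using g I_zero by (auto simp: g0_def coeff_pCons split: nat.splits)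
  have "coeff f' i \<in> I" for i
  proof -
    have "(1 - g0) * coeff f1 i = coeff f1 i - g0 * coeff f1 i"
      by (simp add: algebra_simps)
    then have "(1 - g0) * coeff f1 i \<in> I"
      using c1 g I_diff I_mult by (simp add: g0_def)
    then show ?thesis unfolding f'_def using I_add c0 c2 by simp
  qed
  moreover have "poly f' y = 1"
  proof -
    have "poly g z = g0 + (\<Sum>k=1..m. coeff g k * z ^ k)"
      unfolding poly_altdef m_def[symmetric] atMost_atLeast0 g0_def
      by (simp add: sum.atLeast_Suc_atMost)
    then have s: "(\<Sum>k=1..m. coeff g k * z ^ k) = 1 - g0" using g(2) by (simp add: eq_diff_eq add.commute)
    have yk: "y ^ (n - k) = y ^ n * z ^ k" if "k \<le> m" for k
    proof -
      have "y ^ n = y ^ (n - k) * y ^ k" using that deg by (simp add: n_def m_def flip: power_add)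
      then have "y ^ n * z ^ k = y ^ (n - k) * (y * z) ^ k" by (simp add: power_mult_distrib)
      then show ?thesis using yz by simp
    qed
    have "poly f2 y = (\<Sum>k=1..m. a * y ^ n * (coeff g k * z ^ k))"
      unfolding f2_def by (simp add: poly_sum poly_monom yk algebra_simps)
    also have "\<dots> = a * y ^ n * (1 - g0)" by (simp flip: s sum_distrib_left)
    finally have "poly f' y = g0 + (1 - g0) * (1 - a * y ^ n) + a * y ^ n * (1 - g0)"
      using f(2) by (simp add: f'_def f1_def poly_monom)
    then show ?thesis by (simp add: algebra_simps)
  qed
  moreover have "degree f' < n"
  proof -
    have "coeff f' i = 0" if "i > n - 1" for i
    proof -
      have "coeff f1 i = 0"
        using that n0 by (cases "i = n") (auto simp: f1_def a_def n_def coeff_eq_0)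
      moreover have "coeff f2 i = 0"
        unfolding f2_def using that n0 by (auto simp: coeff_sum intro!: sum.neutral)
      ultimately show ?thesis using that n0 by (auto simp: f'_def coeff_pCons split: nat.splits)
    qed
    then have "degree f' \<le> n - 1" by (intro degree_le) auto
    then show ?thesis using n0 by simp
  qed
  ultimately show ?thesis unfolding n_def by blast
qed

lemma no_two_relations:
  assumes "\<forall>i. coeff f i \<in> I" "poly f y = 1"
    and "\<forall>i. coeff g i \<in> I" "poly g z = 1" "y * z = 1"
  shows False
  using assms
proof (induction "degree f + degree g" arbitrary: f g y z rule: less_induct)
  case less
  show False
  proof (cases "degree g \<le> degree f")
    case True
    then obtain f' where "\<forall>i. coeff f' i \<in> I" "poly f' y = 1" "degree f' < degree f"
      using relation_reduce[OF less.prems] by blast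
    then show False using less.hyps[of f' g y z] less.prems by simp
  next
    case False
    then obtain g' where "\<forall>i. coeff g' i \<in> I" "poly g' z = 1" "degree g' < degree g"
      using relation_reduce[OF less.prems(3,4,1,2)] less.prems(5) by (auto simp: mult.commute)
    then show False using less.hyps[of f g' y z] less.prems by simp
  qed
qed

lemma valuation_ring:
  assumes "y \<in> K"
  shows "y \<in> R \<or> inverse y \<in> R"
proof (cases "y = 0")
  case False
  then show ?thesis
    using multiplier_if_proper[OF assms] multiplier_if_proper[OF inverse[OF assms]]
      no_two_relations[of _ y _ "inverse y"] by force
qed (simp add: R_zero)

text \<open>If r \<notin> I, then i / r \<in> R for all i \<in> I, as otherwise r = (r / i) i would
  lie in I. Hence r R contains I, and it misses 1 because r is not a unit; maximality then forces r
  \<in> I.\<close>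

lemma nonunit_in_I:
  assumes r: "r \<in> R" "inverse r \<notin> R"
  shows "r \<in> I"
proof (rule ccontr)
  assume rI: "r \<notin> I"
  have r0: "r \<noteq> 0" using r R_zero by auto
  define J where "J = {r * t | t. t \<in> R}"
  have "J \<subseteq> K" using r R_subset mult by (auto simp: J_def)
  moreover have "nonunital J"
    unfolding nonunital_def
  proof (intro conjI ballI)
    show "0 \<in> J" unfolding J_def using R_zero by force
    show "1 \<notin> J" using r(2) r0 by (auto simp: J_def dest: inverse_unique)
    fix a b assume "a \<in> J" "b \<in> J"
    then obtain s t where st: "a = r * s" "b = r * t" "s \<in> R" "t \<in> R" by (auto simp: J_def)
    have "a - b = r * (s - t)" "a * b = r * (s * (r * t))" using st by (auto simp: algebra_simps)
    then show "a - b \<in> J" "a * b \<in> J" unfolding J_def using st r R_mult R_diff by blast+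
  qed
  moreover have "I \<subseteq> J"
  proof
    fix i assume i: "i \<in> I"
    have "i / r \<in> R"
    proof (rule ccontr)
      assume no: "i / r \<notin> R"
      then have "i \<noteq> 0" using R_zero by auto
      have "inverse (i / r) \<in> R" using valuation_ring[of "i / r"] no i r I_subset R_subset divide by blast
      then have "inverse (i / r) * i \<in> I" using i R_I by blast
      then show False using rI \<open>i \<noteq> 0\<close> by simp
    qed
    moreover have "i = r * (i / r)" using r0 by simp
    ultimately show "i \<in> J" unfolding J_def by blast
  qed
  ultimately have "J = I" by (rule maximal)
  moreover have "r \<in> J" unfolding J_def using R_one by force
  ultimately show False using rI by simp
qed

end


section \<open>From the valuation ring to a p-adic absolute value\<close>

locale padic_ideal = maximal_nonunital K I for K :: "'a::field_char_0 set" and I +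
  fixes p :: nat
  assumes prime: "prime p" and p_in_I: "of_nat p \<in> I"
    and algebraic: "y \<in> K \<Longrightarrow> \<exists>f. f \<noteq> 0 \<and> ipoly f y = 0"
begin

lemma not_dvd_not_in_I:
  assumes "\<not> int p dvd c"
  shows "of_int c \<notin> I"
proof
  assume c: "of_int c \<in> I"
  have "coprime (int p) c" using prime assms by (simp add: prime_imp_coprime)
  then obtain a b where "a * int p + b * c = 1" using bezout_int[of "int p" c] by auto
  then have "of_int (a * int p + b * c) = (1::'a)" by simp
  then have "of_int a * of_nat p + of_int b * of_int c = (1::'a)" by simp
  moreover have "of_int a * of_nat p + of_int b * of_int c \<in> I"
    using R_I[OF R_of_int] p_in_I c I_add by blast
  ultimately show False using I_one by simp
qed

lemma not_dvd_unit: "\<not> int p dvd c \<Longrightarrow> inverse (of_int c) \<in> R"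
  using not_dvd_not_in_I nonunit_in_I[OF R_of_int] by blast

definition P :: "int \<Rightarrow> 'a" where
  "P k = of_nat p powi k"

lemma p_nz: "of_nat p \<noteq> (0::'a)"
  using prime by (auto dest: prime_gt_0_nat)

lemma P_nz: "P k \<noteq> 0"
  using p_nz by (simp add: P_def)

lemma P_K: "P k \<in> K"
  by (auto simp: P_def power_int_def intro: power inverse of_nat)

lemma P_add: "P (k + l) = P k * P l"
  using p_nz by (simp add: P_def power_int_add)

lemma P_0: "P 0 = 1"
  by (simp add: P_def)

lemma P_uminus: "P (- k) = inverse (P k)"
  by (simp add: P_def power_int_minus)

lemma P_mult: "P (k * int n) = P k ^ n"
  by (simp add: P_def power_int_mult)

lemma P_of_nat: "P (int n) = of_nat p ^ n"
  by (simp add: P_def)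

lemma P_in_R_iff: "P k \<in> R \<longleftrightarrow> 0 \<le> k"
proof
  show "P k \<in> R" if "0 \<le> k" using that R_power[OF R_of_nat] by (simp add: P_def power_int_def)
  show "0 \<le> k" if "P k \<in> R"
  proof (rule ccontr)
    assume "\<not> 0 \<le> k"
    then obtain n where n: "k = - int (Suc n)" by (metis negD not_le)
    have "of_nat p ^ n * of_nat p \<in> I" using R_I[OF R_power[OF R_of_nat] p_in_I] .
    then have "of_nat p ^ Suc n \<in> I" by (simp add: mult.commute)
    then have "inverse (of_nat p ^ Suc n) \<notin> R" by (rule I_unit) (use p_nz in simp)
    then show False using that by (simp only: n P_uminus P_of_nat)
  qed
qed

lemma int_decompose:
  assumes "a \<noteq> 0"
  obtains k c where "a = int p ^ k * c" "\<not> int p dvd c" "k = multiplicity (int p) a"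
proof -
  have "\<not> is_unit (int p)" using prime by (metis not_prime_unit prime_nat_int_transfer)
  then show ?thesis using multiplicity_decompose'[of a "int p"] assms that by metis
qed

text \<open>This is the archimedean property that makes the valuation real-valued: algebraic
  elements are not infinitely large compared with powers of p. Otherwise every 1 / (p ^ k y) lies in
  I. Let p ^ k be the p-part of the leading coefficient; dividing the equation of y by p ^ k y ^ n
  puts the prime-to-p part c into I.\<close>

lemma denominator:
  assumes y: "y \<in> K"
  shows "\<exists>k. P (int k) * y \<in> R"
proof (rule ccontr)
  assume "\<not> ?thesis"
  then have no: "P (int k) * y \<notin> R" for k by blast
  then have y0: "y \<noteq> 0" using R_zero by auto
  have inI: "inverse (P (int k) * y) \<in> I" for k
    using valuation_ring[OF mult[OF P_K y], of "int k"] no[of k] by (intro nonunit_in_I) auto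
  obtain f where f: "f \<noteq> 0" "ipoly f y = 0" using algebraic[OF y] by blast
  define n where "n = degree f"
  have "coeff f n \<noteq> 0" using f(1) by (simp add: n_def)
  then obtain k c where kc: "coeff f n = int p ^ k * c" "\<not> int p dvd c"
    by (rule int_decompose)
  have "(\<Sum>i\<le>n. of_int (coeff f i) * y ^ i) = 0" using f(2) by (simp add: ipoly_altdef n_def)
  then have "of_int (coeff f n) * y ^ n = - (\<Sum>i<n. of_int (coeff f i) * y ^ i)"
    by (simp add: lessThan_Suc_atMost[symmetric] eq_neg_iff_add_eq_0 add.commute)
  then have "of_int c * (P (int k) * y ^ n) = - (\<Sum>i<n. of_int (coeff f i) * y ^ i)"
    by (simp add: kc(1) P_of_nat mult_ac)
  then have "of_int c = - (\<Sum>i<n. of_int (coeff f i) * y ^ i) / (P (int k) * y ^ n)"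
    using y0 P_nz by (intro eq_divide_imp) auto
  also have "\<dots> = - (\<Sum>i<n. of_int (coeff f i) * (y ^ i / (P (int k) * y ^ n)))"
    by (simp add: sum_divide_distrib)
  also have "\<dots> \<in> I"
  proof (intro I_uminus I_sum R_I[OF R_of_int])
    fix i assume "i \<in> {..<n}"
    then have n: "n = i + Suc (n - Suc i)" by simp
    have "y ^ i / (P (int k) * y ^ n) = inverse y ^ (n - Suc i) * inverse (P (int k) * y)"
      by (subst n, subst power_add) (use y0 in \<open>simp add: field_simps\<close>)
    moreover have "inverse y \<in> R" using inI[of 0] I_subset_R by (auto simp: P_0)
    ultimately show "y ^ i / (P (int k) * y ^ n) \<in> I" using R_I[OF R_power inI] by simp
  qed
  finally show False using not_dvd_not_in_I[OF kc(2)] by simp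
qed

text \<open>A Dedekind cut for the valuation of y normalised by the value 1 at p: k / n belongs to
  it when y ^ n is divisible by p ^ k in R. Its supremum \<open>L\<close> is the real
  valuation.\<close>

definition cut :: "'a \<Rightarrow> real set" where
  "cut y = {of_int k / of_nat n | k n. n > 0 \<and> y ^ n * P (- k) \<in> R}"

definition L :: "'a \<Rightarrow> real" where
  "L y = Sup (cut y)"

lemma cutI: "n > 0 \<Longrightarrow> y ^ n * P (- k) \<in> R \<Longrightarrow> of_int k / of_nat n \<in> cut y"
  unfolding cut_def by blast

lemma cut_add:
  assumes "a \<in> cut y" "b \<in> cut z"
  shows "a + b \<in> cut (y * z)"
proof -
  obtain k n where a: "a = of_int k / of_nat n" "n > 0" "y ^ n * P (- k) \<in> R"
    using assms(1) unfolding cut_def by blast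
  obtain l m where b: "b = of_int l / of_nat m" "m > 0" "z ^ m * P (- l) \<in> R"
    using assms(2) unfolding cut_def by blast
  have "(y ^ n * P (- k)) ^ m * (z ^ m * P (- l)) ^ n \<in> R" using a b R_mult R_power by simp
  moreover have "(y ^ n * P (- k)) ^ m * (z ^ m * P (- l)) ^ n
      = (y * z) ^ (n * m) * (P (- k * int m) * P (- l * int n))"
    unfolding P_mult by (simp add: power_mult_distrib power_mult mult_ac flip: power_mult)
  ultimately have "(y * z) ^ (n * m) * P (- (k * int m + l * int n)) \<in> R"
    by (simp flip: P_add)
  moreover have "a + b = of_int (k * int m + l * int n) / of_nat (n * m)"
    using a b by (simp add: field_simps)
  ultimately show ?thesis using cutI[of "n * m" "y * z" "k * int m + l * int n"] a b by simp
qed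

lemma cut_one: "a \<in> cut 1 \<longleftrightarrow> a \<in> \<rat> \<and> a \<le> 0"
proof
  assume "a \<in> cut 1"
  then obtain k n where a: "a = of_int k / of_nat n" "n > 0" "P (- k) \<in> R"
    unfolding cut_def by auto
  then have "k \<le> 0" by (simp add: P_in_R_iff)
  then show "a \<in> \<rat> \<and> a \<le> 0" using a by (simp add: divide_nonpos_pos)
next
  assume a: "a \<in> \<rat> \<and> a \<le> 0"
  then obtain k n where kn: "n > 0" "a = of_int k / of_nat n"
    by (metis Rats_cases' of_int_of_nat_eq pos_int_cases of_nat_0_less_iff)
  then have "k \<le> 0" using a by (simp add: divide_le_0_iff)
  then show "a \<in> cut 1" unfolding kn(2) using kn(1) by (intro cutI) (auto simp: P_in_R_iff)
qed

lemma cut_nonempty: "y \<in> K \<Longrightarrow> cut y \<noteq> {}"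
proof -
  assume "y \<in> K"
  then obtain k where "P (int k) * y \<in> R" using denominator by blast
  then have "of_int (- int k) / of_nat 1 \<in> cut y" by (intro cutI) (auto simp: mult.commute)
  then show ?thesis by blast
qed

text \<open>Adding one fixed element of the cut of the inverse, which exists by
  \<open>denominator\<close>, lands in the cut of 1.\<close>

lemma cut_bdd:
  assumes "y \<in> K" "y \<noteq> 0"
  shows "bdd_above (cut y)"
proof -
  obtain b where b: "b \<in> cut (inverse y)" using cut_nonempty[OF inverse[OF assms(1)]] by blast
  have "a \<le> - b" if "a \<in> cut y" for a
    using cut_add[OF that b] assms(2) by (simp add: cut_one)
  then show ?thesis by (rule bdd_aboveI)
qed

lemma L_ge: "y \<in> K \<Longrightarrow> y \<noteq> 0 \<Longrightarrow> a \<in> cut y \<Longrightarrow> a \<le> L y"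
  unfolding L_def using cut_bdd by (intro cSup_upper)

lemma L_superadditive:
  assumes y: "y \<in> K" "y \<noteq> 0" and z: "z \<in> K" "z \<noteq> 0"
  shows "L y + L z \<le> L (y * z)"
proof -
  have "a + b \<le> L (y * z)" if "a \<in> cut y" "b \<in> cut z" for a b
    using L_ge[OF _ _ cut_add[OF that]] y z mult by simp
  then have "b \<le> L (y * z) - a" if "a \<in> cut y" "b \<in> cut z" for a b using that by force
  then have "L z \<le> L (y * z) - a" if "a \<in> cut y" for a
    unfolding L_def[of z] using that by (intro cSup_least cut_nonempty z(1))
  then have "a \<le> L (y * z) - L z" if "a \<in> cut y" for a using that by force
  then have "L y \<le> L (y * z) - L z"
    unfolding L_def[of y] by (intro cSup_least cut_nonempty y(1))
  then show ?thesis by simp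
qed

lemma L_one: "L 1 = 0"
proof (rule antisym)
  show "L 1 \<le> 0" unfolding L_def using cut_nonempty[OF one] by (intro cSup_least) (auto simp: cut_one)
  show "0 \<le> L 1" using L_ge[OF one, of 0] by (simp add: cut_one)
qed

lemma L_inverse:
  assumes y: "y \<in> K" "y \<noteq> 0"
  shows "L (inverse y) = - L y"
proof (rule antisym)
  show "L (inverse y) \<le> - L y"
    using L_superadditive[OF y inverse[OF y(1)]] y by (simp add: L_one)
  show "- L y \<le> L (inverse y)"
  proof (rule ccontr)
    assume "\<not> ?thesis"
    then have "L y < - L (inverse y)" by simp
    \<comment> \<open>A rational k / n in this gap would mean that neither y ^ n / p ^ k nor its
      inverse lies in R.\<close>
    then obtain q where q: "q \<in> \<rat>" "L y < q" "q < - L (inverse y)" using Rats_dense_in_real by blast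
    then obtain k n where kn: "n > 0" "q = of_int k / of_nat n"
      by (metis Rats_cases' of_int_of_nat_eq pos_int_cases of_nat_0_less_iff)
    have "y ^ n * P (- k) \<notin> R" using L_ge[OF y cutI[OF kn(1)]] q(2) kn(2) by force
    then have "inverse (y ^ n * P (- k)) \<in> R"
      using valuation_ring[OF mult[OF power[OF y(1)] P_K]] by blast
    then have "inverse y ^ n * P (- (- k)) \<in> R" by (simp add: P_uminus power_inverse)
    then have "- q \<in> cut (inverse y)" using cutI[OF kn(1)] kn(2) by fastforce
    then show False using L_ge[OF inverse[OF y(1)]] y(2) q(3) by force
  qed
qed

lemma L_mult:
  assumes y: "y \<in> K" "y \<noteq> 0" and z: "z \<in> K" "z \<noteq> 0"
  shows "L (y * z) = L y + L z"
proof (rule antisym)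
  show "L y + L z \<le> L (y * z)" by (rule L_superadditive[OF y z])
  have "L (y * z) + L (inverse z) \<le> L (y * z * inverse z)"
    using y z mult inverse by (intro L_superadditive) auto
  then show "L (y * z) \<le> L y + L z" using z by (simp add: L_inverse mult.assoc)
qed

lemma L_R: "y \<in> R \<Longrightarrow> y \<noteq> 0 \<Longrightarrow> 0 \<le> L y"
  using L_ge[of y 0] cutI[of 1 y 0] R_subset by (auto simp: P_0)

lemma L_unit: "y \<in> R \<Longrightarrow> inverse y \<in> R \<Longrightarrow> y \<noteq> 0 \<Longrightarrow> L y = 0"
  using L_R[of y] L_R[of "inverse y"] L_inverse[of y] R_subset by force

lemma L_p: "L (of_nat p) = 1"
proof (rule antisym)
  have le: "a \<le> 1" if a: "a \<in> cut (of_nat p)" for a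
  proof -
    obtain k n where kn: "a = of_int k / of_nat n" "n > 0" "of_nat p ^ n * P (- k) \<in> R"
      using a unfolding cut_def by blast
    then have "P (int n - k) \<in> R" using P_add[of "int n" "- k"] by (simp add: P_of_nat)
    then show ?thesis using kn by (simp add: P_in_R_iff)
  qed
  show "L (of_nat p) \<le> 1"
    unfolding L_def using cut_nonempty[OF of_nat] le by (intro cSup_least)
  have "of_int 1 / of_nat 1 \<in> cut (of_nat p)"
    by (rule cutI) (use p_nz R_one in \<open>auto simp: P_def\<close>)
  then show "1 \<le> L (of_nat p)" using L_ge[OF of_nat p_nz] by simp
qed

lemma L_power: "y \<in> K \<Longrightarrow> y \<noteq> 0 \<Longrightarrow> L (y ^ n) = of_nat n * L y"
  by (induction n) (simp_all add: L_one L_mult power algebra_simps)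

lemma L_of_int: "a \<noteq> 0 \<Longrightarrow> L (of_int a) = of_nat (multiplicity (int p) a)"
proof -
  assume "a \<noteq> 0"
  then obtain k c where kc: "a = int p ^ k * c" "\<not> int p dvd c" "k = multiplicity (int p) a"
    by (rule int_decompose)
  then have c0: "of_int c \<noteq> (0::'a)" by auto
  have "L (of_int c) = 0" using L_unit[OF R_of_int not_dvd_unit[OF kc(2)]] c0 by simp
  moreover have "(of_int a :: 'a) = of_nat p ^ k * of_int c" by (simp add: kc(1))
  then have "L (of_int a) = of_nat k * L (of_nat p) + L (of_int c)"
    using L_mult[OF power[OF of_nat] _ of_int c0] L_power[OF of_nat p_nz] p_nz by simp
  ultimately show ?thesis using L_p kc(3) by simp
qed

lemma L_add:
  assumes y: "y \<in> K" "y \<noteq> 0" and z: "z \<in> K" "z \<noteq> 0" and yz: "y + z \<noteq> 0"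
  shows "min (L y) (L z) \<le> L (y + z)"
proof -
  have half: "L z \<le> L (y + z)" if y: "y \<in> K" "y \<noteq> 0" and z: "z \<in> K" "z \<noteq> 0" and yz: "y + z \<noteq> 0"
    and q: "y / z \<in> R" for y z
  proof -
    have eq: "y + z = z * (1 + y / z)" using z by (simp add: distrib_left)
    then have nz: "1 + y / z \<noteq> 0" using yz by auto
    have "0 \<le> L (1 + y / z)" using L_R[OF R_add[OF R_one q] nz] .
    moreover have "1 + y / z \<in> K" using y z by (intro add one divide)
    ultimately show ?thesis using L_mult[OF z _ nz] eq by simp
  qed
  consider "y / z \<in> R" | "z / y \<in> R" using valuation_ring[OF divide[OF y(1) z(1)]] by auto
  then show ?thesis
  proof cases
    case 1
    then show ?thesis using half[OF y z yz] by simp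
  next
    case 2
    then show ?thesis using half[OF z y] yz by (simp add: add.commute)
  qed
qed

definition padic_extension :: "'a \<Rightarrow> real" where
  "padic_extension = restrict (\<lambda>y. if y = 0 then 0 else of_nat p powr (- L y)) K"

lemma padic_extension: "padic_extension \<in> extensions K (padic_abs p)"
proof -
  have p1: "1 < real p" using prime prime_gt_1_nat by simp
  have "absolute_value_on K padic_extension"
    unfolding absolute_value_on_def
  proof (intro conjI ballI)
    show "padic_extension \<in> extensional K" by (simp add: padic_extension_def)
    fix x assume x: "x \<in> K"
    show "0 \<le> padic_extension x" "(padic_extension x = 0) = (x = 0)"
      using x p1 by (auto simp: padic_extension_def)
    fix y assume y: "y \<in> K"
    show "padic_extension (x * y) = padic_extension x * padic_extension y"
      using x y mult by (auto simp: padic_extension_def L_mult powr_add[symmetric])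
    show "padic_extension (x + y) \<le> padic_extension x + padic_extension y"
    proof (cases "x = 0 \<or> y = 0 \<or> x + y = 0")
      case True
      then show ?thesis using x y add p1 by (auto simp: padic_extension_def zero)
    next
      case False
      then have "L x \<le> L (x + y) \<or> L y \<le> L (x + y)" using L_add[of x y] x y by linarith
      then have "real p powr (- L (x + y)) \<le> real p powr (- L x) \<or>
          real p powr (- L (x + y)) \<le> real p powr (- L y)" using p1 by simp
      then have "real p powr (- L (x + y)) \<le> real p powr (- L x) + real p powr (- L y)"
        by (smt (verit) powr_ge_zero)
      then show ?thesis using x y add False by (simp add: padic_extension_def)
    qed
  qed
  moreover have "padic_extension (of_rat q) = padic_abs p q" for q
  proof (cases "q = 0")
    case True
    then show ?thesis by (simp add: padic_extension_def padic_abs_def zero)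
  next
    case False
    obtain a b where ab: "quotient_of q = (a, b)" by fastforce
    have b: "b > 0" using quotient_of_denom_pos[OF ab] .
    have q: "q = of_int a / of_int b" using quotient_of_div[OF ab] .
    have a: "a \<noteq> 0" using False q by auto
    have eq: "(of_rat q :: 'a) = of_int a * inverse (of_int b)" unfolding q by (simp only: divide_inverse of_rat_mult of_rat_inverse of_rat_of_int_eq)
    have "L (of_rat q) = of_nat (multiplicity (int p) a) - of_nat (multiplicity (int p) b)"
      unfolding eq using a b by (simp add: L_mult L_inverse L_of_int of_int inverse)
    then have "- L (of_rat q) = of_int (int (multiplicity (int p) b) - int (multiplicity (int p) a))" by simp
    then have "padic_extension (of_rat q) = real p powr of_int (int (multiplicity (int p) b) - int (multiplicity (int p) a))"
      using False of_rat by (simp add: padic_extension_def)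
    also have "\<dots> = real p powi (int (multiplicity (int p) b) - int (multiplicity (int p) a))"
      using p1 by (intro powr_real_of_int') auto
    finally show ?thesis using False ab by (simp add: padic_abs_def)
  qed
  ultimately show ?thesis by (simp add: extensions_def)
qed

text \<open>Membership of u = 1 / x in I gives only L u \<ge> 0; strictness needs some power of u to
  be divisible by p in R. If none is, then p x ^ n \<in> I for all n, and the equation of x puts an
  integer prime to p into I.\<close>

lemma padic_extension_gt_1:
  assumes x: "x \<in> K" "x \<noteq> 0" "inverse x \<in> I" and f: "content f = 1" "ipoly f x = 0"
  shows "1 < padic_extension x"
proof -
  define u where "u = inverse x"
  have u: "u \<in> I" "u \<in> K" "u \<noteq> 0" "u \<in> R" using x I_subset I_subset_R by (auto simp: u_def)
  have "\<exists>n>0. u ^ n * P (- 1) \<in> R"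
  proof (rule ccontr)
    assume no: "\<not> ?thesis"
    have inR: "of_nat p * x ^ n \<in> R" if "n > 0" for n
    proof -
      have "inverse (u ^ n * P (- 1)) \<in> R"
        using valuation_ring[OF mult[OF power[OF u(2)] P_K]] no that by blast
      then show ?thesis by (simp add: u_def P_def power_inverse mult.commute)
    qed
    have inI: "of_nat p * x ^ n \<in> I" for n
    proof -
      have "(of_nat p * x ^ Suc n) * u \<in> I" by (rule R_I[OF inR u(1)]) simp
      moreover have "(of_nat p * x ^ Suc n) * u = of_nat p * x ^ n" using x by (simp add: u_def)
      ultimately show ?thesis by (simp only:)
    qed
    have "x * u = 1" using x by (simp add: u_def)
    then have "x ^ i * u ^ i = 1" for i by (simp flip: power_mult_distrib)
    then have xu_cancel: "x ^ i * u ^ (i + k) = u ^ k" "x ^ (i + k) * u ^ i = x ^ k" for i k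
      by (simp add: power_add flip: mult.assoc, simp add: power_add mult.commute mult.left_commute)
    \<comment> \<open>Let j be the last index whose coefficient is prime to p; one exists as the
      content is 1. After multiplication by u ^ j, terms below j carry a factor u and terms above j
      a factor p x ^ (i - j), so all but the j-th lie in I.\<close>
    define S where "S = {i. \<not> int p dvd coeff f i}"
    have "S \<noteq> {}"
    proof
      assume "S = {}"
      then have "[:int p:] dvd f" by (simp add: S_def const_poly_dvd_iff)
      then have "int p dvd 1" using f(1) by (simp add: const_poly_dvd_iff_dvd_content)
      then show False using prime by (metis not_prime_unit prime_nat_int_transfer)
    qed
    moreover have fin: "finite S"
      by (rule finite_subset[of _ "{..degree f}"]) (auto simp: S_def intro: le_degree)
    ultimately have j: "Max S \<in> S" using Max_in by blast
    define j where "j = Max S"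
    have jn: "j \<le> degree f" and pj: "\<not> int p dvd coeff f j"
      using j by (auto simp: j_def S_def intro: le_degree)
    have big: "int p dvd coeff f i" if "i > j" for i
      using Max_ge[OF fin, of i] that by (auto simp: j_def S_def)
    have "(\<Sum>i\<le>degree f. of_int (coeff f i) * x ^ i * u ^ j) = 0"
      using f(2) by (simp add: ipoly_altdef flip: sum_distrib_right)
    moreover have "of_int (coeff f j) * x ^ j * u ^ j = of_int (coeff f j)"
      using x by (simp add: u_def power_inverse)
    ultimately have "of_int (coeff f j)
        = - (\<Sum>i\<in>{..degree f} - {j}. of_int (coeff f i) * x ^ i * u ^ j)"
      using jn by (simp add: sum.remove[of _ j] eq_neg_iff_add_eq_0)
    also have "\<dots> \<in> I"
    proof (intro I_uminus I_sum)
      fix i assume i: "i \<in> {..degree f} - {j}"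
      show "of_int (coeff f i) * x ^ i * u ^ j \<in> I"
      proof (cases "i < j")
        case True
        then have "x ^ i * u ^ j = u ^ (j - Suc i) * u"
          using xu_cancel(1)[of i "Suc (j - Suc i)"] by (simp add: mult.commute)
        then have "x ^ i * u ^ j \<in> I" using R_I[OF R_power[OF u(4)] u(1)] by simp
        then show ?thesis using R_I[OF R_of_int] by (simp add: mult.assoc)
      next
        case False
        then have "i > j" using i by auto
        then have xu: "x ^ i * u ^ j = x ^ (i - j)" using xu_cancel(2)[of j "i - j"] by simp
        obtain b where b: "coeff f i = int p * b" using big[OF \<open>i > j\<close>] by (rule dvdE)
        have "of_int (coeff f i) * x ^ i * u ^ j = of_int b * (of_nat p * x ^ (i - j))"
          by (simp add: b mult.assoc xu mult.left_commute)
        then show ?thesis using R_I[OF R_of_int inI] by simp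
      qed
    qed
    finally show False using not_dvd_not_in_I[OF pj] by simp
  qed
  then obtain n where n: "n > 0" "u ^ n * P (- 1) \<in> R" by blast
  then have "1 / of_nat n \<le> L u" using L_ge[OF u(2,3) cutI[OF n]] by simp
  moreover have "0 < 1 / real n" using n(1) by simp
  ultimately have "L x < 0" using L_inverse[OF x(1,2)] unfolding u_def by linarith
  moreover have "1 < real p" using prime prime_gt_1_nat by simp
  ultimately show ?thesis using x gr_one_powr[of "real p" "- L x"] by (simp add: padic_extension_def)
qed

end

text \<open>With u = 1 / x, the ideal \<open>I0\<close> generated by p and u in the ring of integer
  polynomials in u is proper. If 1 = h(u) with p dividing h(0), reversing 1 - h gives a polynomial
  vanishing at x with leading coefficient prime to p, although that of f divides it. Zorn enlarges
  \<open>I0\<close> to a maximal I, at whose absolute value x exceeds 1.\<close>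

lemma (in number_field_basis) padic_place_exists:
  assumes p: "prime p" and x: "x \<in> K" and f: "minimal_poly f x"
    and dvd: "int p dvd lead_coeff f"
  shows "\<exists>v\<in>extensions K (padic_abs p). 1 < v x"
proof -
  have lead: "\<not> ipoly g x = 0" if "\<not> int p dvd lead_coeff g" for g
  proof
    assume "ipoly g x = 0"
    then have "f dvd g" using f by (simp add: minimal_poly_def)
    then have "lead_coeff f dvd lead_coeff g" by (auto simp: lead_coeff_mult)
    then show False using dvd that dvd_trans by blast
  qed
  have np: "\<not> int p dvd 1" using p by (metis not_prime_unit prime_nat_int_transfer)
  have x0: "x \<noteq> 0" using lead[of "monom 1 1"] np by (auto simp: degree_monom_eq)
  define u where "u = inverse x"
  define \<A> where "\<A> = {J. J \<subseteq> K \<and> nonunital J \<and> of_nat p \<in> J \<and> u \<in> J}"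
  define I0 where "I0 = {ipoly h u | h. int p dvd coeff h 0}"
  have uK: "u \<in> K" using x inverse by (simp add: u_def)
  have "nonunital I0"
    unfolding nonunital_def
  proof (intro conjI ballI)
    show "0 \<in> I0" unfolding I0_def by (intro CollectI exI[of _ 0]) auto
    fix a b assume "a \<in> I0" "b \<in> I0"
    then obtain g h where gh: "a = ipoly g u" "b = ipoly h u" "int p dvd coeff g 0" "int p dvd coeff h 0"
      unfolding I0_def by blast
    show "a - b \<in> I0" unfolding I0_def using gh by (intro CollectI exI[of _ "g - h"]) auto
    show "a * b \<in> I0" unfolding I0_def using gh by (intro CollectI exI[of _ "g * h"]) (auto simp: coeff_mult)
  next
    show "1 \<notin> I0"
    proof
      assume "1 \<in> I0"
      then obtain h where h: "ipoly h u = 1" "int p dvd coeff h 0" unfolding I0_def by fastforce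
      define g where "g = 1 - h"
      have g0: "\<not> int p dvd coeff g 0"
      proof
        assume "int p dvd coeff g 0"
        then have "int p dvd coeff g 0 + coeff h 0" using h(2) by simp
        then show False using np by (simp add: g_def)
      qed
      have gu: "ipoly g u = 0" by (simp add: g_def h)
      define n where "n = degree g"
      have "ipoly (reflect_poly g) x = x ^ n * ipoly g u"
      proof -
        have "ipoly (reflect_poly g) x = (\<Sum>i\<le>n. of_int (coeff (reflect_poly g) i) * x ^ i)"
          unfolding n_def by (rule ipoly_bounded_degree[OF degree_reflect_poly_le])
        also have "\<dots> = (\<Sum>i\<le>n. of_int (coeff g (n - i)) * x ^ i)"
          by (simp add: coeff_reflect_poly n_def)
        also have "\<dots> = (\<Sum>i\<le>n. of_int (coeff g i) * x ^ (n - i))"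
          by (rule sum.reindex_bij_witness[of _ "\<lambda>i. n - i" "\<lambda>i. n - i"]) auto
        also have "\<dots> = (\<Sum>i\<le>n. x ^ n * (of_int (coeff g i) * u ^ i))"
          using x0 by (intro sum.cong) (auto simp: u_def power_diff power_inverse divide_inverse)
        finally show ?thesis by (simp add: ipoly_altdef n_def sum_distrib_left)
      qed
      then have "ipoly (reflect_poly g) x = 0" by (simp add: gu)
      moreover have "lead_coeff (reflect_poly g) = coeff g 0"
        using g0 by (subst degree_reflect_poly_eq) (auto simp: coeff_reflect_poly)
      ultimately show False using lead[of "reflect_poly g"] g0 by simp
    qed
  qed
  moreover have "I0 \<subseteq> K" unfolding I0_def using ipoly_closed[OF uK] by auto
  moreover have "of_nat p \<in> I0" unfolding I0_def by (intro CollectI exI[of _ "[:int p:]"]) auto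
  moreover have "u \<in> I0" unfolding I0_def by (intro CollectI exI[of _ "[:0, 1:]"]) auto
  ultimately have "I0 \<in> \<A>" by (simp add: \<A>_def)
  then have "\<A> \<noteq> {}" by blast
  moreover have "\<Union>\<C> \<in> \<A>" if C: "\<C> \<noteq> {}" "subset.chain \<A> \<C>" for \<C>
  proof -
    have sub: "J \<in> \<A>" if "J \<in> \<C>" for J using C(2) that by (auto simp: subset.chain_def)
    note two = chain_Union_pair[OF C(2)]
    have "nonunital (\<Union>\<C>)"
      unfolding nonunital_def
    proof (intro conjI ballI)
      show "0 \<in> \<Union>\<C>" "1 \<notin> \<Union>\<C>" using C(1) sub by (auto simp: \<A>_def nonunital_def)
      fix a b assume "a \<in> \<Union>\<C>" "b \<in> \<Union>\<C>"
      then obtain J where "J \<in> \<C>" "a \<in> J" "b \<in> J" using two by blast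
      moreover from this have "nonunital J" using sub by (simp add: \<A>_def)
      ultimately show "a - b \<in> \<Union>\<C>" "a * b \<in> \<Union>\<C>" by (auto simp: nonunital_def)
    qed
    then show ?thesis using C(1) sub by (auto simp: \<A>_def)
  qed
  ultimately obtain I where I: "I \<in> \<A>" "\<And>J. J \<in> \<A> \<Longrightarrow> I \<subseteq> J \<Longrightarrow> J = I"
    using subset_Zorn_nonempty[of \<A>] by blast
  interpret padic_ideal K I p
  proof
    show "I \<subseteq> K" "nonunital I" "of_nat p \<in> I" using I(1) by (auto simp: \<A>_def)
    show "J = I" if "J \<subseteq> K" "nonunital J" "I \<subseteq> J" for J
      using I that by (auto simp: \<A>_def)
    show "prime p" by fact
    show "\<exists>f. f \<noteq> 0 \<and> ipoly f y = 0" if "y \<in> K" for y using int_poly_root[OF that] by blast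
  qed
  have "1 < padic_extension x"
    using x x0 I(1) f by (intro padic_extension_gt_1) (auto simp: \<A>_def u_def minimal_poly_def)
  then show ?thesis using padic_extension by blast
qed


section \<open>Existence of archimedean absolute values\<close>

text \<open>Partial embeddings into the complex numbers are represented by their graphs.\<close>

locale hom_graph = field_set K for K :: "'a::field_char_0 set" +
  fixes G :: "('a \<times> complex) set"
  assumes dom: "(a, c) \<in> G \<Longrightarrow> a \<in> K"
    and g_one: "(1, 1) \<in> G"
    and g_diff: "(a, c) \<in> G \<Longrightarrow> (b, d) \<in> G \<Longrightarrow> (a - b, c - d) \<in> G"
    and g_mult: "(a, c) \<in> G \<Longrightarrow> (b, d) \<in> G \<Longrightarrow> (a * b, c * d) \<in> G"
    and g_zero_unique: "(0, c) \<in> G \<Longrightarrow> c = 0"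
    and algebraic: "a \<in> K \<Longrightarrow> \<exists>f. f \<noteq> 0 \<and> ipoly f a = 0"
begin

lemma g_zero: "(0, 0) \<in> G"
  using g_diff[OF g_one g_one] by simp

lemma g_uminus: "(a, c) \<in> G \<Longrightarrow> (- a, - c) \<in> G"
  using g_diff[OF g_zero] by fastforce

lemma g_add: "(a, c) \<in> G \<Longrightarrow> (b, d) \<in> G \<Longrightarrow> (a + b, c + d) \<in> G"
  using g_diff[of a c "- b" "- d"] g_uminus by fastforce

lemma g_sum: "(\<And>i. i \<in> I \<Longrightarrow> (f i, g i) \<in> G) \<Longrightarrow> (sum f I, sum g I) \<in> G"
  by (induction I rule: infinite_finite_induct) (auto intro: g_zero g_add)

lemma g_of_nat: "(of_nat n, of_nat n) \<in> G"
  by (induction n) (auto intro: g_zero g_one g_add)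

lemma g_of_int: "(of_int n, of_int n) \<in> G"
  by (cases n) (auto intro: g_of_nat g_uminus simp del: of_nat_Suc)

lemma g_ipoly: "(a, c) \<in> G \<Longrightarrow> (ipoly f a, ipoly f c) \<in> G"
  by (induction f) (auto intro: g_zero g_of_int g_add g_mult)

lemma g_unique: "(a, c) \<in> G \<Longrightarrow> (a, d) \<in> G \<Longrightarrow> c = d"
  using g_zero_unique g_diff by fastforce

text \<open>The domain of G is only a ring, so the kernel needs an argument: an algebraic a \<noteq>
  0 has g(a) = 0 with g(0) \<noteq> 0, but G relates g(a) to g(0).\<close>

lemma g_injective:
  assumes "(a, 0) \<in> G"
  shows "a = 0"
proof (rule ccontr)
  assume a0: "a \<noteq> 0"
  obtain f where f: "f \<noteq> 0" "ipoly f a = 0" using algebraic[OF dom[OF assms]] by blast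
  then have "algebraic a"
    by (intro algebraicI[of "map_poly of_int f"]) (auto simp: coeff_map_poly ipoly_def map_poly_eq_0_iff)
  then obtain g where g: "coeff g 0 \<noteq> 0" "ipoly g a = 0"
    using a0 unfolding ipoly_def by (rule algebraicE'_nonzero)
  have "(ipoly g a, ipoly g 0) \<in> G" using g_ipoly[OF assms] .
  moreover have "ipoly g (0::complex) = of_int (coeff g 0)"
    by (cases g) auto
  ultimately show False using g g_zero_unique by force
qed

lemma g_eq_0_iff: "(a, c) \<in> G \<Longrightarrow> a = 0 \<longleftrightarrow> c = 0"
  using g_zero_unique g_injective by blast

text \<open>The polynomial h' is the image of h under the homomorphism, stated relationally because
  only its graph is given.\<close>

definition poly_pair :: "'a poly \<Rightarrow> complex poly \<Rightarrow> bool" where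
  "poly_pair h h' \<longleftrightarrow> (\<forall>i. (coeff h i, coeff h' i) \<in> G)"

lemma poly_pair_diff: "poly_pair f f' \<Longrightarrow> poly_pair g g' \<Longrightarrow> poly_pair (f - g) (f' - g')"
  by (auto simp: poly_pair_def intro: g_diff)

lemma poly_pair_mult: "poly_pair f f' \<Longrightarrow> poly_pair g g' \<Longrightarrow> poly_pair (f * g) (f' * g')"
  by (auto simp: poly_pair_def coeff_mult intro!: g_sum g_mult)

lemma poly_pair_monom: "(a, c) \<in> G \<Longrightarrow> poly_pair (monom a n) (monom c n)"
  by (auto simp: poly_pair_def g_zero)

lemma poly_pair_degree:
  assumes "poly_pair h h'"
  shows "degree h' = degree h"
proof -
  have "coeff h i = 0 \<longleftrightarrow> coeff h' i = 0" for i
    using assms g_eq_0_iff by (auto simp: poly_pair_def)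
  then show ?thesis by (metis coeff_0_degree_minus_1 degree_le le_antisym le_degree not_le)
qed

lemma poly_pair_0: "poly_pair 0 h' \<Longrightarrow> h' = 0"
  using g_zero_unique by (auto simp: poly_pair_def poly_eq_iff)

text \<open>Choose t as a complex root of the image of a polynomial g of least degree vanishing at
  y. Every other polynomial vanishing at y reduces to 0 by pseudo-division by g, carried out on both
  sides in parallel; leading coefficients are cross-multiplied, as the domain of G may lack
  inverses.\<close>

lemma root_image:
  assumes y: "y \<in> K"
  shows "\<exists>t. \<forall>h h'. poly_pair h h' \<longrightarrow> poly h y = 0 \<longrightarrow> poly h' t = 0"
proof -
  define Q where "Q h \<longleftrightarrow> h \<noteq> 0 \<and> poly h y = 0 \<and> (\<exists>h'. poly_pair h h')" for h
  obtain f where f: "f \<noteq> 0" "ipoly f y = 0" using algebraic[OF y] by blast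
  have "poly_pair (map_poly of_int f) (map_poly of_int f)"
    by (simp add: poly_pair_def coeff_map_poly g_of_int)
  then have "Q (map_poly of_int f)"
    using f by (auto simp: Q_def ipoly_def map_poly_eq_0_iff)
  then obtain g where g: "Q g" "\<And>h. Q h \<Longrightarrow> degree g \<le> degree h"
    using arg_min_nat_lemma[of Q _ degree] by blast
  obtain g' where g': "poly_pair g g'" using g(1) by (auto simp: Q_def)
  have "degree g \<noteq> 0"
  proof
    assume "degree g = 0"
    then obtain c where "g = [:c:]" by (rule degree_eq_zeroE)
    then show False using g(1) by (auto simp: Q_def)
  qed
  then have "\<not> constant (poly g')" using poly_pair_degree[OF g'] by (simp add: constant_degree)
  then obtain t where t: "poly g' t = 0" using fundamental_theorem_of_algebra by blast
  define n where "n = degree g"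
  define a b where "a = coeff g n" and "b = coeff g' n"
  have ab: "(a, b) \<in> G" using g' by (simp add: poly_pair_def a_def b_def)
  have "a \<noteq> 0" using g(1) by (simp add: a_def n_def Q_def)
  then have b0: "b \<noteq> 0" using g_eq_0_iff[OF ab] by simp
  have "poly h' t = 0" if "poly_pair h h'" "poly h y = 0" for h h'
    using that
  proof (induction "degree h" arbitrary: h h' rule: less_induct)
    case less
    show ?case
    proof (cases "h = 0")
      case True
      then have "h' = 0" using poly_pair_0 less.prems(1) by blast
      then show ?thesis by simp
    next
      case False
      then have "Q h" using less.prems by (auto simp: Q_def)
      then have le: "n \<le> degree h" using g(2) by (simp add: n_def)
      define k m where "k = degree h - n" and "m = degree h"
      define c d where "c = coeff h m" and "d = coeff h' m"
      have cd: "(c, d) \<in> G" using less.prems(1) by (simp add: poly_pair_def c_def d_def)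
      define h1 where "h1 = monom a 0 * h - monom c k * g"
      define h1' where "h1' = monom b 0 * h' - monom d k * g'"
      have pair: "poly_pair h1 h1'"
        unfolding h1_def h1'_def
        using less.prems(1) g' ab cd by (intro poly_pair_diff poly_pair_mult poly_pair_monom)
      have root: "poly h1 y = 0" using less.prems(2) g(1) by (simp add: h1_def Q_def)
      have "degree h1 \<le> m"
        unfolding h1_def
      proof (rule degree_diff_le)
        show "degree (monom a 0 * h) \<le> m"
          by (simp add: monom_0 m_def degree_smult_le)
        have "degree (monom c k * g) \<le> k + n"
          using degree_mult_le[of "monom c k" g] degree_monom_le[of c k] by (simp add: n_def)
        then show "degree (monom c k * g) \<le> m" using le by (simp add: k_def m_def)
      qed
      moreover have "coeff h1 m = 0"
      proof -
        have "coeff (monom c k * g) m = c * a"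
          using le by (simp add: coeff_monom_mult k_def m_def a_def)
        moreover have "coeff (monom a 0 * h) m = a * c"
          by (simp add: monom_0 c_def)
        ultimately show ?thesis by (simp add: h1_def)
      qed
      ultimately have "h1 = 0 \<or> degree h1 < m" by (rule eq_zero_or_degree_less)
      then have "poly h1' t = 0"
      proof
        assume "h1 = 0"
        then have "h1' = 0" using poly_pair_0 pair by blast
        then show ?thesis by simp
      next
        assume "degree h1 < m"
        then show ?thesis using less.hyps[of h1 h1'] pair root by (simp add: m_def)
      qed
      then have "b * poly h' t = 0" using t by (simp add: h1'_def poly_monom)
      then show ?thesis using b0 by simp
    qed
  qed
  then show ?thesis by blast
qed

lemma extend:
  assumes y: "y \<in> K"
  shows "\<exists>G'. hom_graph K G' \<and> G \<subseteq> G' \<and> y \<in> fst ` G'"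
proof -
  obtain t where t: "\<And>h h'. poly_pair h h' \<Longrightarrow> poly h y = 0 \<Longrightarrow> poly h' t = 0"
    using root_image[OF y] by blast
  define G' where "G' = {(poly h y, poly h' t) | h h'. poly_pair h h'}"
  have "hom_graph K G'"
  proof
    fix a c assume ac: "(a, c) \<in> G'"
    then obtain h h' where h: "a = poly h y" "c = poly h' t" "poly_pair h h'" unfolding G'_def by blast
    then show "a \<in> K" using y dom by (auto simp: poly_altdef poly_pair_def intro!: sum mult power)
    fix b d assume "(b, d) \<in> G'"
    then obtain k k' where k: "b = poly k y" "d = poly k' t" "poly_pair k k'" unfolding G'_def by blast
    show "(a - b, c - d) \<in> G'" unfolding G'_def
      using poly_pair_diff[OF h(3) k(3)] by (force simp: h k)
    show "(a * b, c * d) \<in> G'" unfolding G'_def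
      using poly_pair_mult[OF h(3) k(3)] by (force simp: h k)
  next
    show "(1, 1) \<in> G'" unfolding G'_def using poly_pair_monom[OF g_one, of 0] by (force simp: poly_monom)
    show "c = 0" if "(0, c) \<in> G'" for c using that t unfolding G'_def by force
    show "\<exists>f. f \<noteq> 0 \<and> ipoly f a = 0" if "a \<in> K" for a using algebraic[OF that] .
  qed
  moreover have "G \<subseteq> G'"
  proof
    fix z assume "z \<in> G"
    then show "z \<in> G'" unfolding G'_def
      using poly_pair_monom[of "fst z" "snd z" 0] by (force simp: poly_monom)
  qed
  moreover have "(y, t) \<in> G'" unfolding G'_def using poly_pair_monom[OF g_one, of 1] by (force simp: poly_monom)
  then have "y \<in> fst ` G'" by force
  ultimately show ?thesis by blast
qed

end

text \<open>Sending x to its conjugate w is well defined on integer polynomials in x because f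
  divides every polynomial vanishing at x. A maximal extension \<sigma> is defined on all of K, and
  v y is the modulus of \<sigma> y.\<close>

lemma (in number_field_basis) archimedean_place_exists:
  fixes w :: complex
  assumes x: "x \<in> K" and f: "minimal_poly f x" and w: "ipoly f w = 0"
  shows "\<exists>v\<in>extensions K (\<lambda>q. \<bar>of_rat q\<bar>). v x = norm w"
proof -
  define G0 where "G0 = {(ipoly h x, ipoly h w) | h. True}"
  have alg: "\<exists>f. f \<noteq> 0 \<and> ipoly f a = 0" if "a \<in> K" for a using int_poly_root[OF that] by blast
  have G0: "hom_graph K G0"
  proof
    fix a c assume ac: "(a, c) \<in> G0"
    then obtain h where h: "a = ipoly h x" "c = ipoly h w" unfolding G0_def by blast
    then show "a \<in> K" using ipoly_closed[OF x] by simp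
    fix b d assume "(b, d) \<in> G0"
    then obtain k where k: "b = ipoly k x" "d = ipoly k w" unfolding G0_def by blast
    show "(a - b, c - d) \<in> G0" unfolding G0_def h k ipoly_diff[symmetric] by blast
    show "(a * b, c * d) \<in> G0" unfolding G0_def h k ipoly_mult[symmetric] by blast
  next
    show "(1, 1) \<in> G0" unfolding G0_def by (intro CollectI exI[of _ 1]) auto
    show "c = 0" if c: "(0, c) \<in> G0" for c
    proof -
      obtain h where h: "0 = ipoly h x" "c = ipoly h w" using c unfolding G0_def by blast
      then have "f dvd h" using f by (simp add: minimal_poly_def)
      then show ?thesis using h(2) w by auto
    qed
  qed (rule alg)
  define \<A> where "\<A> = {G. hom_graph K G \<and> G0 \<subseteq> G}"
  have "G0 \<in> \<A>" using G0 by (simp add: \<A>_def)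
  then have "\<A> \<noteq> {}" by blast
  moreover have "\<Union>\<C> \<in> \<A>" if C: "\<C> \<noteq> {}" "subset.chain \<A> \<C>" for \<C>
  proof -
    have sub: "J \<in> \<A>" if "J \<in> \<C>" for J using C(2) that by (auto simp: subset.chain_def)
    have graph: "hom_graph K J" if "J \<in> \<C>" for J using sub[OF that] by (simp add: \<A>_def)
    note two = chain_Union_pair[OF C(2)]
    have "hom_graph K (\<Union>\<C>)"
    proof
      fix a c assume ac: "(a, c) \<in> \<Union>\<C>"
      then show "a \<in> K" using hom_graph.dom[OF graph] by blast
      fix b d assume "(b, d) \<in> \<Union>\<C>"
      then obtain J where J: "J \<in> \<C>" "(a, c) \<in> J" "(b, d) \<in> J" using two[OF ac] by blast
      show "(a - b, c - d) \<in> \<Union>\<C>" "(a * b, c * d) \<in> \<Union>\<C>"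
        using hom_graph.g_diff[OF graph[OF J(1)] J(2,3)] hom_graph.g_mult[OF graph[OF J(1)] J(2,3)] J(1) by blast+
    next
      show "(1, 1) \<in> \<Union>\<C>" using C(1) hom_graph.g_one[OF graph] by blast
      show "c = 0" if "(0, c) \<in> \<Union>\<C>" for c using that hom_graph.g_zero_unique[OF graph] by blast
    qed (rule alg)
    moreover have "G0 \<subseteq> \<Union>\<C>" using C(1) sub by (auto simp: \<A>_def)
    ultimately show ?thesis by (simp add: \<A>_def)
  qed
  ultimately obtain G where G: "G \<in> \<A>" "\<And>J. J \<in> \<A> \<Longrightarrow> G \<subseteq> J \<Longrightarrow> J = G"
    using subset_Zorn_nonempty[of \<A>] by blast
  interpret hom_graph K G using G(1) by (simp add: \<A>_def)
  have total: "\<exists>c. (y, c) \<in> G" if y: "y \<in> K" for y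
  proof -
    obtain G' where G': "hom_graph K G'" "G \<subseteq> G'" "y \<in> fst ` G'" using extend[OF y] by blast
    then have "G' \<in> \<A>" using G(1) by (auto simp: \<A>_def)
    then have "G' = G" using G(2) G'(2) by blast
    then show ?thesis using G'(3) by force
  qed
  define \<sigma> where "\<sigma> y = (SOME c. (y, c) \<in> G)" for y
  have \<sigma>: "(y, \<sigma> y) \<in> G" if "y \<in> K" for y
    unfolding \<sigma>_def using total[OF that] by (rule someI_ex)
  have \<sigma>_eq: "\<sigma> y = c" if "(y, c) \<in> G" for y c
    using g_unique[OF \<sigma>[OF dom[OF that]] that] .
  define v where "v = restrict (\<lambda>y. norm (\<sigma> y)) K"
  have "absolute_value_on K v"
    unfolding absolute_value_on_def
  proof (intro conjI ballI)
    show "v \<in> extensional K" by (simp add: v_def)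
    fix y assume y: "y \<in> K"
    show "0 \<le> v y" using y by (simp add: v_def)
    show "(v y = 0) = (y = 0)" using y g_eq_0_iff[OF \<sigma>[OF y]] by (simp add: v_def)
    fix z assume z: "z \<in> K"
    show "v (y * z) = v y * v z"
      using y z mult \<sigma>_eq[OF g_mult[OF \<sigma>[OF y] \<sigma>[OF z]]] by (simp add: v_def norm_mult)
    show "v (y + z) \<le> v y + v z"
      using y z add \<sigma>_eq[OF g_add[OF \<sigma>[OF y] \<sigma>[OF z]]] norm_triangle_ineq[of "\<sigma> y" "\<sigma> z"] by (simp add: v_def)
  qed
  moreover have "v (of_rat q) = \<bar>of_rat q\<bar>" for q
  proof -
    obtain a b where q: "q = of_int a / of_int b" "b > 0"
      by (metis quotient_of_div quotient_of_denom_pos surj_pair)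
    have "(of_rat q * of_int b, \<sigma> (of_rat q) * of_int b) \<in> G" using g_mult[OF \<sigma>[OF of_rat] g_of_int] .
    moreover have "of_rat q * of_int b = (of_int a :: 'a)" using q(2) by (simp add: q(1) of_rat_divide)
    ultimately have "\<sigma> (of_rat q) * of_int b = of_int a" using g_unique g_of_int by metis
    then have "norm (\<sigma> (of_rat q)) * norm (of_int b :: complex) = norm (of_int a :: complex)"
      by (metis norm_mult)
    then have "norm (\<sigma> (of_rat q)) = \<bar>of_rat q\<bar>"
      using q(2) by (simp add: q(1) of_rat_divide nonzero_eq_divide_eq)
    then show ?thesis using of_rat by (simp add: v_def)
  qed
  moreover have "v x = norm w"
  proof -
    have "(x, w) \<in> G0" unfolding G0_def by (intro CollectI exI[of _ "[:0, 1:]"]) auto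
    then have "(x, w) \<in> G" using G(1) by (auto simp: \<A>_def)
    then show ?thesis using x \<sigma>_eq by (simp add: v_def)
  qed
  ultimately show ?thesis by (auto simp: extensions_def)
qed


section \<open>Heights\<close>

abbreviation arch_abs :: "rat \<Rightarrow> real" where
  "arch_abs \<equiv> \<lambda>q. \<bar>of_rat q\<bar>"

lemma canonical_abs_iff:
  "v \<in> canonical_abs K \<longleftrightarrow>
     v \<in> extensions K arch_abs \<or> (\<exists>p. prime p \<and> v \<in> extensions K (padic_abs p))"
  by (auto simp: canonical_abs_def extensions_def)

lemma padic_abs_of_int:
  "padic_abs p (of_int n) = (if n = 0 then 0 else real p powi (- int (multiplicity (int p) n)))"
proof -
  have "quotient_of (of_int n) = (n, 1)"
    by (simp add: of_int_rat quotient_of_Fract Rat.normalize_def)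
  then show ?thesis by (simp add: padic_abs_def)
qed

lemma padic_abs_of_int_le:
  assumes "prime p"
  shows "padic_abs p (of_int n) \<le> 1"
proof -
  have "1 \<le> real p ^ multiplicity (int p) n" using prime_gt_0_nat[OF assms] by (intro one_le_power) simp
  then show ?thesis by (simp add: padic_abs_of_int power_int_minus inverse_le_1_iff)
qed

lemma padic_abs_unit: "\<not> int p dvd n \<Longrightarrow> padic_abs p (of_int n) = 1"
  by (auto simp: padic_abs_of_int not_dvd_imp_multiplicity_0)

lemma padic_abs_prime:
  assumes "prime p"
  shows "padic_abs p (of_nat p) = 1 / real p"
proof -
  have "multiplicity (int p) (int p) = 1" using assms by (intro multiplicity_self) auto
  then show ?thesis
    using padic_abs_of_int[of p "int p"] prime_gt_0_nat[OF assms] by (simp add: power_int_minus divide_inverse)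
qed

context field_set
begin

lemma canonical_absolute_value: "v \<in> canonical_abs F \<Longrightarrow> absolute_value F v"
  unfolding canonical_abs_iff using extension_absolute_value by blast

lemma padic_extension_of_int:
  assumes "v \<in> extensions F (padic_abs p)"
  shows "v (of_int n) = padic_abs p (of_int n)"
  using assms of_rat_of_int_eq[of n, where 'a = 'a] unfolding extensions_def by (metis (mono_tags, lifting) mem_Collect_eq)

lemma padic_extension_of_int_le:
  assumes "prime p" "v \<in> extensions F (padic_abs p)"
  shows "v (of_int n) \<le> 1"
  using padic_extension_of_int[OF assms(2)] padic_abs_of_int_le[OF assms(1)] by simp

lemma padic_extension_of_nat_le:
  assumes "prime p" "v \<in> extensions F (padic_abs p)"
  shows "v (of_nat n) \<le> 1"
  using padic_extension_of_int_le[OF assms, of "int n"] by simp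

lemma padic_extension_ultrametric:
  assumes "prime p" "v \<in> extensions F (padic_abs p)" "x \<in> F" "y \<in> F"
  shows "v (x + y) \<le> max (v x) (v y)"
proof -
  interpret absolute_value F v using extension_absolute_value[OF assms(2)] .
  show ?thesis using ultrametric[OF padic_extension_of_nat_le[OF assms(1,2)] assms(3,4)] .
qed

lemma padic_extension_sum_less:
  assumes p: "prime p" and v: "v \<in> extensions F (padic_abs p)"
    and f: "\<And>i. i \<in> A \<Longrightarrow> f i \<in> F \<and> v (f i) < M" and M: "0 < M"
  shows "v (sum f A) < M"
  using f
proof (induction A rule: infinite_finite_induct)
  case (insert i A)
  interpret absolute_value F v using extension_absolute_value[OF v] .
  have "v (f i + sum f A) \<le> max (v (f i)) (v (sum f A))"
    using insert by (intro padic_extension_ultrametric[OF p v]) (auto intro: sum)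
  also have "\<dots> < M" using insert by simp
  finally show ?case using insert by simp
qed (use M absolute_value.v_0[OF extension_absolute_value[OF v]] in auto)

lemma arch_extension_of_nat:
  assumes "v \<in> extensions F arch_abs"
  shows "v (of_nat n) = of_nat n"
proof -
  have "v (of_rat (of_nat n)) = \<bar>of_rat (of_nat n)\<bar>" using assms unfolding extensions_def by blast
  then show ?thesis by simp
qed

end

section \<open>Places where constants occur, and comparison of heights\<close>

context number_field_basis
begin

lemma finite_arch_extensions: "finite (extensions K arch_abs)"
  by (rule finite_extensions[of _ "1 / 2"]) (simp_all add: of_rat_divide)

lemma finite_padic_extensions:
  assumes p: "prime p"
  shows "finite (extensions K (padic_abs p))"
  using prime_gt_1_nat[OF p]
  by (intro finite_extensions[of _ "of_nat p"]) (simp_all add: padic_abs_prime[OF p])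

text \<open>Outside this finite set places are ultrametric and n is a unit, so height comparisons
  need constants only on it.\<close>

definition bad_places :: "int \<Rightarrow> ('a \<Rightarrow> real) set" where
  "bad_places n = extensions K arch_abs \<union> (\<Union>p\<in>{p. prime p \<and> int p dvd n}. extensions K (padic_abs p))"

lemma finite_bad_places:
  assumes "n \<noteq> 0"
  shows "finite (bad_places n)"
proof -
  have "finite {p. int p dvd n}"
  proof (rule finite_subset)
    show "{p. int p dvd n} \<subseteq> {..nat \<bar>n\<bar>}"
    proof
      fix p assume "p \<in> {p. int p dvd n}"
      then have "\<bar>int p\<bar> \<le> \<bar>n\<bar>" using assms by (intro dvd_imp_le_int) auto
      then show "p \<in> {..nat \<bar>n\<bar>}" by simp
    qed
  qed simp
  then have "finite {p. prime p \<and> int p dvd n}" by (rule rev_finite_subset) auto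
  then show ?thesis unfolding bad_places_def using finite_arch_extensions finite_padic_extensions by auto
qed

lemma bad_places_subset: "bad_places n \<subseteq> canonical_abs K"
  by (auto simp: bad_places_def canonical_abs_iff)

lemma good_placeE:
  assumes "v \<in> canonical_abs K" "v \<notin> bad_places n"
  obtains p where "prime p" "v \<in> extensions K (padic_abs p)" "\<not> int p dvd n"
  using assms by (auto simp: bad_places_def canonical_abs_iff)

text \<open>If v x > 1 and the leading coefficient is a unit at v, the leading term strictly
  dominates the ultrametric sum f(x) = 0.\<close>

lemma integral_at_good_places:
  assumes x: "x \<in> K" and f: "ipoly f x = 0" "f \<noteq> 0"
    and v: "v \<in> canonical_abs K" "v \<notin> bad_places (lead_coeff f)"
  shows "v x \<le> 1"
proof (rule ccontr)
  assume "\<not> ?thesis"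
  then have t: "1 < v x" by simp
  obtain p where p: "prime p" "v \<in> extensions K (padic_abs p)"
    "\<not> int p dvd lead_coeff f" using v by (rule good_placeE)
  interpret absolute_value K v using extension_absolute_value[OF p(2)] .
  define n where "n = degree f"
  have t0: "0 < v x" using t by simp
  have "(\<Sum>i\<le>n. of_int (coeff f i) * x ^ i) = 0" using f by (simp add: ipoly_altdef n_def)
  then have eq: "of_int (coeff f n) * x ^ n = - (\<Sum>i<n. of_int (coeff f i) * x ^ i)"
    by (simp add: lessThan_Suc_atMost[symmetric] eq_neg_iff_add_eq_0 add.commute)
  have "v (\<Sum>i<n. of_int (coeff f i) * x ^ i) < v x ^ n"
  proof (rule padic_extension_sum_less[OF p(1,2)])
    show "0 < v x ^ n" using t0 by simp
    fix i assume i: "i \<in> {..<n}"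
    have "v (of_int (coeff f i)) * v x ^ i \<le> 1 * v x ^ i"
      using padic_extension_of_int_le[OF p(1,2)] t0 by (intro mult_right_mono) auto
    also have "\<dots> < v x ^ n" using t i by (simp add: power_strict_increasing)
    finally show "of_int (coeff f i) * x ^ i \<in> K \<and> v (of_int (coeff f i) * x ^ i) < v x ^ n"
      using x by (simp add: v_mult v_power of_int power mult)
  qed
  moreover have "v (of_int (coeff f n) * x ^ n) = v x ^ n"
    using x p(3) padic_extension_of_int[OF p(2)] padic_abs_unit[of p]
    by (simp add: v_mult v_power of_int power n_def)
  moreover have "v (of_int (coeff f n) * x ^ n) = v (\<Sum>i<n. of_int (coeff f i) * x ^ i)"
    unfolding eq using x by (intro v_uminus sum mult of_int power)
  ultimately show False by simp
qed

lemma finite_places_gt_1: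
  assumes "x \<in> K"
  shows "finite {v \<in> canonical_abs K. 1 < v x}"
proof -
  obtain f where f: "f \<noteq> 0" "ipoly f x = 0" using int_poly_root[OF assms] by blast
  then have "{v \<in> canonical_abs K. 1 < v x} \<subseteq> bad_places (lead_coeff f)"
    using integral_at_good_places[OF assms f(2,1)] by force
  then show ?thesis using finite_bad_places[of "lead_coeff f"] f(1) by (simp add: finite_subset)
qed

text \<open>Any finite superset of the places with v x > 1 may index the product, so the heights of
  two elements can be compared over a common set.\<close>

lemma height_eq_prod:
  assumes x: "x \<in> K" and S: "finite S" "S \<subseteq> canonical_abs K" "{v \<in> canonical_abs K. 1 < v x} \<subseteq> S"
  shows "height K x = (\<Prod>v\<in>S. max 1 (v x) ^ local_degree K v)"
proof -
  have eq: "max 1 (v x ^ n) = max 1 (v x) ^ n" if "v \<in> canonical_abs K" for v n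
  proof (cases "v x \<le> 1")
    case True
    then have "v x ^ n \<le> 1"
      using absolute_value.nonneg[OF canonical_absolute_value[OF that] x] by (intro power_le_one)
    then show ?thesis using True by (simp add: max_absorb1)
  next
    case False
    then show ?thesis by (simp add: max_def one_le_power)
  qed
  have "height K x = (\<Prod>v\<in>S. max 1 (v x ^ local_degree K v))"
    unfolding height_def
  proof (rule prod.mono_neutral_left)
    show "{v \<in> canonical_abs K. max 1 (v x ^ local_degree K v) \<noteq> 1} \<subseteq> S"
    proof
      fix v assume v: "v \<in> {v \<in> canonical_abs K. max 1 (v x ^ local_degree K v) \<noteq> 1}"
      then have "max 1 (v x) ^ local_degree K v \<noteq> 1" using eq[of v "local_degree K v"] by simp
      then have "max 1 (v x) \<noteq> 1" by auto
      then have "1 < v x" by linarith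
      then show "v \<in> S" using v S(3) by blast
    qed
  qed (use S in auto)
  also have "\<dots> = (\<Prod>v\<in>S. max 1 (v x) ^ local_degree K v)"
    using S(2) by (intro prod.cong refl eq) auto
  finally show ?thesis .
qed

lemma height_ge_1: "x \<in> K \<Longrightarrow> 1 \<le> height K x"
  using height_eq_prod[OF _ finite_places_gt_1, of x] by (auto intro!: prod_ge_1 one_le_power)

text \<open>Here positivity of the local degree enters: an exponent 0 would hide a large value at
  v.\<close>

lemma place_le_height:
  assumes x: "x \<in> K" and v: "v \<in> canonical_abs K"
  shows "v x \<le> height K x"
proof (cases "1 < v x")
  case True
  let ?S = "{v \<in> canonical_abs K. 1 < v x}"
  have vS: "v \<in> ?S" using True v by simp
  have deg: "0 < local_degree K v" using v local_degree_pos by (simp add: canonical_abs_def)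
  have "v x \<le> max 1 (v x) ^ local_degree K v"
    using True deg by (simp add: max_def self_le_power)
  also have "\<dots> = (\<Prod>v\<in>{v}. max 1 (v x) ^ local_degree K v)" by simp
  also have "\<dots> \<le> (\<Prod>v\<in>?S. max 1 (v x) ^ local_degree K v)"
    using finite_places_gt_1[OF x] vS by (intro prod_mono2) (auto intro: one_le_power)
  also have "\<dots> = height K x" using height_eq_prod[OF x finite_places_gt_1[OF x]] by simp
  finally show ?thesis .
next
  case False
  then show ?thesis using height_ge_1[OF x] by linarith
qed

text \<open>The bridge from local to global: it is applied with e = n for the Chebyshev maps and
  with e = 1 for the affine maps.\<close>

lemma height_compare:
  assumes x: "x \<in> K" and y: "y \<in> K" and S: "finite S" "S \<subseteq> canonical_abs K"
    and le: "\<And>v. v \<in> canonical_abs K \<Longrightarrow> max 1 (v x) ^ e \<le> (if v \<in> S then C v else 1) * max 1 (v y)"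
  shows "height K x ^ e \<le> (\<Prod>v\<in>S. C v ^ local_degree K v) * height K y"
proof -
  define T where "T = S \<union> {v \<in> canonical_abs K. 1 < v x} \<union> {v \<in> canonical_abs K. 1 < v y}"
  have T: "finite T" "T \<subseteq> canonical_abs K" "{v \<in> canonical_abs K. 1 < v x} \<subseteq> T"
    "{v \<in> canonical_abs K. 1 < v y} \<subseteq> T" "S \<subseteq> T"
    using S finite_places_gt_1 x y by (auto simp: T_def)
  define C' where "C' v = (if v \<in> S then C v else 1)" for v
  have "height K x ^ e = (\<Prod>v\<in>T. (max 1 (v x) ^ e) ^ local_degree K v)"
    unfolding height_eq_prod[OF x T(1-3)] prod_power_distrib
    by (simp add: mult.commute flip: power_mult)
  also have "\<dots> \<le> (\<Prod>v\<in>T. (C' v * max 1 (v y)) ^ local_degree K v)"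
  proof (intro prod_mono conjI power_mono)
    fix v assume "v \<in> T"
    then show "max 1 (v x) ^ e \<le> C' v * max 1 (v y)" using le[of v] T(2) by (auto simp: C'_def)
  qed auto
  also have "\<dots> = (\<Prod>v\<in>T. C' v ^ local_degree K v) * height K y"
    unfolding height_eq_prod[OF y T(1,2,4)] by (simp add: power_mult_distrib prod.distrib)
  also have "(\<Prod>v\<in>T. C' v ^ local_degree K v) = (\<Prod>v\<in>S. C' v ^ local_degree K v)"
    using T by (intro prod.mono_neutral_right) (auto simp: C'_def)
  also have "\<dots> = (\<Prod>v\<in>S. C v ^ local_degree K v)"
    by (intro prod.cong) (auto simp: C'_def)
  finally show ?thesis .
qed

lemma height_0: "height K 0 = 1"
proof -
  have "\<not> 1 < v 0" if "v \<in> canonical_abs K" for v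
    using absolute_value.v_0[OF canonical_absolute_value[OF that]] by simp
  then have "{v \<in> canonical_abs K. 1 < v 0} = {}" by blast
  then show ?thesis using height_eq_prod[OF zero, of "{}"] by simp
qed


section \<open>Northcott's theorem\<close>

text \<open>A Newton polygon argument: in f(x) = 0 two terms i < j share the maximal value, so v x ^
  (j - i) is a power of p and, being above 1, at least p. Thus a bound on the height bounds the
  primes at which x is not integral.\<close>

lemma padic_place_discrete:
  assumes p: "prime p" "v \<in> extensions K (padic_abs p)" and x: "x \<in> K" "1 < v x"
  shows "real p \<le> v x ^ card Bs"
proof -
  interpret absolute_value K v using extension_absolute_value[OF p(2)] .
  obtain f where f: "f \<noteq> 0" "degree f \<le> card Bs" "ipoly f x = 0"
    using int_poly_root[OF x(1)] by blast
  define n where "n = degree f"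
  define a where "a i = coeff f i" for i
  define T where "T i = v (of_int (a i) * x ^ i)" for i
  have T: "T i = v (of_int (a i)) * v x ^ i" for i
    unfolding T_def using x by (simp add: v_mult v_power of_int power)
  have tK: "of_int (a i) * x ^ i \<in> K" for i using x by (intro mult of_int power)
  define M where "M = Max (T ` {..n})"
  have "M \<in> T ` {..n}" unfolding M_def by (rule Max_in) auto
  then obtain i where i: "i \<le> n" "M = T i" by auto
  have le: "T j \<le> T i" if "j \<le> n" for j
    unfolding i(2)[symmetric] M_def using that by (intro Max_ge) auto
  have x0: "x \<noteq> 0" using x v_0 by auto
  have "0 < T n" unfolding T_def using f(1) x0 tK by (intro pos) (auto simp: a_def n_def)
  then have Ti: "0 < T i" using le[of n] by simp
  have "\<exists>j\<le>n. j \<noteq> i \<and> T j = T i"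
  proof (rule ccontr)
    assume "\<not> ?thesis"
    then have less: "T j < T i" if "j \<in> {..n} - {i}" for j using le[of j] that by force
    have "(\<Sum>j\<le>n. of_int (a j) * x ^ j) = 0" using f(3) by (simp add: ipoly_altdef n_def a_def)
    then have "of_int (a i) * x ^ i = - (\<Sum>j\<in>{..n} - {i}. of_int (a j) * x ^ j)"
      using i by (simp add: sum.remove[of _ i] eq_neg_iff_add_eq_0)
    then have "T i = v (\<Sum>j\<in>{..n} - {i}. of_int (a j) * x ^ j)"
      unfolding T_def using tK v_uminus sum by (metis (no_types, lifting))
    also have "\<dots> < T i"
      using less tK Ti by (intro padic_extension_sum_less[OF p]) (auto simp: T_def)
    finally show False by simp
  qed
  then obtain j where j: "j \<le> n" "j \<noteq> i" "T j = T i" by blast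
  have key: "real p \<le> v x ^ card Bs" if ij: "i \<le> n" "j \<le> n" "i < j" "T i = T j" "0 < T i" for i j
  proof -
    have ai: "a i \<noteq> 0" "a j \<noteq> 0"
      using ij(4,5) by (metis T less_irrefl mult_zero_left of_int_0 v_0)+
    define k l where "k = int (multiplicity (int p) (a i))" and "l = int (multiplicity (int p) (a j))"
    have p1: "1 < real p" using prime_gt_1_nat[OF p(1)] by simp
    have vi: "v (of_int (a i)) = real p powi (- k)" "v (of_int (a j)) = real p powi (- l)"
      using ai padic_extension_of_int[OF p(2)] by (simp_all add: padic_abs_of_int k_def l_def)
    have "v x ^ j = v x ^ i * v x ^ (j - i)" using ij(3) by (simp flip: power_add)
    then have "real p powi (- k) = real p powi (- l) * v x ^ (j - i)"
      using ij(4) x(2) by (simp add: T vi)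
    then have eq: "v x ^ (j - i) = real p powi (l - k)"
      using p1 by (simp add: power_int_minus power_int_diff field_simps)
    have gt: "1 < v x ^ (j - i)" using x(2) ij(3) by (simp add: one_less_power)
    have "0 < l - k"
    proof (rule ccontr)
      assume "\<not> ?thesis"
      then have "real p powi (l - k) \<le> real p powi 0" using p1 by (intro power_int_increasing) auto
      then show False using gt eq by simp
    qed
    then have "real p powi 1 \<le> real p powi (l - k)" using p1 by (intro power_int_increasing) auto
    then have "real p \<le> v x ^ (j - i)" using eq by simp
    also have "\<dots> \<le> v x ^ card Bs" using x(2) ij f(2) by (intro power_increasing) (auto simp: n_def)
    finally show ?thesis .
  qed
  show ?thesis using key[of i j] key[of j i] i j Ti by (metis linorder_neqE_nat)
qed

end

text \<open>Split off one root at a time: multiplying by X - w enlarges the coefficient bound at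
  most by the factor 1 + M.\<close>

lemma coeff_bound_of_root_bound:
  fixes q :: "complex poly"
  assumes "\<And>w. poly q w = 0 \<Longrightarrow> norm w \<le> M" "0 \<le> M"
  shows "norm (coeff q i) \<le> norm (lead_coeff q) * (1 + M) ^ degree q"
  using assms
proof (induction "degree q" arbitrary: q i)
  case 0
  then show ?case by (cases i) (auto simp: coeff_eq_0)
next
  case (Suc n)
  then have "\<not> constant (poly q)" by (simp add: constant_degree)
  then obtain w where w: "poly q w = 0" using fundamental_theorem_of_algebra by blast
  then obtain r where r: "q = [:- w, 1:] * r" by (metis poly_eq_0_iff_dvd dvdE)
  have "q \<noteq> 0" using Suc.hyps(2) by auto
  then have r0: "r \<noteq> 0" using r by auto
  have deg: "degree q = Suc (degree r)"
    unfolding r using r0 by (subst degree_mult_eq) auto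
  have lead: "lead_coeff q = lead_coeff r"
    unfolding r by (simp only: lead_coeff_mult) simp
  define A where "A = norm (lead_coeff r) * (1 + M) ^ degree r"
  have IH: "norm (coeff r j) \<le> A" for j
    unfolding A_def using Suc deg by (intro Suc.hyps(1)) (auto simp: r)
  have wM: "norm w \<le> M" using Suc.prems(1) w by blast
  have A0: "0 \<le> A" using IH[of 0] norm_ge_zero order_trans by blast
  have "norm (coeff q i) \<le> norm w * norm (coeff r i) + A"
  proof (cases i)
    case 0
    then show ?thesis using A0 by (simp add: r norm_mult)
  next
    case (Suc j)
    have "coeff q i = coeff r j - w * coeff r i" by (simp add: r Suc)
    then have "norm (coeff q i) \<le> norm (coeff r j) + norm w * norm (coeff r i)"
      using norm_triangle_ineq4[of "coeff r j" "w * coeff r i"] by (simp add: norm_mult)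
    then show ?thesis using IH[of j] by simp
  qed
  also have "\<dots> \<le> M * A + A" using IH[of i] wM A0 Suc.prems(2) by (intro add_mono mult_mono) auto
  also have "\<dots> = norm (lead_coeff q) * (1 + M) ^ degree q"
    by (simp only: lead, simp only: deg) (simp add: A_def algebra_simps)
  finally show ?case .
qed

lemma finite_bounded_int_polys: "finite {f :: int poly. degree f \<le> d \<and> (\<forall>i. \<bar>coeff f i\<bar> \<le> C)}"
proof (rule finite_subset)
  show "finite (Poly ` {xs. set xs \<subseteq> {-C..C} \<and> length xs \<le> Suc d})"
    by (intro finite_imageI finite_lists_length_le) simp
  show "{f :: int poly. degree f \<le> d \<and> (\<forall>i. \<bar>coeff f i\<bar> \<le> C)}
      \<subseteq> Poly ` {xs. set xs \<subseteq> {-C..C} \<and> length xs \<le> Suc d}"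
  proof
    fix f :: "int poly" assume f: "f \<in> {f. degree f \<le> d \<and> (\<forall>i. \<bar>coeff f i\<bar> \<le> C)}"
    have "set (coeffs f) \<subseteq> {-C..C}"
    proof
      fix c assume "c \<in> set (coeffs f)"
      then obtain i where "c = coeff f i" by (auto simp: coeffs_def split: if_splits)
      then have "\<bar>c\<bar> \<le> C" using f by simp
      then show "c \<in> {-C..C}" by (simp add: abs_le_iff)
    qed
    moreover have "length (coeffs f) \<le> Suc d" using f by (cases "f = 0") (auto simp: length_coeffs_degree)
    ultimately show "f \<in> Poly ` {xs. set xs \<subseteq> {-C..C} \<and> length xs \<le> Suc d}"
      by (intro image_eqI[of _ _ "coeffs f"]) auto
  qed
qed

context number_field_basis
begin

text \<open>Enough places exist: a prime dividing the leading coefficient would yield a p-adic place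
  with v z > 1, and every complex root of f is seen by an archimedean place. So f has leading
  coefficient 1 or -1 and bounded roots.\<close>

lemma integral_bounded_minimal_poly:
  assumes z: "z \<in> K" and f: "minimal_poly f z" "f \<noteq> 0" "degree f \<le> card Bs"
    and int: "\<And>p v. prime p \<Longrightarrow> v \<in> extensions K (padic_abs p) \<Longrightarrow> v z \<le> 1"
    and arch: "\<And>v. v \<in> extensions K arch_abs \<Longrightarrow> v z \<le> M" and M: "0 \<le> M"
  shows "\<bar>coeff f i\<bar> \<le> \<lceil>(1 + M) ^ card Bs\<rceil>"
proof -
  have "\<bar>lead_coeff f\<bar> = 1"
  proof (rule ccontr)
    assume "\<not> ?thesis"
    then obtain p where p: "prime p" "p dvd lead_coeff f"
      using prime_factor_int by blast
    define p' where "p' = nat p"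
    have "p = int p'" using prime_ge_0_int[OF p(1)] by (simp add: p'_def)
    then have p': "prime p'" "int p' dvd lead_coeff f" using p by auto
    obtain v where v: "v \<in> extensions K (padic_abs p')" "1 < v z"
      using padic_place_exists[OF p'(1) z f(1) p'(2)] by blast
    then show False using int[OF p'(1) v(1)] by simp
  qed
  then have lead: "norm (lead_coeff (map_poly of_int f :: complex poly)) = 1"
    by (simp add: degree_map_poly coeff_map_poly)
  have "norm w \<le> M" if "poly (map_poly of_int f) w = 0" for w :: complex
  proof -
    obtain v where v: "v \<in> extensions K arch_abs" "v z = norm w"
      using archimedean_place_exists[OF z f(1), of w] \<open>poly (map_poly of_int f) w = 0\<close> by (auto simp: ipoly_def)
    then show ?thesis using arch[OF v(1)] by simp
  qed
  then have "norm (coeff (map_poly of_int f :: complex poly) i)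
      \<le> 1 * (1 + M) ^ degree (map_poly of_int f :: complex poly)"
    using coeff_bound_of_root_bound[of "map_poly of_int f" M i] M lead by simp
  also have "\<dots> \<le> (1 + M) ^ card Bs"
    using f(3) M by (simp add: degree_map_poly power_increasing)
  finally have "\<bar>real_of_int (coeff f i)\<bar> \<le> (1 + M) ^ card Bs" by (simp add: coeff_map_poly)
  then show ?thesis by linarith
qed

text \<open>One integer N serves as denominator for all x of bounded height, so each N x is a root
  of one of finitely many integer polynomials.\<close>

theorem northcott: "finite (bounded_height K B)"
proof -
  define d B1 where "d = card Bs" and "B1 = max 1 B"
  have B1: "1 \<le> B1" by (simp add: B1_def)
  define P where "P = nat \<lceil>B1 ^ d\<rceil>"
  have P: "B1 ^ d \<le> real P" unfolding P_def by linarith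
  obtain k where "B1 < 2 ^ k" using real_arch_pow[of 2 B1] by auto
  then have k: "B1 \<le> 2 ^ k" by simp
  \<comment> \<open>A prime p > P cannot occur in a denominator, as v x ^ d \<ge> p would exceed B1
    ^ d. For p \<le> P, the factorial has value at most 1 / 2, so N has value at most 2 ^ (- k) and
    compensates v x \<le> B1 \<le> 2 ^ k.\<close>
  define N where "N = (fact P :: nat) ^ k"
  have N0: "N \<noteq> 0" by (simp add: N_def)
  define M where "M = real N * B1"
  have M0: "0 \<le> M" using B1 by (simp add: M_def)
  define FF where "FF = {f :: int poly. degree f \<le> d \<and> (\<forall>i. \<bar>coeff f i\<bar> \<le> \<lceil>(1 + M) ^ d\<rceil>)}"
  define Z where "Z = (\<Union>f\<in>FF - {0}. {z :: 'a. poly (map_poly of_int f) z = 0})"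
  have "finite Z"
    unfolding Z_def
  proof (rule finite_UN_I)
    show "finite (FF - {0})" unfolding FF_def using finite_bounded_int_polys by simp
    show "finite {z :: 'a. poly (map_poly of_int f) z = 0}" if "f \<in> FF - {0}" for f
      using that by (intro poly_roots_finite) (auto simp: map_poly_eq_0_iff)
  qed
  moreover have "bounded_height K B \<subseteq> (\<lambda>z. z / of_nat N) ` Z"
  proof
    fix x assume "x \<in> bounded_height K B"
    then have x: "x \<in> K" "height K x \<le> B" by (auto simp: bounded_height_def)
    have bd: "v x \<le> B1" if "v \<in> canonical_abs K" for v
      using place_le_height[OF x(1) that] x(2) by (simp add: B1_def)
    define z where "z = of_nat N * x"
    have zK: "z \<in> K" using x(1) by (simp add: z_def mult of_nat)
    obtain f where f: "minimal_poly f z" "f \<noteq> 0" "degree f \<le> card Bs"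
      using minimal_poly_exists[OF zK] by blast
    have "v z \<le> 1" if pv: "prime p" "v \<in> extensions K (padic_abs p)" for p v
    proof -
      interpret absolute_value K v using extension_absolute_value[OF pv(2)] .
      have can: "v \<in> canonical_abs K" using pv by (auto simp: canonical_abs_iff)
      have vz: "v z = v (of_nat N) * v x" unfolding z_def using x(1) by (simp add: v_mult of_nat)
      show ?thesis
      proof (cases "p \<le> P")
        case True
        then have "p dvd fact P" using prime_gt_0_nat[OF pv(1)] by (intro dvd_fact) auto
        then obtain m where m: "fact P = p * m" by (rule dvdE)
        have "v (of_nat p) = 1 / real p"
          using padic_abs_prime[OF pv(1)] padic_extension_of_int[OF pv(2), of "int p"] by simp
        then have "v (of_nat (fact P)) = 1 / real p * v (of_nat m)"
          unfolding m by (simp add: v_mult of_nat)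
        also have "\<dots> \<le> 1 / real p * 1"
          using padic_extension_of_nat_le[OF pv] by (intro mult_left_mono) auto
        also have "\<dots> \<le> 1 / 2" using prime_ge_2_nat[OF pv(1)] by (simp add: field_simps)
        finally have "v (of_nat (fact P)) \<le> 1 / 2" .
        moreover have "0 \<le> v (of_nat (fact P))" by (rule nonneg[OF of_nat])
        ultimately have "v (of_nat (fact P)) ^ k \<le> (1 / 2) ^ k" by (intro power_mono)
        moreover have "v (of_nat N) = v (of_nat (fact P)) ^ k"
          unfolding N_def by (simp add: v_power of_nat del: of_nat_fact)
        ultimately have "v (of_nat N) \<le> (1 / 2) ^ k" by simp
        then have "v z \<le> (1 / 2) ^ k * 2 ^ k"
          unfolding vz using bd[OF can] k nonneg[OF x(1)] by (intro mult_mono) auto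
        then show ?thesis by (simp flip: power_mult_distrib)
      next
        case False
        have "v x \<le> 1"
        proof (rule ccontr)
          assume "\<not> ?thesis"
          then have "1 < v x" by simp
          then have "real p \<le> v x ^ d" using padic_place_discrete[OF pv x(1)] by (simp add: d_def)
          also have "\<dots> \<le> B1 ^ d" using bd[OF can] nonneg[OF x(1)] by (intro power_mono)
          finally show False using P False by simp
        qed
        then show ?thesis
          unfolding vz using padic_extension_of_nat_le[OF pv] nonneg[OF of_nat] nonneg[OF x(1)]
          by (intro mult_le_one)
      qed
    qed
    moreover have "v z \<le> M" if v: "v \<in> extensions K arch_abs" for v
    proof -
      interpret absolute_value K v using extension_absolute_value[OF v] .
      have "v z = real N * v x" unfolding z_def using x(1) arch_extension_of_nat[OF v] by (simp add: v_mult of_nat)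
      then show ?thesis using bd[of v] v by (simp add: M_def canonical_abs_iff mult_left_mono)
    qed
    ultimately have "\<bar>coeff f i\<bar> \<le> \<lceil>(1 + M) ^ card Bs\<rceil>" for i
      using integral_bounded_minimal_poly[OF zK f] M0 by blast
    then have "f \<in> FF - {0}" using f by (simp add: FF_def d_def)
    moreover have "poly (map_poly of_int f) z = 0" using f(1) by (simp add: minimal_poly_def ipoly_def)
    ultimately have "z \<in> Z" unfolding Z_def by blast
    moreover have "x = z / of_nat N" using N0 by (simp add: z_def)
    ultimately show "x \<in> (\<lambda>z. z / of_nat N) ` Z" by blast
  qed
  ultimately show ?thesis using finite_surj by blast
qed

end


section \<open>Heights under affine and Chebyshev maps\<close>

lemma (in field_set) chebyshev_closed: "y \<in> F \<Longrightarrow> chebyshev n y \<in> F"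
  by (induction n y rule: chebyshev.induct) (auto intro!: closed)

text \<open>Write t = v y. If t < 4, the factor 4 ^ n suffices. If t \<ge> 4, each step of the
  recurrence multiplies the value by at least t / 4: the main term contributes at least t / 2 times
  the previous value, and the subtracted term costs at most t / 4 of it.\<close>

lemma (in absolute_value) chebyshev_lower_bound:
  assumes y: "y \<in> K" and two: "1 / 2 \<le> v 2"
  shows "max 1 (v y) ^ n \<le> 4 ^ n * max 1 (v (chebyshev n y))"
proof (cases "v y < 4")
  case True
  have "max 1 (v y) ^ n \<le> 4 ^ n" using True by (intro power_mono) auto
  also have "\<dots> \<le> 4 ^ n * max 1 (v (chebyshev n y))" by simp
  finally show ?thesis .
next
  case False
  define t where "t = v y"
  have t: "4 \<le> t" using False by (simp add: t_def)
  have step: "t / 4 * v (chebyshev k y) \<le> v (chebyshev (Suc k) y)" for k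
  proof (induction k)
    case 0
    then show ?case using t by (simp add: v_1 t_def)
  next
    case (Suc k)
    define a b where "a = v (chebyshev k y)" and "b = v (chebyshev (Suc k) y)"
    have a0: "0 \<le> a" and b0: "0 \<le> b" unfolding a_def b_def using y by (auto intro!: nonneg chebyshev_closed)
    have "1 * a \<le> t / 4 * a" using t a0 by (intro mult_right_mono) auto
    then have ab: "a \<le> b" using Suc by (simp add: a_def b_def)
    have "v (2 * y * chebyshev (Suc k) y) = v 2 * t * b"
      using y by (simp add: v_mult mult numeral chebyshev_closed t_def b_def)
    then have "v 2 * t * b - a \<le> v (chebyshev (Suc (Suc k)) y)"
      using v_diff_ge[of "2 * y * chebyshev (Suc k) y" "chebyshev k y"] y
      by (simp add: a_def mult numeral chebyshev_closed)
    moreover have "1 / 2 * (t * b) \<le> v 2 * (t * b)" using two t b0 by (intro mult_right_mono) auto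
    moreover have "4 * b \<le> t * b" using t b0 by (intro mult_right_mono) auto
    ultimately show ?case using ab unfolding b_def[symmetric] by (simp add: algebra_simps)
  qed
  have "(t / 4) ^ n \<le> v (chebyshev n y)"
  proof (induction n)
    case (Suc n)
    have "(t / 4) ^ Suc n \<le> t / 4 * v (chebyshev n y)" using Suc t by simp
    then show ?case using step[of n] by linarith
  qed (simp add: v_1)
  then have "4 ^ n * (t / 4) ^ n \<le> 4 ^ n * max 1 (v (chebyshev n y))" by (intro mult_left_mono) auto
  then have "t ^ n \<le> 4 ^ n * max 1 (v (chebyshev n y))" by (simp flip: power_mult_distrib)
  then show ?thesis using t by (simp add: t_def max_def)
qed

text \<open>At the remaining, infinitely many places the constant has to be 1. For v y > 1 the
  values increase strictly, so 2 y times the previous polynomial dominates the recurrence and each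
  step gains the full factor v y.\<close>

lemma (in absolute_value) chebyshev_lower_bound_ultrametric:
  assumes y: "y \<in> K" and two: "v 2 = 1" and ultra: "\<And>a b. a \<in> K \<Longrightarrow> b \<in> K \<Longrightarrow> v (a + b) \<le> max (v a) (v b)"
  shows "max 1 (v y) ^ n \<le> max 1 (v (chebyshev n y))"
proof (cases "v y \<le> 1")
  case True
  then show ?thesis by (simp add: max_def)
next
  case False
  define t where "t = v y"
  have t: "1 < t" using False by (simp add: t_def)
  have step: "t * v (chebyshev k y) \<le> v (chebyshev (Suc k) y) \<and> 0 < v (chebyshev k y)" for k
  proof (induction k)
    case 0
    then show ?case by (simp add: v_1 t_def)
  next
    case (Suc k)
    define a b where "a = v (chebyshev k y)" and "b = v (chebyshev (Suc k) y)"
    have a0: "0 < a" and tab: "t * a \<le> b" using Suc by (auto simp: a_def b_def)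
    have "1 * a < t * a" using t a0 by (intro mult_strict_right_mono)
    then have ab: "a < b" using tab by simp
    then have b0: "0 < b" using a0 by simp
    have v: "v (2 * y * chebyshev (Suc k) y) = t * b"
      using y two by (simp add: v_mult mult numeral chebyshev_closed t_def b_def)
    have "v (chebyshev (Suc (Suc k)) y + chebyshev k y) \<le> max (v (chebyshev (Suc (Suc k)) y)) a"
      unfolding a_def using y by (intro ultra chebyshev_closed)
    then have "t * b \<le> max (v (chebyshev (Suc (Suc k)) y)) a" using v by simp
    moreover have "1 * b < t * b" using t b0 by (intro mult_strict_right_mono)
    ultimately show ?case using ab b0 unfolding b_def by linarith
  qed
  have "t ^ n \<le> v (chebyshev n y)"
  proof (induction n)
    case (Suc n)
    have "t ^ Suc n \<le> t * v (chebyshev n y)" using Suc t by simp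
    then show ?case using step[of n] by linarith
  qed (simp add: v_1)
  then show ?thesis using t by (simp add: t_def max_def)
qed

context number_field_basis
begin

lemma height_chebyshev:
  "\<exists>D. \<forall>y\<in>K. height K y ^ n \<le> D * height K (chebyshev n y)"
proof -
  \<comment> \<open>Powers of 2 are the leading coefficients of Chebyshev polynomials, so the
    archimedean and dyadic places are the exceptional ones.\<close>
  have "height K y ^ n \<le> (\<Prod>v\<in>bad_places 2. (4 ^ n) ^ local_degree K v) * height K (chebyshev n y)"
    if y: "y \<in> K" for y
  proof (rule height_compare[OF y chebyshev_closed[OF y] finite_bad_places bad_places_subset])
    show "(2::int) \<noteq> 0" by simp
    fix v assume v: "v \<in> canonical_abs K"
    interpret absolute_value K v using canonical_absolute_value[OF v] .
    show "max 1 (v y) ^ n \<le> (if v \<in> bad_places 2 then 4 ^ n else 1) * max 1 (v (chebyshev n y))"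
    proof (cases "v \<in> bad_places 2")
      case True
      have "1 / 2 \<le> v 2"
      proof (cases "v \<in> extensions K arch_abs")
        case True
        then show ?thesis using arch_extension_of_nat[of v 2] by simp
      next
        case False
        then obtain p where p: "prime p" "int p dvd 2" "v \<in> extensions K (padic_abs p)"
          using \<open>v \<in> bad_places 2\<close> by (auto simp: bad_places_def)
        then have "p \<le> 2" by (metis dvd_imp_le int_dvd_int_iff of_nat_numeral zero_less_numeral)
        then have "p = 2" using prime_ge_2_nat[OF p(1)] by simp
        then have "padic_abs 2 (of_int 2) = 1 / 2" using padic_abs_prime[OF p(1)] by simp
        then show ?thesis using padic_extension_of_int[OF p(3), of 2] \<open>p = 2\<close> by simp
      qed
      then show ?thesis using chebyshev_lower_bound[OF y] True by simp
    next
      case False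
      then obtain p where p: "prime p" "v \<in> extensions K (padic_abs p)" "\<not> int p dvd 2"
        using good_placeE[OF v False] by blast
      have "v 2 = 1" using padic_extension_of_int[OF p(2), of 2] padic_abs_unit[OF p(3)] by simp
      then show ?thesis
        using chebyshev_lower_bound_ultrametric[OF y _ padic_extension_ultrametric[OF p(1,2)]] False by simp
    qed
  qed
  then show ?thesis by blast
qed

lemma height_affine:
  assumes M: "0 < M"
  shows "\<exists>c\<ge>1. \<forall>y\<in>K. \<forall>j<M. height K ((y + of_nat (3 * j)) / of_nat (3 * M)) \<le> c * height K y"
proof -
  define s where "s v = (\<Sum>j<M. v (of_nat (3 * j) :: 'a))" for v :: "'a \<Rightarrow> real"
  \<comment> \<open>Summing all shifts in \<open>s\<close> makes the constant uniform in j, and the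
    maximum with 1 gives c \<ge> 1.\<close>
  define C where "C v = max 1 (inverse (v (of_nat (3 * M))) * (1 + s v))" for v :: "'a \<Rightarrow> real"
  define S where "S = bad_places (int (3 * M))"
  define c where "c = (\<Prod>v\<in>S. C v ^ local_degree K v)"
  have "height K ((y + of_nat (3 * j)) / of_nat (3 * M)) ^ 1 \<le> c * height K y"
    if y: "y \<in> K" and j: "j < M" for y j
    unfolding c_def
  proof (rule height_compare)
    show "finite S" unfolding S_def using M by (intro finite_bad_places) auto
    show "S \<subseteq> canonical_abs K" unfolding S_def by (rule bad_places_subset)
    show "(y + of_nat (3 * j)) / of_nat (3 * M) \<in> K" using y by (intro divide add of_nat)
    show "y \<in> K" by fact
    fix v assume v: "v \<in> canonical_abs K"
    interpret absolute_value K v using canonical_absolute_value[OF v] .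
    have vx: "v ((y + of_nat (3 * j)) / of_nat (3 * M)) = inverse (v (of_nat (3 * M))) * v (y + of_nat (3 * j))"
      by (simp only: v_divide[OF add[OF y of_nat] of_nat]) (simp add: divide_inverse mult.commute)
    show "max 1 (v ((y + of_nat (3 * j)) / of_nat (3 * M))) ^ 1 \<le> (if v \<in> S then C v else 1) * max 1 (v y)"
    proof (cases "v \<in> S")
      case True
      have "v (of_nat (3 * j)) \<le> s v"
        unfolding s_def using j by (intro member_le_sum nonneg of_nat) auto
      moreover have s0: "0 \<le> s v" unfolding s_def by (intro sum_nonneg nonneg of_nat)
      moreover have "v (y + of_nat (3 * j)) \<le> v y + v (of_nat (3 * j))" using y by (intro v_add of_nat)
      moreover have "s v * 1 \<le> s v * max 1 (v y)" using s0 by (intro mult_left_mono) auto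
      ultimately have "v (y + of_nat (3 * j)) \<le> (1 + s v) * max 1 (v y)"
        by (simp only: distrib_right mult_1_left mult_1_right)
      then have "v ((y + of_nat (3 * j)) / of_nat (3 * M)) \<le> inverse (v (of_nat (3 * M))) * ((1 + s v) * max 1 (v y))"
        unfolding vx using nonneg[OF of_nat, of "3 * M"] by (intro mult_left_mono) auto
      also have "\<dots> \<le> C v * max 1 (v y)"
        unfolding C_def mult.assoc[symmetric] by (intro mult_right_mono) auto
      finally have "v ((y + of_nat (3 * j)) / of_nat (3 * M)) \<le> C v * max 1 (v y)" .
      moreover have "1 * 1 \<le> C v * max 1 (v y)" by (intro mult_mono) (auto simp: C_def)
      ultimately show ?thesis using True by simp
    next
      case False
      then obtain p where p: "prime p" "v \<in> extensions K (padic_abs p)" "\<not> int p dvd int (3 * M)"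
        using good_placeE[OF v] unfolding S_def by blast
      have "v (of_nat (3 * M)) = 1"
        using padic_extension_of_int[OF p(2), of "int (3 * M)"] padic_abs_unit[OF p(3)] by simp
      then have "v ((y + of_nat (3 * j)) / of_nat (3 * M)) = v (y + of_nat (3 * j))" using vx by simp
      also have "\<dots> \<le> max (v y) (v (of_nat (3 * j)))"
        using y by (intro padic_extension_ultrametric[OF p(1,2)] of_nat)
      also have "\<dots> \<le> max 1 (v y)" using padic_extension_of_nat_le[OF p(1,2), of "3 * j"] by linarith
      finally show ?thesis using False by simp
    qed
  qed
  then have "height K ((y + of_nat (3 * j)) / of_nat (3 * M)) \<le> c * height K y" if "y \<in> K" "j < M" for y j
    using that by simp
  moreover have "1 \<le> c" unfolding c_def by (intro prod_ge_1 one_le_power) (simp add: C_def)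
  ultimately show ?thesis by blast
qed

end


section \<open>Density\<close>

locale real_number_field = number_field_basis K Bs for K :: "real set" and Bs
begin

definition count :: "real \<Rightarrow> nat" where
  "count B = card ({-1..1} \<inter> bounded_height K B)"

lemma finite_count: "finite ({-1..1} \<inter> bounded_height K B)"
  using northcott by blast

lemma count_pos:
  assumes "1 \<le> B"
  shows "0 < count B"
proof -
  have "0 \<in> {-1..1} \<inter> bounded_height K B" using assms zero by (simp add: bounded_height_def height_0)
  then show ?thesis unfolding count_def using finite_count card_gt_0_iff by blast
qed

text \<open>
  The maps \<open>y \<mapsto> (y + 3 j) / (3 M)\<close> for \<open>j < M\<close> send \<open>[-1, 1]\<close> to disjoint subintervals and
  increase heights by a bounded factor only.
\<close>

lemma count_growth:
  assumes M: "0 < M"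
  shows "\<exists>c\<ge>1. \<forall>B. M * count (B / c) \<le> count B"
proof -
  obtain c where c: "c \<ge> 1" "\<And>y j. y \<in> K \<Longrightarrow> j < M \<Longrightarrow> height K ((y + real (3 * j)) / real (3 * M)) \<le> c * height K y"
    using height_affine[OF M] by blast
  have "M * count (B / c) \<le> count B" for B
  proof -
    let ?A = "{-1..1} \<inter> bounded_height K (B / c)"
    define g where "g = (\<lambda>(j, y). (y + real (3 * j)) / real (3 * M))"
    have "inj_on g ({..<M} \<times> ?A)"
    proof (rule inj_onI)
      fix a b assume a: "a \<in> {..<M} \<times> ?A" and b: "b \<in> {..<M} \<times> ?A" and eq: "g a = g b"
      obtain i y where iy: "a = (i, y)" by fastforce
      obtain j z where jz: "b = (j, z)" by fastforce
      have "y + 3 * real i = z + 3 * real j" using eq M by (simp add: g_def iy jz)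
      moreover have "-1 \<le> y" "y \<le> 1" "-1 \<le> z" "z \<le> 1" using a b by (auto simp: iy jz)
      \<comment> \<open>The spacing 3 exceeds the length 2 of [-1, 1], which makes the images
        disjoint.\<close>
      ultimately have "\<bar>real i - real j\<bar> < 1" by linarith
      then have "i = j" by linarith
      then show "a = b" using \<open>y + 3 * real i = z + 3 * real j\<close> by (simp add: iy jz)
    qed
    then have "card (g ` ({..<M} \<times> ?A)) = M * count (B / c)"
      by (simp add: card_image card_cartesian_product count_def)
    moreover have "g ` ({..<M} \<times> ?A) \<subseteq> {-1..1} \<inter> bounded_height K B"
    proof
      fix x assume "x \<in> g ` ({..<M} \<times> ?A)"
      then obtain j y where jy: "j < M" "y \<in> ?A" "x = (y + real (3 * j)) / real (3 * M)" by (auto simp: g_def)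
      then have y: "-1 \<le> y" "y \<le> 1" "y \<in> K" "height K y \<le> B / c" by (auto simp: bounded_height_def)
      have "real j + 1 \<le> real M" using jy(1) by simp
      then have "x \<in> {-1..1}" using y M unfolding jy(3) by (simp add: field_simps)
      moreover have "x \<in> K" unfolding jy(3) using y(3) by (intro divide add of_nat)
      moreover have "height K x \<le> c * height K y" unfolding jy(3) using c(2)[OF y(3) jy(1)] .
      moreover have "c * height K y \<le> B" using y(4) c(1) by (simp add: field_simps)
      ultimately show "x \<in> {-1..1} \<inter> bounded_height K B" by (simp add: bounded_height_def)
    qed
    ultimately show ?thesis
      unfolding count_def using card_mono[OF finite_count] by metis
  qed
  then show ?thesis using c(1) by blast
qed

lemma density_power_of_two: "has_density K (Sect (2 ^ k)) {-1..1} 1"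
proof -
  have "density_upto K (Sect (2 ^ k)) {-1..1} B = 1" if "1 \<le> B" for B
    using count_pos[OF that] by (simp add: density_upto_def Sect_power_of_two count_def)
  then have "eventually (\<lambda>B. density_upto K (Sect (2 ^ k)) {-1..1} B = 1) at_top"
    using eventually_ge_at_top by (rule eventually_mono[rotated])
  then show ?thesis unfolding has_density_def by (rule tendsto_eventually)
qed

lemma density_odd_factor:
  assumes n: "odd n" "n \<noteq> 1"
  shows "has_density K (Sect (l * n)) {-1..1} 0"
proof -
  obtain D where D: "\<And>y. y \<in> K \<Longrightarrow> height K y ^ n \<le> D * height K (chebyshev n y)"
    using height_chebyshev by blast
  have D0: "0 \<le> D"
    using D[OF zero] height_ge_1[OF zero] height_ge_1[OF chebyshev_closed[OF zero], of n]
    by (smt (verit) mult_nonneg_nonneg mult_neg_pos one_le_power)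
  have n2: "2 \<le> n" using n by (cases n) (auto elim: oddE)
  \<comment> \<open>The threshold is chosen for this contradiction: if H(y) > B / c, then D B \<le>
    (B / c)^2 < H(y)^2 \<le> H(y)^n \<le> D H(x) \<le> D B.\<close>
  have sub: "Sect (l * n) \<inter> bounded_height K B \<subseteq> chebyshev n ` ({-1..1} \<inter> bounded_height K (B / c))"
    if B: "1 \<le> B" "D * c\<^sup>2 \<le> B" and c: "1 \<le> c" for B c
  proof
    fix x assume "x \<in> Sect (l * n) \<inter> bounded_height K B"
    then have x: "x \<in> Sect (l * n)" "x \<in> K" "height K x \<le> B" by (auto simp: bounded_height_def)
    obtain y where y: "y \<in> K" "y \<in> {-1..1}" "chebyshev n y = x"
      using Sect_subset_chebyshev[OF field_set_axioms x(1,2) n(1)] by blast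
    have "height K y \<le> B / c"
    proof (rule ccontr)
      assume "\<not> ?thesis"
      then have less: "B / c < height K y" by simp
      have "D * B = (D * c\<^sup>2) * B / c\<^sup>2" using c by simp
      also have "\<dots> \<le> B * B / c\<^sup>2" using B c by (intro divide_right_mono mult_right_mono) auto
      also have "\<dots> = (B / c)\<^sup>2" by (simp add: power2_eq_square)
      also have "\<dots> < height K y ^ 2" using less B c by (intro power_strict_mono) auto
      also have "\<dots> \<le> height K y ^ n" using n2 height_ge_1[OF y(1)] by (intro power_increasing)
      also have "\<dots> \<le> D * height K x" using D[OF y(1)] y(3) by simp
      also have "\<dots> \<le> D * B" using x(3) D0 by (intro mult_left_mono)
      finally show False by simp
    qed
    then show "x \<in> chebyshev n ` ({-1..1} \<inter> bounded_height K (B / c))"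
      using y by (intro image_eqI[of _ _ y]) (auto simp: bounded_height_def)
  qed
  have "(density_upto K (Sect (l * n)) {-1..1} \<longlongrightarrow> 0) at_top"
  proof (rule tendstoI)
    fix e :: real assume "0 < e"
    then obtain M :: nat where M: "0 < M" "1 / real M < e"
      using ex_inverse_of_nat_less[of e] by (auto simp: inverse_eq_divide)
    obtain c where c: "1 \<le> c" "\<And>B. M * count (B / c) \<le> count B" using count_growth[OF M(1)] by blast
    have "dist (density_upto K (Sect (l * n)) {-1..1} B) 0 < e" if B: "1 \<le> B" "D * c\<^sup>2 \<le> B" for B
    proof -
      have "card (Sect (l * n) \<inter> bounded_height K B) \<le> count (B / c)"
        unfolding count_def using sub[OF B c(1)] finite_count by (rule surj_card_le[rotated])
      then have "real (card (Sect (l * n) \<inter> bounded_height K B)) * real M \<le> real (count B)"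
        using c(2)[of B] mult_right_mono by (metis (no_types, lifting) le_trans mult.commute mult_le_mono2 of_nat_le_iff of_nat_mult)
      then have "density_upto K (Sect (l * n)) {-1..1} B \<le> 1 / real M"
        using count_pos[OF B(1)] M(1) by (simp add: density_upto_def count_def field_simps)
      moreover have "0 \<le> density_upto K (Sect (l * n)) {-1..1} B" by (simp add: density_upto_def)
      ultimately show ?thesis using M(2) by simp
    qed
    moreover have "eventually (\<lambda>B. 1 \<le> B \<and> D * c\<^sup>2 \<le> B) at_top"
      by (intro eventually_conj eventually_ge_at_top)
    ultimately show "eventually (\<lambda>B. dist (density_upto K (Sect (l * n)) {-1..1} B) 0 < e) at_top"
      by (auto elim: eventually_mono)
  qed
  then show ?thesis by (simp add: has_density_def)
qed

end

theorem theorem1p2: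
  fixes K :: "real set" and m :: nat
  assumes "number_field K" and "m > 0"
  shows "has_density K (Sect m) {-1..1} (if \<exists>k. m = 2 ^ k then 1 else 0)"
proof -
  obtain Bs where "number_field_basis K Bs" using number_field_basis[OF assms(1)] by blast
  then interpret real_number_field K Bs by (simp add: real_number_field_def)
  show ?thesis
  proof (cases "\<exists>k. m = 2 ^ k")
    case True
    then show ?thesis using density_power_of_two by auto
  next
    case False
    obtain n where n: "m = 2 ^ multiplicity 2 m * n" "odd n"
      using multiplicity_decompose'[of m 2] assms(2) by auto
    then have "n \<noteq> 1" using False by auto
    then have "has_density K (Sect (2 ^ multiplicity 2 m * n)) {-1..1} 0"
      using density_odd_factor[OF n(2)] by blast
    then show ?thesis using False by (simp flip: n(1))
  qed
qed

end
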